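(* Assume $T$ is NIP, working in a monster model. Let $X_1,\ldots,X_n$ be quasi-minimal definable sets of dp-ranks $r_1,\ldots,r_n$ respectively, and let $Y\subseteq X_1\times\cdots\times X_n$ be definable. Then $Y$ is broad if and only if $\operatorname{dp-rk}(Y)=r_1+\cdots+r_n$.
   Context: A definable set $D$ is quasi-minimal if $D$ has finite dp-rank $m>0$ and every definable subset of $D$ has dp-rank $0$ or $m$. For definable $X_1,\ldots,X_n$ and type-definable $Y\subseteq X_1\times\cdots\times X_n$, $Y$ is broad if there exist elements $a_{i,j}\in X_i$ ($1\le i\le n$, $j\in\mathbb{N}$) such that for each fixed $i$ the $a_{i,j}$ are pairwise distinct, and for every function $\eta:[n]\to\mathbb{N}$ the tuple $(a_{1,\eta(1)},\ldots,a_{n,\eta(n)})$ lies in $Y$. *)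

theory Defs
  imports Main "HOL-Library.Extended_Nat"
begin

unbundle cardinal_syntax

section \<open>First-order logic\<close>

record ('f, 'r) language =
  Funs :: "'f set"
  Rels :: "'r set"
  farity :: "'f \<Rightarrow> nat"
  rarity :: "'r \<Rightarrow> nat"

datatype 'f tm = Var nat | App 'f "'f tm list"

datatype ('f, 'r) fm =
    Equal "'f tm" "'f tm"
  | Atom 'r "'f tm list"
  | Neg "('f, 'r) fm"
  | Conj "('f, 'r) fm" "('f, 'r) fm"
  | Exists nat "('f, 'r) fm"

primrec wf_tm :: "('f, 'r) language \<Rightarrow> 'f tm \<Rightarrow> bool" where
  "wf_tm L (Var v) = True"
| "wf_tm L (App f ts) =
     (f \<in> Funs L \<and> length ts = farity L f \<and> list_all (wf_tm L) ts)"

primrec wf_fm :: "('f, 'r) language \<Rightarrow> ('f, 'r) fm \<Rightarrow> bool" where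
  "wf_fm L (Equal s t) = (wf_tm L s \<and> wf_tm L t)"
| "wf_fm L (Atom r ts) = (r \<in> Rels L \<and> length ts = rarity L r \<and> list_all (wf_tm L) ts)"
| "wf_fm L (Neg \<phi>) = wf_fm L \<phi>"
| "wf_fm L (Conj \<phi> \<psi>) = (wf_fm L \<phi> \<and> wf_fm L \<psi>)"
| "wf_fm L (Exists v \<phi>) = wf_fm L \<phi>"

primrec fv_tm :: "'f tm \<Rightarrow> nat set" where
  "fv_tm (Var v) = {v}"
| "fv_tm (App f ts) = \<Union> (set (map fv_tm ts))"

primrec fv_fm :: "('f, 'r) fm \<Rightarrow> nat set" where
  "fv_fm (Equal s t) = fv_tm s \<union> fv_tm t"
| "fv_fm (Atom r ts) = (\<Union>t\<in>set ts. fv_tm t)"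
| "fv_fm (Neg \<phi>) = fv_fm \<phi>"
| "fv_fm (Conj \<phi> \<psi>) = fv_fm \<phi> \<union> fv_fm \<psi>"
| "fv_fm (Exists v \<phi>) = fv_fm \<phi> - {v}"

text \<open>The universe of a structure is the whole type \<open>'a\<close>. Interpretations are constrained only at
  symbols of the language and at argument lists of the correct length; other values are never
  inspected by well-formed formulas.\<close>

record ('f, 'r, 'a) struct =
  interp_fun :: "'f \<Rightarrow> 'a list \<Rightarrow> 'a"
  interp_rel :: "'r \<Rightarrow> 'a list \<Rightarrow> bool"

primrec eval_tm :: "('f, 'r, 'a) struct \<Rightarrow> (nat \<Rightarrow> 'a) \<Rightarrow> 'f tm \<Rightarrow> 'a" where
  "eval_tm M e (Var v) = e v"
| "eval_tm M e (App f ts) = interp_fun M f (map (eval_tm M e) ts)"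

primrec sat :: "('f, 'r, 'a) struct \<Rightarrow> (nat \<Rightarrow> 'a) \<Rightarrow> ('f, 'r) fm \<Rightarrow> bool" where
  "sat M e (Equal s t) = (eval_tm M e s = eval_tm M e t)"
| "sat M e (Atom r ts) = interp_rel M r (map (eval_tm M e) ts)"
| "sat M e (Neg \<phi>) = (\<not> sat M e \<phi>)"
| "sat M e (Conj \<phi> \<psi>) = (sat M e \<phi> \<and> sat M e \<psi>)"
| "sat M e (Exists v \<phi>) = (\<exists>x. sat M (e(v := x)) \<phi>)"

text \<open>\<open>formulas L p\<close> is the set of \<open>L\<close>-formulas \<open>\<phi>(x\<^sub>0, \<dots>, x\<^bsub>p-1\<^esub>)\<close>, and \<open>holds M \<phi> xs\<close> says that such a
  formula is true of a tuple \<open>xs\<close> of length \<open>p\<close>. A partitioned formula \<open>\<phi>(x; y)\<close> with \<open>|x| = k\<close> and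
  \<open>|y| = l\<close> is an element of \<open>formulas L (k + l)\<close>, evaluated at the concatenation \<open>a @ b\<close>.\<close>

definition formulas :: "('f, 'r) language \<Rightarrow> nat \<Rightarrow> ('f, 'r) fm set" where
  "formulas L p = {\<phi>. wf_fm L \<phi> \<and> fv_fm \<phi> \<subseteq> {..<p}}"

definition holds :: "('f, 'r, 'a) struct \<Rightarrow> ('f, 'r) fm \<Rightarrow> 'a list \<Rightarrow> bool" where
  "holds M \<phi> xs = sat M (\<lambda>i. xs ! i) \<phi>"

section \<open>Monster models\<close>

definition automorphism :: "('f, 'r) language \<Rightarrow> ('f, 'r, 'a) struct \<Rightarrow> ('a \<Rightarrow> 'a) \<Rightarrow> bool" where
  "automorphism L M g \<longleftrightarrow> bij g \<and>
     (\<forall>f\<in>Funs L. \<forall>xs. length xs = farity L f \<longrightarrow>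
        g (interp_fun M f xs) = interp_fun M f (map g xs)) \<and>
     (\<forall>r\<in>Rels L. \<forall>xs. length xs = rarity L r \<longrightarrow>
        interp_rel M r (map g xs) = interp_rel M r xs)"

definition partial_elementary ::
  "('f, 'r) language \<Rightarrow> ('f, 'r, 'a) struct \<Rightarrow> 'a set \<Rightarrow> ('a \<Rightarrow> 'a) \<Rightarrow> bool" where
  "partial_elementary L M A g \<longleftrightarrow>
     (\<forall>b \<phi>. set b \<subseteq> A \<and> \<phi> \<in> formulas L (length b) \<longrightarrow> holds M \<phi> (map g b) = holds M \<phi> b)"

text \<open>A partial 1-type over \<open>A\<close> is a set \<open>p\<close> of pairs \<open>(\<phi>, b)\<close>, standing for the formulas \<open>\<phi>(x; b)\<close> with
  parameters \<open>b\<close> from \<open>A\<close>.\<close>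

definition saturated ::
  "'k rel \<Rightarrow> ('f, 'r) language \<Rightarrow> ('f, 'r, 'a) struct \<Rightarrow> bool" where
  "saturated \<kappa> L M \<longleftrightarrow>
     (\<forall>A p. |A| <o \<kappa> \<and>
        (\<forall>(\<phi>, b)\<in>p. set b \<subseteq> A \<and> \<phi> \<in> formulas L (1 + length b)) \<and>
        (\<forall>q\<subseteq>p. finite q \<longrightarrow> (\<exists>x. \<forall>(\<phi>, b)\<in>q. holds M \<phi> ([x] @ b))) \<longrightarrow>
        (\<exists>x. \<forall>(\<phi>, b)\<in>p. holds M \<phi> ([x] @ b)))"

definition strongly_homogeneous ::
  "'k rel \<Rightarrow> ('f, 'r) language \<Rightarrow> ('f, 'r, 'a) struct \<Rightarrow> bool" where
  "strongly_homogeneous \<kappa> L M \<longleftrightarrow>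
     (\<forall>A g. |A| <o \<kappa> \<and> partial_elementary L M A g \<longrightarrow>
        (\<exists>h. automorphism L M h \<and> (\<forall>x\<in>A. h x = g x)))"

text \<open>The cardinal \<open>\<kappa>\<close> is the bound for small sets; the only largeness imposed on it is
  \<open>\<kappa> > |L| + \<aleph>\<^sub>0\<close>. The theory \<open>T\<close> is the complete \<open>L\<close>-theory of \<open>M\<close>.\<close>

definition monster_model ::
  "'k rel \<Rightarrow> ('f, 'r) language \<Rightarrow> ('f, 'r, 'a) struct \<Rightarrow> bool" where
  "monster_model \<kappa> L M \<longleftrightarrow>
     Card_order \<kappa> \<and> natLeq <o \<kappa> \<and> |Funs L <+> Rels L| <o \<kappa> \<and>
     saturated \<kappa> L M \<and> strongly_homogeneous \<kappa> L M"

section \<open>NIP\<close>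

text \<open>\<open>\<phi>(x; y)\<close> has the independence property if it shatters sets of every finite size. For each size
  this is a first-order sentence, so it depends only on \<open>T = Th(M)\<close>.\<close>

definition has_IP ::
  "('f, 'r, 'a) struct \<Rightarrow> nat \<Rightarrow> nat \<Rightarrow> ('f, 'r) fm \<Rightarrow> bool" where
  "has_IP M k l \<phi> \<longleftrightarrow>
     (\<forall>n::nat. \<exists>(a :: nat \<Rightarrow> 'a list) (b :: nat set \<Rightarrow> 'a list).
        (\<forall>i<n. length (a i) = k) \<and> (\<forall>S\<subseteq>{..<n}. length (b S) = l) \<and>
        (\<forall>i<n. \<forall>S\<subseteq>{..<n}. holds M \<phi> (a i @ b S) \<longleftrightarrow> i \<in> S))"

definition NIP :: "('f, 'r) language \<Rightarrow> ('f, 'r, 'a) struct \<Rightarrow> bool" where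
  "NIP L M \<longleftrightarrow> (\<forall>k l. \<forall>\<phi>\<in>formulas L (k + l). \<not> has_IP M k l \<phi>)"

section \<open>Definable sets and dp-rank\<close>

text \<open>\<open>definable L M k D\<close>: the set \<open>D \<subseteq> M\<^sup>k\<close> is definable with parameters.\<close>

definition definable ::
  "('f, 'r) language \<Rightarrow> ('f, 'r, 'a) struct \<Rightarrow> nat \<Rightarrow> 'a list set \<Rightarrow> bool" where
  "definable L M k D \<longleftrightarrow>
     (\<exists>b. \<exists>\<phi>\<in>formulas L (k + length b). D = {a. length a = k \<and> holds M \<phi> (a @ b)})"

text \<open>An ict-pattern of depth \<open>m\<close> in \<open>D \<subseteq> M\<^sup>k\<close>: formulas \<open>\<phi>\<^sub>i(x; y\<^sub>i)\<close> and parameters \<open>b\<^bsub>i,j\<^esub>\<close>, for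
  \<open>i < m\<close> and \<open>j \<in> \<nat>\<close>, such that for all \<open>\<eta>\<close> some \<open>a \<in> D\<close> satisfies
  \<open>\<phi>\<^sub>i(a; b\<^bsub>i,j\<^esub>) \<longleftrightarrow> j = \<eta>(i)\<close> for all \<open>i\<close>, \<open>j\<close>. Only the values of \<open>\<eta>\<close> below \<open>m\<close> matter.\<close>

definition has_ict_pattern ::
  "('f, 'r) language \<Rightarrow> ('f, 'r, 'a) struct \<Rightarrow> nat \<Rightarrow> 'a list set \<Rightarrow> nat \<Rightarrow> bool" where
  "has_ict_pattern L M k D m \<longleftrightarrow>
     (\<exists>(\<phi> :: nat \<Rightarrow> ('f, 'r) fm) (l :: nat \<Rightarrow> nat) (b :: nat \<Rightarrow> nat \<Rightarrow> 'a list).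
        (\<forall>i<m. \<phi> i \<in> formulas L (k + l i) \<and> (\<forall>j. length (b i j) = l i)) \<and>
        (\<forall>\<eta> :: nat \<Rightarrow> nat. \<exists>a\<in>D. \<forall>i<m. \<forall>j. holds M (\<phi> i) (a @ b i j) \<longleftrightarrow> j = \<eta> i))"

text \<open>The value \<open>\<infinity>\<close> means that there are patterns of arbitrarily large finite depth, that is, that the
  dp-rank is not finite. The empty set gets dp-rank 0 here (rather than \<open>-\<infinity>\<close>), so that it is not
  an exception to the condition on subsets in the definition of quasi-minimality.\<close>

definition dp_rank ::
  "('f, 'r) language \<Rightarrow> ('f, 'r, 'a) struct \<Rightarrow> nat \<Rightarrow> 'a list set \<Rightarrow> enat" where
  "dp_rank L M k D = (SUP m\<in>{m. has_ict_pattern L M k D m}. enat m)"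

definition quasi_minimal ::
  "('f, 'r) language \<Rightarrow> ('f, 'r, 'a) struct \<Rightarrow> nat \<Rightarrow> 'a list set \<Rightarrow> bool" where
  "quasi_minimal L M k D \<longleftrightarrow> definable L M k D \<and>
     (\<exists>m::nat. m > 0 \<and> dp_rank L M k D = enat m \<and>
        (\<forall>E. definable L M k E \<and> E \<subseteq> D \<longrightarrow> dp_rank L M k E = 0 \<or> dp_rank L M k E = enat m))"

section \<open>Products and broad sets\<close>

text \<open>Families are indexed by \<open>{..<n}\<close> instead of \<open>{1..n}\<close>. The product \<open>X\<^sub>0 \<times> \<dots> \<times> X\<^bsub>n-1\<^esub>\<close> of sets
  \<open>X\<^sub>i \<subseteq> M\<^bsup>k i\<^esup>\<close> is a subset of \<open>M\<^bsup>k 0 + \<dots> + k (n-1)\<^esup>\<close>, a tuple of tuples being identified with its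
  concatenation.\<close>

definition join :: "nat \<Rightarrow> (nat \<Rightarrow> 'a list) \<Rightarrow> 'a list" where
  "join n x = concat (map x [0..<n])"

definition product :: "nat \<Rightarrow> (nat \<Rightarrow> 'a list set) \<Rightarrow> 'a list set" where
  "product n X = {join n x | x. \<forall>i<n. x i \<in> X i}"

definition broad :: "nat \<Rightarrow> (nat \<Rightarrow> 'a list set) \<Rightarrow> 'a list set \<Rightarrow> bool" where
  "broad n X Y \<longleftrightarrow>
     (\<exists>a :: nat \<Rightarrow> nat \<Rightarrow> 'a list.
        (\<forall>i<n. (\<forall>j. a i j \<in> X i) \<and> inj (a i)) \<and>
        (\<forall>\<eta> :: nat \<Rightarrow> nat. join n (\<lambda>i. a i (\<eta> i)) \<in> Y))"

end

theory Submission
  imports Defs "HOL-Library.Ramsey" "HOL-Library.Countable_Set"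
begin

text \<open>
  Ramsey's theorem and compactness replace indiscernible sequences. Working with finite grids of
  parameters, an ict-pattern of depth \<open>N\<close> in a set \<open>Z\<close> of pairs \<open>(y, x)\<close> is split as follows. After
  thinning out the rows, the truth value of the formula ``some \<open>y\<close> with \<open>(y, x) \<in> Z\<close> realizes the
  rows in \<open>S\<close> at the given parameters'' depends only on the set \<open>A\<close> of rows in \<open>S\<close> at which the
  parameter is the one selected by the path of \<open>x\<close>, the other parameters being further to the right.
  Let \<open>Q\<close> be a maximal set of rows for which membership in \<open>A\<close> never matters. Then the rows in \<open>Q\<close>
  form a pattern in a single fibre over \<open>x\<close>, while every row outside \<open>Q\<close> is broken by \<open>x\<close> itself
  with the help of selected parameters from \<open>Q\<close> only, so that these rows form a pattern for \<open>x\<close>.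
  This gives subadditivity of the dp-rank. If the rank of \<open>Z\<close> is the full sum, then independent
  elements of one fibre show that \<open>{(x, y\<^sub>1, \<dots>, y\<^sub>m)}\<close> with distinct \<open>y\<^sub>t\<close> and \<open>(y\<^sub>t, x) \<in> Z\<close> has full
  rank too. Iterating over all factors of the product yields an \<open>m \<times> \<dots> \<times> m\<close> grid in \<open>Y\<close> for each
  \<open>m\<close>, whence \<open>Y\<close> is broad.

  Conversely, the sequences witnessing that \<open>Y\<close> is broad are ict-patterns of depth 1 for the formula
  \<open>x = y\<close>. One after the other they are replaced by patterns of depth \<open>r\<^sub>i\<close>. By NIP there is a number
  \<open>D\<close> such that each sufficiently large grid in the other factors contains \<open>D\<close> points and \<open>D\<close> large
  subgrids with the property that any \<open>y\<close> compatible with all the points is compatible with one of the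
  subgrids entirely. Compactness makes the points independent of the size of the grids, and the
  elements of \<open>X\<^sub>i\<close> compatible with them form an infinite definable set, which has rank \<open>r\<^sub>i\<close> by
  quasi-minimality.
\<close>

section \<open>Product Ramsey theorem\<close>

text \<open>Reduction to the usual Ramsey theorem: \<open>w\<close> points in each of
  \<open>R\<close> rows are coded as one set of \<open>R * w\<close> numbers. A homogeneous set of
  size \<open>R * k\<close> is cut into \<open>R\<close> consecutive blocks of length
  \<open>k\<close>, one per row, so that increasing choices inside the blocks are decoded
  correctly.\<close>

lemma product_ramsey:
  fixes I :: "'i set" and C :: "'c set" and w k :: nat
  assumes "finite I" "finite C"
  obtains N :: nat where
    "k \<le> N"
    "\<And>col :: ('i \<Rightarrow> nat \<Rightarrow> nat) \<Rightarrow> 'c.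
      (\<And>g. col g \<in> C) \<Longrightarrow>
      (\<And>g g'. (\<And>i t. i \<in> I \<Longrightarrow> t < w \<Longrightarrow> g i t = g' i t) \<Longrightarrow> col g = col g') \<Longrightarrow>
      \<exists>h v. (\<forall>i\<in>I. strict_mono_on {..<k} (h i) \<and> h i ` {..<k} \<subseteq> {..<N}) \<and>
        (\<forall>g. (\<forall>i\<in>I. strict_mono_on {..<w} (g i) \<and> g i ` {..<w} \<subseteq> {..<k}) \<longrightarrow>
           col (\<lambda>i t. h i (g i t)) = v)"
proof -
  define R where "R = card I"
  obtain \<rho> where \<rho>: "bij_betw \<rho> I {..<R}"
    using assms(1) R_def ex_bij_betw_finite_nat lessThan_atLeast0 by metis
  define \<sigma> where "\<sigma> = inv_into I \<rho>"
  have \<sigma>\<rho>: "\<sigma> (\<rho> i) = i" "\<rho> i < R" if "i \<in> I" for i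
    using that \<rho> by (auto simp: \<sigma>_def bij_betw_def)
  have \<rho>\<sigma>: "\<sigma> q \<in> I" "\<rho> (\<sigma> q) = q" if "q < R" for q
    using that \<rho> unfolding \<sigma>_def
    by (metis bij_betw_def inv_into_into lessThan_iff, metis bij_betw_def f_inv_into_f lessThan_iff)
  obtain \<gamma> where \<gamma>: "bij_betw \<gamma> C {..<card C}"
    using assms(2) ex_bij_betw_finite_nat lessThan_atLeast0 by metis
  obtain N0 where N0: "partn_lst {..<N0::nat} (replicate (card C) (R * k)) (R * w)"
    using ramsey_full by blast
  define N where "N = max N0 k"
  have N: "partn_lst {..<N} (replicate (card C) (R * k)) (R * w)"
    using partn_lst_greater_resource[OF N0] by (simp add: N_def)
  show ?thesis
  proof (rule that[of N])
    show "k \<le> N" by (simp add: N_def)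
    fix col :: "('i \<Rightarrow> nat \<Rightarrow> nat) \<Rightarrow> 'c"
    assume C: "\<And>g. col g \<in> C"
      and dep: "\<And>g g'. (\<And>i t. i \<in> I \<Longrightarrow> t < w \<Longrightarrow> g i t = g' i t) \<Longrightarrow> col g = col g'"
    \<comment> \<open>Row \<open>i\<close> sees the \<open>\<rho> i\<close>-th run of
      \<open>w\<close> elements of \<open>S\<close> in increasing order.\<close>
    define dec where "dec S = (\<lambda>i t. sorted_list_of_set S ! (\<rho> i * w + t))" for S :: "nat set"
    have "(\<lambda>S. \<gamma> (col (dec S))) \<in> nsets {..<N} (R * w) \<rightarrow> {..<card C}"
      using C \<gamma> by (auto simp: bij_betw_def)
    then obtain c H where H: "H \<in> nsets {..<N} (R * k)"
      and c: "\<And>S. S \<in> nsets H (R * w) \<Longrightarrow> \<gamma> (col (dec S)) = c"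
      by (rule partn_lstE[OF N, where l = "card C"]) (auto simp: image_subset_iff)
    have fH: "finite H" "card H = R * k" "H \<subseteq> {..<N}"
      using H by (auto simp: nsets_def)
    define e where "e = nth (sorted_list_of_set H)"
    have e_mono: "e x < e y" if "x < y" "y < R * k" for x y
      using that fH sorted_wrt_nth_less[OF strict_sorted_list_of_set[of H]]
      by (simp add: e_def)
    have e_H: "e x \<in> H" if "x < R * k" for x
      using that fH nth_mem[of x "sorted_list_of_set H"] by (simp add: e_def)
    define h where "h = (\<lambda>i x. e (\<rho> i * k + x))"
    have bound: "q * k + x < R * k" if "q < R" "x < k" for q x
    proof -
      have "q * k + x < (q + 1) * k" using that by simp
      also have "\<dots> \<le> R * k" using that by (intro mult_le_mono1) simp
      finally show ?thesis .
    qed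
    have boundw: "q * w + x < R * w" if "q < R" "x < w" for q x
    proof -
      have "q * w + x < (q + 1) * w" using that by simp
      also have "\<dots> \<le> R * w" using that by (intro mult_le_mono1) simp
      finally show ?thesis .
    qed
    have key: "\<gamma> (col (\<lambda>i t. h i (g i t))) = c"
      if g: "\<forall>i\<in>I. strict_mono_on {..<w} (g i) \<and> g i ` {..<w} \<subseteq> {..<k}" for g
    proof -
      \<comment> \<open>\<open>u\<close> runs through the points picked by \<open>g\<close> in all
        rows. Since the blocks lie one after the other, it is increasing, and decoding its range
        gives back \<open>h i (g i t)\<close>.\<close>
      define u where "u = (\<lambda>q. e ((q div w) * k + g (\<sigma> (q div w)) (q mod w)))"
      have dw: "q div w < R \<and> q mod w < w" if "q < R * w" for q
        using that by (metis less_mult_imp_div_less mod_less_divisor mult_0_right not_gr_zero not_less_zero)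
      have gk: "g (\<sigma> q) x < k" if "q < R" "x < w" for q x
        using g \<rho>\<sigma>(1)[OF that(1)] that(2) by auto
      have umono: "u p < u q" if pq: "p < q" "q < R * w" for p q
      proof -
        have p: "p div w < R" "p mod w < w" and q: "q div w < R" "q mod w < w"
          using dw[of p] dw[of q] pq by auto
        have "(p div w) * k + g (\<sigma> (p div w)) (p mod w) < (q div w) * k + g (\<sigma> (q div w)) (q mod w)"
        proof (cases "p div w = q div w")
          case True
          then have "p mod w < q mod w" using pq(1)
            by (metis div_mult_mod_eq nat_add_left_cancel_less)
          then show ?thesis using True g \<rho>\<sigma>(1)[OF q(1)] q(2)
            by (auto simp: strict_mono_on_def)
        next
          case False
          then have "p div w < q div w" using pq(1) div_le_mono[of p q w] by simp
          then have "(p div w + 1) * k \<le> (q div w) * k" by (intro mult_le_mono1) simp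
          then show ?thesis using gk[OF p] by simp
        qed
        then show ?thesis unfolding u_def using bound[OF q(1) gk[OF q]] e_mono by blast
      qed
      define S where "S = u ` {..<R * w}"
      have inj: "inj_on u {..<R * w}"
        by (rule linorder_inj_onI) (use umono in fastforce)+
      have "card S = R * w"
        using card_image[OF inj] by (simp add: S_def)
      moreover have "S \<subseteq> H"
        using dw bound gk e_H by (auto simp: S_def u_def)
      ultimately have S: "S \<in> nsets H (R * w)"
        by (simp add: S_def nsets_def)
      have "sorted_list_of_set S = map u [0..<R * w]"
      proof (rule sorted_distinct_set_unique)
        show "set (sorted_list_of_set S) = set (map u [0..<R * w])"
          by (simp add: S_def atLeast0LessThan)
        show "sorted (map u [0..<R * w])"
          using umono by (auto simp: sorted_wrt_map sorted_wrt_iff_nth_less intro: less_imp_le)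
        show "distinct (map u [0..<R * w])"
          using inj by (simp add: distinct_map atLeast0LessThan)
      qed simp_all
      then have "dec S i t = h i (g i t)" if "i \<in> I" "t < w" for i t
        using boundw[OF \<sigma>\<rho>(2)[OF that(1)] that(2)] that \<sigma>\<rho>(1)[OF that(1)]
        by (simp add: dec_def u_def h_def)
      then have "col (dec S) = col (\<lambda>i t. h i (g i t))" by (intro dep) auto
      then show ?thesis using c[OF S] by simp
    qed
    have "strict_mono_on {..<k} (h i)" "h i ` {..<k} \<subseteq> {..<N}" if "i \<in> I" for i
      using bound[OF \<sigma>\<rho>(2)[OF that]] e_mono e_H fH(3)
      by (auto simp: strict_mono_on_def h_def subset_iff)
    moreover have "col (\<lambda>i t. h i (g i t)) = inv_into C \<gamma> c"
      if "\<forall>i\<in>I. strict_mono_on {..<w} (g i) \<and> g i ` {..<w} \<subseteq> {..<k}" for g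
      using inv_into_f_f[OF bij_betw_imp_inj_on[OF \<gamma>] C, of "\<lambda>i t. h i (g i t)"] key[OF that]
      by simp
    ultimately show "\<exists>h v. (\<forall>i\<in>I. strict_mono_on {..<k} (h i) \<and> h i ` {..<k} \<subseteq> {..<N}) \<and>
        (\<forall>g. (\<forall>i\<in>I. strict_mono_on {..<w} (g i) \<and> g i ` {..<w} \<subseteq> {..<k}) \<longrightarrow>
           col (\<lambda>i t. h i (g i t)) = v)"
      by (intro exI[of _ h] exI[of _ "inv_into C \<gamma> c"] conjI ballI allI impI) simp_all
  qed
qed

text \<open>Some colour is chosen for infinitely many \<open>k\<close>, and \<open>W\<close> passes
  from larger to smaller \<open>k\<close>.\<close>

lemma finite_colour_uniform:
  fixes W :: "nat \<Rightarrow> 'c \<Rightarrow> bool"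
  assumes "finite C" "\<And>k. \<exists>c\<in>C. W k c" "\<And>k k' c. k \<le> k' \<Longrightarrow> W k' c \<Longrightarrow> W k c"
  obtains c where "c \<in> C" "\<And>k. W k c"
proof -
  obtain f where f: "\<And>k. f k \<in> C \<and> W k (f k)"
    using assms(2) by metis
  have "finite (range f)"
    using f by (intro finite_subset[OF _ assms(1)]) auto
  then obtain k0 where "infinite {k. f k = f k0}"
    using pigeonhole_infinite[of UNIV f] by auto
  then have "W k (f k0)" for k
    using f assms(3) by (metis (mono_tags, lifting) infinite_nat_iff_unbounded_le mem_Collect_eq)
  with f that show ?thesis by blast
qed

text \<open>The homogeneous value \<open>v\<close> is the same for all lengths \<open>k\<close>;
  only the thinning \<open>h\<close> varies. Later arguments can thus fix the value before the size
  of the grid.\<close>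

lemma product_ramsey_uniform:
  fixes I :: "'i set" and C :: "'c set" and w :: nat and col :: "('i \<Rightarrow> nat \<Rightarrow> nat) \<Rightarrow> 'c"
  assumes "finite I" "finite C" "\<And>g. col g \<in> C"
    and dep: "\<And>g g'. (\<And>i t. i \<in> I \<Longrightarrow> t < w \<Longrightarrow> g i t = g' i t) \<Longrightarrow> col g = col g'"
  shows "\<exists>v. \<forall>k::nat. \<exists>h. (\<forall>i\<in>I. strict_mono_on {..<k} (h i)) \<and>
        (\<forall>g. (\<forall>i\<in>I. strict_mono_on {..<w} (g i) \<and> g i ` {..<w} \<subseteq> {..<k}) \<longrightarrow>
           col (\<lambda>i t. h i (g i t)) = v)"
proof -
  define W where "W k v \<longleftrightarrow> (\<exists>h. (\<forall>i\<in>I. strict_mono_on {..<k::nat} (h i :: nat \<Rightarrow> nat)) \<and>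
        (\<forall>g. (\<forall>i\<in>I. strict_mono_on {..<w} (g i) \<and> g i ` {..<w} \<subseteq> {..<k}) \<longrightarrow>
           col (\<lambda>i t. h i (g i t)) = v))" for k v
  have "\<exists>v\<in>C. W k v" for k
  proof -
    obtain N :: nat where "\<exists>h v. (\<forall>i\<in>I. strict_mono_on {..<k} (h i) \<and> h i ` {..<k} \<subseteq> {..<N}) \<and>
        (\<forall>g. (\<forall>i\<in>I. strict_mono_on {..<w} (g i) \<and> g i ` {..<w} \<subseteq> {..<k}) \<longrightarrow>
           col (\<lambda>i t. h i (g i t)) = v)"
    proof (rule product_ramsey[OF assms(1,2), of k w])
      fix N :: nat
      assume "\<And>col :: ('i \<Rightarrow> nat \<Rightarrow> nat) \<Rightarrow> 'c. (\<And>g. col g \<in> C) \<Longrightarrow>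
        (\<And>g g'. (\<And>i t. i \<in> I \<Longrightarrow> t < w \<Longrightarrow> g i t = g' i t) \<Longrightarrow> col g = col g') \<Longrightarrow>
        \<exists>h v. (\<forall>i\<in>I. strict_mono_on {..<k} (h i) \<and> h i ` {..<k} \<subseteq> {..<N}) \<and>
        (\<forall>g. (\<forall>i\<in>I. strict_mono_on {..<w} (g i) \<and> g i ` {..<w} \<subseteq> {..<k}) \<longrightarrow>
           col (\<lambda>i t. h i (g i t)) = v)"
      from this[of col, OF assms(3) dep] that show thesis by blast
    qed
    then obtain h v where h: "\<forall>i\<in>I. strict_mono_on {..<k} (h i)"
      and v: "\<forall>g. (\<forall>i\<in>I. strict_mono_on {..<w} (g i) \<and> g i ` {..<w} \<subseteq> {..<k}) \<longrightarrow>
           col (\<lambda>i t. h i (g i t)) = v"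
      by blast
    show ?thesis
    proof (cases "\<exists>g. \<forall>i\<in>I. strict_mono_on {..<w} (g i :: nat \<Rightarrow> nat) \<and> g i ` {..<w} \<subseteq> {..<k}")
      case True
      then have "v \<in> C" using v assms(3) by metis
      then show ?thesis using h v W_def by blast
    next
      \<comment> \<open>Without an admissible \<open>g\<close> homogeneity is vacuous, and any
        colour in \<open>C\<close> will do.\<close>
      case False
      then show ?thesis using h assms(3) W_def by blast
    qed
  qed
  moreover have "W k v" if "k \<le> k'" "W k' v" for k k' v
  proof -
    have *: "{..<k} \<subseteq> {..<k'}" using that by auto
    show ?thesis
      using that(2) unfolding W_def
    proof (elim exE conjE, intro exI conjI ballI allI impI)
      fix h i
      assume "\<forall>i\<in>I. strict_mono_on {..<k'} (h i :: nat \<Rightarrow> nat)" "i \<in> I"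
      then show "strict_mono_on {..<k} (h i)"
        using * by (auto simp: strict_mono_on_def)
    next
      fix h :: "'i \<Rightarrow> nat \<Rightarrow> nat" and g
      assume "\<forall>g. (\<forall>i\<in>I. strict_mono_on {..<w} (g i) \<and> g i ` {..<w} \<subseteq> {..<k'}) \<longrightarrow>
          col (\<lambda>i t. h i (g i t)) = v"
        and "\<forall>i\<in>I. strict_mono_on {..<w} (g i) \<and> g i ` {..<w} \<subseteq> {..<k}"
      then show "col (\<lambda>i t. h i (g i t)) = v" using * by (meson order_trans)
    qed
  qed
  ultimately obtain v where v: "\<And>k. W k v"
    using finite_colour_uniform[OF assms(2), of W] by blast
  show ?thesis
    by (rule exI[of _ v], rule allI) (rule v[unfolded W_def])
qed

section \<open>Definability with parameters\<close>

lemma eval_tm_cong: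
  "(\<And>n. n \<in> fv_tm t \<Longrightarrow> e n = e' n) \<Longrightarrow> eval_tm M e t = eval_tm M e' t"
proof (induction t)
  case (App f ts)
  have "eval_tm M e t = eval_tm M e' t" if "t \<in> set ts" for t
    by (rule App.IH[OF that]) (use that App.prems in auto)
  then have "map (eval_tm M e) ts = map (eval_tm M e') ts" by simp
  then show ?case by (metis eval_tm.simps(2))
qed simp

lemma sat_cong:
  "(\<And>n. n \<in> fv_fm \<phi> \<Longrightarrow> e n = e' n) \<Longrightarrow> sat M e \<phi> = sat M e' \<phi>"
proof (induction \<phi> arbitrary: e e')
  case (Equal s t)
  then show ?case using eval_tm_cong[of s e e' M] eval_tm_cong[of t e e' M] by auto
next
  case (Atom r ts)
  then have "map (eval_tm M e) ts = map (eval_tm M e') ts"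
    by (auto intro!: eval_tm_cong)
  then show ?case by (metis sat.simps(2))
next
  case (Exists v \<phi>)
  have "sat M (e(v := x)) \<phi> = sat M (e'(v := x)) \<phi>" for x
    using Exists.prems by (intro Exists.IH) auto
  then show ?case by simp
next
  case (Conj \<phi> \<psi>)
  have "sat M e \<phi> = sat M e' \<phi>" by (rule Conj.IH(1)) (use Conj.prems in simp)
  moreover have "sat M e \<psi> = sat M e' \<psi>" by (rule Conj.IH(2)) (use Conj.prems in simp)
  ultimately show ?case by simp
next
  case (Neg \<phi>)
  have "sat M e \<phi> = sat M e' \<phi>" by (rule Neg.IH) (use Neg.prems in simp)
  then show ?case by simp
qed

lemma finite_fv_tm: "finite (fv_tm t)"
  by (induction t) auto

lemma finite_fv_fm: "finite (fv_fm \<phi>)"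
  by (induction \<phi>) (auto simp: finite_fv_tm)

primrec rename_tm :: "(nat \<Rightarrow> nat) \<Rightarrow> 'f tm \<Rightarrow> 'f tm" where
  "rename_tm g (Var v) = Var (g v)"
| "rename_tm g (App f ts) = App f (map (rename_tm g) ts)"

lemma wf_rename_tm: "wf_tm L t \<Longrightarrow> wf_tm L (rename_tm g t)"
  by (induction t) (auto simp: list_all_iff)

lemma fv_rename_tm: "fv_tm (rename_tm g t) = g ` fv_tm t"
  by (induction t) auto

lemma eval_rename_tm: "eval_tm M e (rename_tm g t) = eval_tm M (e \<circ> g) t"
  by (induction t) (auto intro!: arg_cong[where f = "interp_fun M _"])

text \<open>The map \<open>g\<close> may identify variables. Stating only the existence of a formula
  with the right meaning hides the choice of bound variables.\<close>

lemma rename_fm: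
  "wf_fm L \<phi> \<Longrightarrow> \<exists>\<psi>. wf_fm L \<psi> \<and> fv_fm \<psi> \<subseteq> g ` fv_fm \<phi> \<and> (\<forall>e. sat M e \<psi> = sat M (e \<circ> g) \<phi>)"
proof (induction \<phi> arbitrary: g)
  case (Equal s t)
  then show ?case
    by (intro exI[of _ "Equal (rename_tm g s) (rename_tm g t)"])
       (auto simp: wf_rename_tm fv_rename_tm eval_rename_tm simp del: o_apply)
next
  case (Atom r ts)
  moreover have "map (eval_tm M (e \<circ> g)) ts = map (eval_tm M e) (map (rename_tm g) ts)" for e
    by (auto simp: eval_rename_tm)
  ultimately show ?case
    by (intro exI[of _ "Atom r (map (rename_tm g) ts)"])
       (auto simp: wf_rename_tm fv_rename_tm list_all_iff simp del: map_map o_apply)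
next
  case (Neg \<phi>)
  then obtain \<psi> where "wf_fm L \<psi> \<and> fv_fm \<psi> \<subseteq> g ` fv_fm \<phi> \<and> (\<forall>e. sat M e \<psi> = sat M (e \<circ> g) \<phi>)"
    by (metis wf_fm.simps(3))
  then show ?case by (intro exI[of _ "Neg \<psi>"]) (auto simp del: o_apply)
next
  case (Conj \<phi>1 \<phi>2)
  then obtain \<psi>1 \<psi>2
    where "wf_fm L \<psi>1 \<and> fv_fm \<psi>1 \<subseteq> g ` fv_fm \<phi>1 \<and> (\<forall>e. sat M e \<psi>1 = sat M (e \<circ> g) \<phi>1)"
      and "wf_fm L \<psi>2 \<and> fv_fm \<psi>2 \<subseteq> g ` fv_fm \<phi>2 \<and> (\<forall>e. sat M e \<psi>2 = sat M (e \<circ> g) \<phi>2)"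
    by (metis wf_fm.simps(4))
  then show ?case by (intro exI[of _ "Conj \<psi>1 \<psi>2"]) (auto simp del: o_apply)
next
  case (Exists v \<phi>)
  \<comment> \<open>A bound variable outside the image of the free variables avoids capture.\<close>
  obtain w where w: "w \<notin> g ` fv_fm \<phi>"
    using ex_new_if_finite[OF infinite_UNIV_nat finite_imageI[OF finite_fv_fm]] by blast
  obtain \<psi> where \<psi>: "wf_fm L \<psi>" "fv_fm \<psi> \<subseteq> g(v := w) ` fv_fm \<phi>"
      "\<And>e. sat M e \<psi> = sat M (e \<circ> g(v := w)) \<phi>"
    using Exists.IH[of "g(v := w)"] Exists.prems unfolding wf_fm.simps by metis
  have "sat M (e(w := x)) \<psi> = sat M ((e \<circ> g)(v := x)) \<phi>" for e x
    unfolding \<psi>(3) using w by (intro sat_cong) auto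
  then show ?case
    using \<psi>(1,2) by (intro exI[of _ "Exists w \<psi>"]) (auto split: if_splits simp del: o_apply)
qed

text \<open>\<open>P\<close> is a predicate on assignments \<open>'v \<Rightarrow> 'a\<close> for an arbitrary index type \<open>'v\<close>. A variable \<open>n\<close> of \<open>\<phi>\<close>
  stands for the index \<open>v\<close> if \<open>h n = Inl v\<close> and for the parameter \<open>a\<close> if \<open>h n = Inr a\<close>.\<close>

definition edef :: "('f, 'r) language \<Rightarrow> ('f, 'r, 'a) struct \<Rightarrow> (('v \<Rightarrow> 'a) \<Rightarrow> bool) \<Rightarrow> bool" where
  "edef L M P \<longleftrightarrow> (\<exists>\<phi> h. wf_fm L \<phi> \<and> (\<forall>e. P e = sat M (\<lambda>n. case_sum e id (h n)) \<phi>))"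

text \<open>An index may be replaced by another index or by a parameter: \<open>g\<close> is
  composed with the interpretation \<open>h\<close> of the variables, while the formula stays the
  same.\<close>

lemma edef_subst:
  fixes P :: "('u \<Rightarrow> 'a) \<Rightarrow> bool" and g :: "'u \<Rightarrow> 'v + 'a"
  assumes "edef L M P"
  shows "edef L M (\<lambda>e. P (\<lambda>u. case_sum e id (g u)))"
proof -
  obtain \<phi> h where "wf_fm L \<phi>" and P: "\<And>e. P e = sat M (\<lambda>n. case_sum e id (h n)) \<phi>"
    using assms unfolding edef_def by blast
  moreover have "(\<lambda>n. case_sum (\<lambda>u. case_sum e id (g u)) id (h n)) =
      (\<lambda>n. case_sum e id (case_sum g Inr (h n)))" for e
    by (auto split: sum.splits)
  ultimately show ?thesis
    unfolding edef_def by metis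
qed

lemma edef_neg: "edef L M P \<Longrightarrow> edef L M (\<lambda>e. \<not> P e)"
  unfolding edef_def by (metis sat.simps(3) wf_fm.simps(3))

lemma edef_conj:
  fixes P Q :: "('v \<Rightarrow> 'a) \<Rightarrow> bool"
  assumes "edef L M P" "edef L M Q"
  shows "edef L M (\<lambda>e. P e \<and> Q e)"
proof -
  obtain \<phi> h where \<phi>: "wf_fm L \<phi>" "\<And>e. P e = sat M (\<lambda>n. case_sum e id (h n)) \<phi>"
    using assms(1) unfolding edef_def by blast
  obtain \<psi> k where \<psi>: "wf_fm L \<psi>" "\<And>e. Q e = sat M (\<lambda>n. case_sum e id (k n)) \<psi>"
    using assms(2) unfolding edef_def by blast
  \<comment> \<open>Even variables carry the first formula and odd ones the second, so that
    \<open>h\<close> and \<open>k\<close> can be merged into one interpretation.\<close>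
  obtain \<phi>' where \<phi>': "wf_fm L \<phi>'" "\<And>e. sat M e \<phi>' = sat M (e \<circ> (\<lambda>n. 2 * n)) \<phi>"
    using rename_fm[OF \<phi>(1)] by metis
  obtain \<psi>' where \<psi>': "wf_fm L \<psi>'" "\<And>e. sat M e \<psi>' = sat M (e \<circ> (\<lambda>n. 2 * n + 1)) \<psi>"
    using rename_fm[OF \<psi>(1)] by metis
  define l where "l = (\<lambda>n. if even n then h (n div 2) else k (n div 2))"
  have "(P e \<and> Q e) = sat M (\<lambda>n. case_sum e id (l n)) (Conj \<phi>' \<psi>')" for e
    by (simp add: \<phi> \<psi> \<phi>'(2) \<psi>'(2) o_def l_def)
  then show ?thesis
    unfolding edef_def using \<phi>'(1) \<psi>'(1) by (metis wf_fm.simps(4))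
qed

lemma edef_eq: "edef L M (\<lambda>e. e u = e v)"
  unfolding edef_def
  by (rule exI[of _ "Equal (Var 0) (Var 1)"], rule exI[of _ "\<lambda>n. if n = 0 then Inl u else Inl v"])
     auto

lemma edef_const: "edef L M (\<lambda>e. b)"
proof -
  have "edef L M (\<lambda>e. e undefined = e undefined)"
    by (rule edef_eq)
  then have "edef L M (\<lambda>e. True)" by simp
  from this edef_neg[OF this] show ?thesis by (cases b) auto
qed

lemma edef_ball:
  assumes "finite A" "\<And>x. x \<in> A \<Longrightarrow> edef L M (P x)"
  shows "edef L M (\<lambda>e. \<forall>x\<in>A. P x e)"
  using assms by (induction A) (auto simp: edef_const intro!: edef_conj)

lemma edef_ex1:
  fixes P :: "('v \<Rightarrow> 'a) \<Rightarrow> bool"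
  assumes "edef L M P"
  shows "edef L M (\<lambda>e. \<exists>x. P (e(v := x)))"
proof -
  obtain \<phi> h where \<phi>: "wf_fm L \<phi>" "\<And>e. P e = sat M (\<lambda>n. case_sum e id (h n)) \<phi>"
    using assms(1) unfolding edef_def by blast
  \<comment> \<open>All variables standing for \<open>v\<close> are merged into variable 0, which is
    then quantified; the others are shifted out of its way.\<close>
  define g where "g = (\<lambda>n. if h n = Inl v then 0 else Suc n)"
  obtain \<psi> where \<psi>: "wf_fm L \<psi>" "\<And>e. sat M e \<psi> = sat M (e \<circ> g) \<phi>"
    using rename_fm[OF \<phi>(1)] by metis
  have "P (e(v := x)) = sat M ((\<lambda>n. case_sum e id (h (n - 1)))(0 := x)) \<psi>" for e x
    unfolding \<phi>(2) \<psi>(2) by (intro sat_cong) (auto simp: g_def split: sum.splits)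
  then have "(\<exists>x. P (e(v := x))) = sat M (\<lambda>n. case_sum e id (h (n - 1))) (Exists 0 \<psi>)" for e
    by simp
  then show ?thesis
    unfolding edef_def using \<psi>(1) by (metis wf_fm.simps(5))
qed

lemma edef_finite_support:
  fixes P :: "('v \<Rightarrow> 'a) \<Rightarrow> bool"
  assumes "edef L M P"
  obtains W where "finite W" "\<And>e e'. (\<And>v. v \<in> W \<Longrightarrow> e v = e' v) \<Longrightarrow> P e = P e'"
proof -
  obtain \<phi> h where \<phi>: "wf_fm L \<phi>" "\<And>e. P e = sat M (\<lambda>n. case_sum e id (h n)) \<phi>"
    using assms(1) unfolding edef_def by blast
  show ?thesis
  proof (rule that[of "{v. Inl v \<in> h ` fv_fm \<phi>}"])
    show "finite {v. Inl v \<in> h ` fv_fm \<phi>}"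
      using finite_vimageI[OF finite_imageI[OF finite_fv_fm], of Inl h \<phi>] by (simp add: vimage_def)
  next
    fix e e' :: "'v \<Rightarrow> 'a"
    assume "\<And>v. v \<in> {v. Inl v \<in> h ` fv_fm \<phi>} \<Longrightarrow> e v = e' v"
    then show "P e = P e'"
      unfolding \<phi>(2) by (intro sat_cong) (auto split: sum.splits intro: rev_image_eqI[OF _ sym])
  qed
qed

text \<open>A quantifier over a whole assignment is first-order because \<open>P\<close> depends on
  finitely many indices only. Those of the form \<open>Inr w\<close> are quantified one at a time;
  the remaining ones are set to \<open>undefined\<close>.\<close>

lemma edef_ex_env:
  fixes P :: "('v + 'w \<Rightarrow> 'a) \<Rightarrow> bool"
  assumes "edef L M P"
  shows "edef L M (\<lambda>e. \<exists>e'. P (case_sum e e'))"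
proof -
  have *: "edef L M (\<lambda>e. \<exists>e'. (\<forall>u. u \<notin> V \<longrightarrow> e' u = e u) \<and> P e')" if "finite V" for V
    using that
  proof (induction V)
    case empty
    have "(\<exists>e'. (\<forall>u. u \<notin> {} \<longrightarrow> e' u = e u) \<and> P e') = P e" for e
      using ext by auto
    then show ?case using assms by simp
  next
    case (insert v V)
    have "(\<exists>e'. (\<forall>u. u \<notin> insert v V \<longrightarrow> e' u = e u) \<and> P e') =
        (\<exists>x e'. (\<forall>u. u \<notin> V \<longrightarrow> e' u = (e(v := x)) u) \<and> P e')" for e
    proof
      assume "\<exists>e'. (\<forall>u. u \<notin> insert v V \<longrightarrow> e' u = e u) \<and> P e'"
      then obtain e' where "\<forall>u. u \<notin> insert v V \<longrightarrow> e' u = e u" "P e'" by blast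
      then show "\<exists>x e'. (\<forall>u. u \<notin> V \<longrightarrow> e' u = (e(v := x)) u) \<and> P e'"
        by (intro exI[of _ "e' v"] exI[of _ e']) auto
    next
      assume "\<exists>x e'. (\<forall>u. u \<notin> V \<longrightarrow> e' u = (e(v := x)) u) \<and> P e'"
      then show "\<exists>e'. (\<forall>u. u \<notin> insert v V \<longrightarrow> e' u = e u) \<and> P e'"
        by (metis fun_upd_other insertCI)
    qed
    then show ?case using edef_ex1[OF insert.IH, of v] by simp
  qed
  obtain W where W: "finite W" "\<And>e e'. (\<And>v. v \<in> W \<Longrightarrow> e v = e' v) \<Longrightarrow> P e = P e'"
    using edef_finite_support[OF assms] by metis
  define g :: "'v + 'w \<Rightarrow> 'v + 'a" where "g = case_sum Inl (\<lambda>_. Inr undefined)"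
  have "edef L M (\<lambda>e. \<exists>e'. (\<forall>u. u \<notin> W \<inter> range Inr \<longrightarrow> e' u = case_sum e id (g u)) \<and> P e')"
    by (rule edef_subst[OF *]) (use W(1) in simp)
  moreover have "(\<exists>e'. (\<forall>u. u \<notin> W \<inter> range Inr \<longrightarrow> e' u = case_sum e id (g u)) \<and> P e') =
      (\<exists>e'. P (case_sum e e'))" for e :: "'v \<Rightarrow> 'a"
  proof
    assume "\<exists>e'. (\<forall>u. u \<notin> W \<inter> range Inr \<longrightarrow> e' u = case_sum e id (g u)) \<and> P e'"
    then obtain e' where e': "\<And>u. u \<notin> W \<inter> range Inr \<Longrightarrow> e' u = case_sum e id (g u)" "P e'" by blast
    have "case_sum e (e' \<circ> Inr) u = e' u" for u
      using e'(1)[of u] by (cases u) (auto simp: g_def image_iff)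
    then have "P (case_sum e (e' \<circ> Inr))"
      using e'(2) W(2)[of "case_sum e (e' \<circ> Inr)" e'] by blast
    then show "\<exists>e'. P (case_sum e e')" by blast
  next
    assume "\<exists>e'. P (case_sum e e')"
    then obtain e' where e': "P (case_sum e e')" by blast
    define e'' where "e'' u = (if u \<in> W \<inter> range Inr then case_sum e e' u else case_sum e id (g u))" for u
    have "P e''"
      using e' W(2)[of e'' "case_sum e e'"] by (auto simp: e''_def g_def split: sum.splits)
    then show "\<exists>e'. (\<forall>u. u \<notin> W \<inter> range Inr \<longrightarrow> e' u = case_sum e id (g u)) \<and> P e'"
      by (intro exI[of _ e'']) (simp add: e''_def)
  qed
  ultimately show ?thesis by simp
qed

text \<open>Predicates on assignments of tuples: the variable \<open>v\<close> ranges over \<open>len v\<close>-tuples and is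
  represented by the elements indexed by \<open>(v, 0), \<dots>, (v, len v - 1)\<close>.\<close>

definition tuples :: "('v \<Rightarrow> nat) \<Rightarrow> ('v \<times> nat \<Rightarrow> 'a) \<Rightarrow> 'v \<Rightarrow> 'a list" where
  "tuples len e v = map (\<lambda>x. e (v, x)) [0..<len v]"

definition dfn ::
  "('f, 'r) language \<Rightarrow> ('f, 'r, 'a) struct \<Rightarrow> ('v \<Rightarrow> nat) \<Rightarrow> (('v \<Rightarrow> 'a list) \<Rightarrow> bool) \<Rightarrow> bool" where
  "dfn L M len P \<longleftrightarrow> edef L M (\<lambda>e. P (tuples len e))"

definition tuple_term :: "('v \<Rightarrow> nat) \<Rightarrow> (('v \<Rightarrow> 'a list) \<Rightarrow> 'a list) \<Rightarrow> bool" where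
  "tuple_term len T \<longleftrightarrow> (\<exists>w. \<forall>e. T (tuples len e) = map (case_sum e id) w)"

lemma length_tuples [simp]: "length (tuples len e v) = len v"
  by (simp add: tuples_def)

lemma tuples_surj: "(\<And>v. length (E v) = len v) \<Longrightarrow> tuples len (\<lambda>(v, x). E v ! x) = E"
  by (auto simp: tuples_def fun_eq_iff map_nth intro: trans[OF _ map_nth])

lemma tuple_term_var: "tuple_term len (\<lambda>E. E v)"
  unfolding tuple_term_def tuples_def
  by (rule exI[of _ "map (\<lambda>x. Inl (v, x)) [0..<len v]"]) simp

lemma tuple_term_const: "tuple_term len (\<lambda>E. c)"
  unfolding tuple_term_def by (rule exI[of _ "map Inr c"]) (simp add: map_idI)

lemma tuple_term_append: "tuple_term len S \<Longrightarrow> tuple_term len T \<Longrightarrow> tuple_term len (\<lambda>E. S E @ T E)"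
  unfolding tuple_term_def by (metis map_append)

lemma tuple_term_take: "tuple_term len T \<Longrightarrow> tuple_term len (\<lambda>E. take n (T E))"
  unfolding tuple_term_def by (metis take_map)

lemma tuple_term_drop: "tuple_term len T \<Longrightarrow> tuple_term len (\<lambda>E. drop n (T E))"
  unfolding tuple_term_def by (metis drop_map)

lemma tuple_term_if:
  "(b \<Longrightarrow> tuple_term len S) \<Longrightarrow> (\<not> b \<Longrightarrow> tuple_term len T) \<Longrightarrow>
   tuple_term len (\<lambda>E. if b then S E else T E)"
  by (cases b) simp_all

lemma tuple_term_concat:
  "(\<And>x. x \<in> set xs \<Longrightarrow> tuple_term len (T x)) \<Longrightarrow> tuple_term len (\<lambda>E. concat (map (\<lambda>x. T x E) xs))"
proof (induction xs)
  case Nil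
  then show ?case using tuple_term_const[of len "[]"] by simp
next
  case (Cons x xs)
  then show ?case using tuple_term_append[of len "T x"] by simp
qed

lemma dfn_const: "dfn L M len (\<lambda>E. b)"
  by (simp add: dfn_def edef_const)

lemma dfn_neg: "dfn L M len P \<Longrightarrow> dfn L M len (\<lambda>E. \<not> P E)"
  by (simp add: dfn_def edef_neg)

lemma dfn_conj: "dfn L M len P \<Longrightarrow> dfn L M len Q \<Longrightarrow> dfn L M len (\<lambda>E. P E \<and> Q E)"
  by (simp add: dfn_def edef_conj)

lemma dfn_disj: "dfn L M len P \<Longrightarrow> dfn L M len Q \<Longrightarrow> dfn L M len (\<lambda>E. P E \<or> Q E)"
  using dfn_neg[OF dfn_conj[OF dfn_neg dfn_neg], of L M len P Q] by simp

lemma dfn_imp: "dfn L M len P \<Longrightarrow> dfn L M len Q \<Longrightarrow> dfn L M len (\<lambda>E. P E \<longrightarrow> Q E)"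
  unfolding imp_conv_disj by (intro dfn_disj dfn_neg)

lemma dfn_iff: "dfn L M len P \<Longrightarrow> dfn L M len Q \<Longrightarrow> dfn L M len (\<lambda>E. P E \<longleftrightarrow> Q E)"
  unfolding iff_conv_conj_imp by (intro dfn_conj dfn_imp)

lemma dfn_ball:
  "finite A \<Longrightarrow> (\<And>x. x \<in> A \<Longrightarrow> dfn L M len (P x)) \<Longrightarrow> dfn L M len (\<lambda>E. \<forall>x\<in>A. P x E)"
  by (simp add: dfn_def edef_ball)

lemma dfn_bex:
  assumes "finite A" "\<And>x. x \<in> A \<Longrightarrow> dfn L M len (P x)"
  shows "dfn L M len (\<lambda>E. \<exists>x\<in>A. P x E)"
proof -
  have "dfn L M len (\<lambda>E. \<not> (\<forall>x\<in>A. \<not> P x E))"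
    using assms by (intro dfn_neg dfn_ball)
  then show ?thesis by simp
qed

text \<open>This makes the existence of whole grids of tuples definable; the index type of the bound
  tuples is arbitrary.\<close>

lemma dfn_ex_env:
  assumes "dfn L M (case_sum len len') P"
  shows "dfn L M len (\<lambda>E. \<exists>E'. (\<forall>w. length (E' w) = len' w) \<and> P (case_sum E E'))"
proof -
  define P' where "P' = (\<lambda>e :: _ + _ \<Rightarrow> _.
    P (tuples (case_sum len len') (\<lambda>(v, x). case v of Inl u \<Rightarrow> e (Inl (u, x)) | Inr w \<Rightarrow> e (Inr (w, x)))))"
  have *: "case_sum e id (case u of (v, x) \<Rightarrow> case v of Inl u \<Rightarrow> Inl (Inl (u, x)) | Inr w \<Rightarrow> Inl (Inr (w, x)))
      = (case u of (v, x) \<Rightarrow> case v of Inl u \<Rightarrow> e (Inl (u, x)) | Inr w \<Rightarrow> e (Inr (w, x)))" for e u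
    by (auto split: sum.splits prod.splits)
  have "edef L M P'"
    using edef_subst[OF assms[unfolded dfn_def], where g = "\<lambda>(v, x). case v of
        Inl u \<Rightarrow> Inl (Inl (u, x)) | Inr w \<Rightarrow> Inl (Inr (w, x))"]
    unfolding P'_def * .
  from edef_ex_env[OF this] have "edef L M (\<lambda>e. \<exists>e'. P' (case_sum e e'))" .
  moreover have "P' (case_sum e e') = P (case_sum (tuples len e) (tuples len' e'))" for e e'
    unfolding P'_def by (rule arg_cong[where f = P]) (auto simp: tuples_def fun_eq_iff split: sum.splits)
  moreover have "(\<exists>e'. P (case_sum (tuples len e) (tuples len' e'))) =
      (\<exists>E'. (\<forall>w. length (E' w) = len' w) \<and> P (case_sum (tuples len e) E'))" for e
    using tuples_surj[of _ len'] length_tuples[of len'] by metis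
  ultimately show ?thesis
    unfolding dfn_def by simp
qed

lemma dfn_reindex:
  assumes "dfn L M len' P" "\<And>u. len (g u) = len' u"
  shows "dfn L M len (\<lambda>E. P (\<lambda>u. E (g u)))"
proof -
  have "edef L M (\<lambda>e. P (tuples len' (\<lambda>u. case_sum e id (case u of (v, x) \<Rightarrow> Inl (g v, x)))))"
    by (rule edef_subst[OF assms(1)[unfolded dfn_def]])
  moreover have *: "tuples len' (\<lambda>u. case_sum e id (case u of (v, x) \<Rightarrow> Inl (g v, x))) =
      (\<lambda>u. tuples len e (g u))" for e
    by (auto simp: tuples_def fun_eq_iff assms(2))
  ultimately show ?thesis unfolding dfn_def * by blast
qed

lemma dfn_ex:
  assumes "dfn L M (case_option q len) (\<lambda>E. P (E None) (\<lambda>v. E (Some v)))"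
  shows "dfn L M len (\<lambda>E. \<exists>y. length y = q \<and> P y E)"
proof -
  have "dfn L M (case_sum len (\<lambda>_::unit. q)) (\<lambda>E. P (E (Inr ())) (\<lambda>v. E (Inl v)))"
    using dfn_reindex[OF assms, of "case_sum len (\<lambda>_. q)" "case_option (Inr ()) Inl"]
    by (simp split: option.splits)
  from dfn_ex_env[OF this]
  have "dfn L M len (\<lambda>E. \<exists>E'. (\<forall>w::unit. length (E' w) = q) \<and> P (E' ()) E)" by simp
  moreover have "(\<exists>E'. (\<forall>w::unit. length (E' w) = q) \<and> P (E' ()) E) = (\<exists>y. length y = q \<and> P y E)" for E
  proof
    assume "\<exists>y. length y = q \<and> P y E"
    then obtain y where "length y = q" "P y E" by blast
    then show "\<exists>E'. (\<forall>w::unit. length (E' w) = q) \<and> P (E' ()) E"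
      by (intro exI[of _ "\<lambda>_. y"]) simp
  qed blast
  ultimately show ?thesis by simp
qed

lemma dfn_all:
  assumes "dfn L M (case_option q len) (\<lambda>E. P (E None) (\<lambda>v. E (Some v)))"
  shows "dfn L M len (\<lambda>E. \<forall>y. length y = q \<longrightarrow> P y E)"
proof -
  have "dfn L M len (\<lambda>E. \<not> (\<exists>y. length y = q \<and> \<not> P y E))"
    using assms by (intro dfn_neg dfn_ex)
  then show ?thesis by simp
qed

section \<open>Passing between definable sets and definable predicates\<close>

lemma definable_length: "definable L M k D \<Longrightarrow> a \<in> D \<Longrightarrow> length a = k"
  unfolding definable_def by auto

lemma dfn_mem:
  assumes D: "definable L M k D" and T: "tuple_term len T"
  shows "dfn L M len (\<lambda>E. T E \<in> D)"
proof -
  obtain w where w: "\<And>e. T (tuples len e) = map (case_sum e id) w"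
    using T unfolding tuple_term_def by blast
  obtain b \<phi> where \<phi>: "\<phi> \<in> formulas L (k + length b)"
    "D = {a. length a = k \<and> holds M \<phi> (a @ b)}"
    using D unfolding definable_def by blast
  show ?thesis
  proof (cases "length w = k")
    case True
    define h where "h = (\<lambda>n. (w @ map Inr b) ! n)"
    have "(T (tuples len e) \<in> D) = sat M (\<lambda>n. case_sum e id (h n)) \<phi>" for e
    proof -
      have "map (case_sum e id) (map Inr b) = b" by (simp add: map_idI)
      then have "map (case_sum e id) w @ b = map (case_sum e id) (w @ map Inr b)" by simp
      then have "(T (tuples len e) \<in> D) = sat M (\<lambda>n. map (case_sum e id) (w @ map Inr b) ! n) \<phi>"
        using True by (simp add: \<phi>(2) w holds_def)
      also have "\<dots> = sat M (\<lambda>n. case_sum e id (h n)) \<phi>"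
        using \<phi>(1) True unfolding h_def by (intro sat_cong nth_map) (auto simp: formulas_def)
      finally show ?thesis .
    qed
    then show ?thesis
      using \<phi>(1) unfolding dfn_def edef_def formulas_def by auto
  next
    case False
    \<comment> \<open>The length of the term is the same under all assignments, so a wrong length
      makes membership constantly false.\<close>
    then have "(T (tuples len e) \<in> D) = False" for e
      by (auto simp: \<phi>(2) w)
    then show ?thesis by (simp add: dfn_def edef_const)
  qed
qed

text \<open>Indices below \<open>k\<close> become the free variables, and each variable standing for
  a parameter gets its own slot in the list \<open>b\<close>.\<close>

lemma definable_edef:
  assumes "edef L M (\<lambda>e :: nat \<Rightarrow> 'a. Q (map e [0..<k]))"
  shows "definable L M k {a. length a = k \<and> Q a}"
proof -
  obtain \<phi> h where \<phi>: "wf_fm L \<phi>" "\<And>e. Q (map e [0..<k]) = sat M (\<lambda>n. case_sum e id (h n)) \<phi>"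
    using assms unfolding edef_def by blast
  obtain m where m: "fv_fm \<phi> \<subseteq> {..<m}"
    using finite_nat_bounded[OF finite_fv_fm[of \<phi>]] by blast
  \<comment> \<open>Slot \<open>n\<close> of \<open>b\<close> belongs to variable \<open>n\<close>
    of \<open>\<phi>\<close>. If that variable stands for an index, the slot holds
    \<open>undefined\<close>; this value is used for the indices from \<open>k\<close> on, which
    \<open>Q\<close> does not see.\<close>
  define b where "b = map (\<lambda>n. case_sum (\<lambda>_. undefined) id (h n)) [0..<m]"
  define g where "g = (\<lambda>n. case h n of Inl v \<Rightarrow> if v < k then v else k + n | Inr a \<Rightarrow> k + n)"
  obtain \<psi> where \<psi>: "wf_fm L \<psi>" "fv_fm \<psi> \<subseteq> g ` fv_fm \<phi>" "\<And>e. sat M e \<psi> = sat M (e \<circ> g) \<phi>"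
    using rename_fm[OF \<phi>(1)] by metis
  have "g n < k + m" if "n \<in> fv_fm \<phi>" for n
    using m that by (auto simp: g_def split: sum.splits)
  then have \<psi>f: "\<psi> \<in> formulas L (k + length b)"
    using \<psi>(1,2) by (auto simp: formulas_def b_def)
  have "Q a = holds M \<psi> (a @ b)" if "length a = k" for a
  proof -
    define e where "e = (\<lambda>i. if i < k then a ! i else undefined)"
    have "map e [0..<k] = a"
      using that by (intro nth_equalityI) (auto simp: e_def)
    then have "Q a = sat M (\<lambda>n. case_sum e id (h n)) \<phi>"
      using \<phi>(2)[of e] by simp
    also have "\<dots> = sat M ((\<lambda>i. (a @ b) ! i) \<circ> g) \<phi>"
    proof (rule sat_cong)
      fix n assume "n \<in> fv_fm \<phi>"
      then have "n < m" using m by auto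
      then show "case_sum e id (h n) = ((\<lambda>i. (a @ b) ! i) \<circ> g) n"
        using that by (auto simp: g_def e_def b_def nth_append split: sum.splits)
    qed
    finally show ?thesis by (simp add: holds_def \<psi>(3))
  qed
  then show ?thesis
    unfolding definable_def using \<psi>f by (intro exI[of _ b] bexI[of _ \<psi>]) auto
qed

lemma definable_dfn:
  fixes Q :: "'a list \<Rightarrow> bool"
  assumes "dfn L M (\<lambda>_::unit. k) (\<lambda>E. Q (E ()))"
  shows "definable L M k {a. length a = k \<and> Q a}"
proof (rule definable_edef)
  show "edef L M (\<lambda>e :: nat \<Rightarrow> 'a. Q (map e [0..<k]))"
    using edef_subst[OF assms[unfolded dfn_def], where g = "\<lambda>(_, x). Inl x"]
    by (simp add: tuples_def)
qed

lemma dfn_eq: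
  fixes S T :: "('v \<Rightarrow> 'a list) \<Rightarrow> 'a list"
  assumes S: "tuple_term len S" and T: "tuple_term len T"
  shows "dfn L M len (\<lambda>E. S E = T E)"
proof -
  obtain w where w: "\<And>e. S (tuples len e) = map (case_sum e id) w"
    using S unfolding tuple_term_def by blast
  obtain w' where w': "\<And>e. T (tuples len e) = map (case_sum e id) w'"
    using T unfolding tuple_term_def by blast
  have el: "edef L M (\<lambda>e. case_sum e id u = case_sum e id v)" for u v :: "('v \<times> nat) + 'a"
    using edef_subst[OF edef_eq[of L M True False], of "\<lambda>b. if b then u else v"] by simp
  have "edef L M (\<lambda>e. length w = length w' \<and>
      (\<forall>i\<in>{..<length w}. case_sum e id (w ! i) = case_sum e id (w' ! i)))"
    by (intro edef_conj edef_const edef_ball el) simp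
  moreover have "(S (tuples len e) = T (tuples len e)) = (length w = length w' \<and>
      (\<forall>i\<in>{..<length w}. case_sum e id (w ! i) = case_sum e id (w' ! i)))" for e
    by (auto simp: w w' list_eq_iff_nth_eq)
  ultimately show ?thesis unfolding dfn_def by simp
qed

lemma dfn_length: "tuple_term len T \<Longrightarrow> dfn L M len (\<lambda>E. length (T E) = n)"
proof -
  assume "tuple_term len T"
  then obtain w where "\<And>e. T (tuples len e) = map (case_sum e id) w"
    unfolding tuple_term_def by blast
  then show ?thesis by (simp add: dfn_def edef_const)
qed

lemmas dfn_intros = dfn_const dfn_neg dfn_conj dfn_disj dfn_imp dfn_iff dfn_eq
lemmas tuple_term_intros = tuple_term_var tuple_term_const tuple_term_append tuple_term_take
  tuple_term_drop tuple_term_if tuple_term_concat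

section \<open>Compactness for countable families\<close>

text \<open>Saturation for 1-types supplies the next value. The possible values of coordinate
  \<open>n\<close> under the first \<open>N\<close> conditions form definable sets that decrease
  with \<open>N\<close>, and countably many of them involve only countably many parameters, fewer
  than \<open>\<kappa>\<close>.\<close>

lemma finitely_satisfiable_extend:
  fixes P :: "nat \<Rightarrow> (nat \<Rightarrow> 'a) \<Rightarrow> bool" and M :: "('f, 'r, 'a) struct" and \<kappa> :: "'k rel"
  assumes sat: "saturated \<kappa> L M" and \<kappa>: "natLeq <o \<kappa>"
    and P: "\<And>i. edef L M (P i)"
    and fin: "\<And>N. \<exists>e. (\<forall>m<n. e m = a m) \<and> (\<forall>i<N. P i e)"
  obtains x where "\<And>N. \<exists>e. (\<forall>m<n. e m = a m) \<and> e n = x \<and> (\<forall>i<N. P i e)"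
proof -
  define B where "B N y \<longleftrightarrow> (\<exists>e. (\<forall>m<n. e m = a m) \<and> e n = y \<and> (\<forall>i<N. P i e))" for N y
  have "edef L M (\<lambda>e. B N (hd (map e [0..<1::nat])))" for N
  proof -
    have eqc: "edef L M (\<lambda>e :: nat + nat \<Rightarrow> 'a. e u = c)" for u c
      using edef_subst[OF edef_eq[of L M True False], of "\<lambda>b. if b then Inl u else Inr c"] by simp
    have P': "edef L M (\<lambda>e :: nat + nat \<Rightarrow> 'a. P i (\<lambda>m. e (Inr m)))" for i
      using edef_subst[OF P, where g = "\<lambda>m. Inl (Inr m)"] by simp
    have "edef L M (\<lambda>e :: nat + nat \<Rightarrow> 'a. (\<forall>m\<in>{..<n}. e (Inr m) = a m) \<and> e (Inr n) = e (Inl 0) \<and>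
        (\<forall>i\<in>{..<N}. P i (\<lambda>m. e (Inr m))))"
      by (intro edef_conj edef_ball eqc edef_eq P') auto
    from edef_ex_env[OF this] show ?thesis by (simp add: B_def Ball_def)
  qed
  from definable_edef[OF this]
  have D: "definable L M 1 {a. length a = 1 \<and> B N (hd a)}" for N .
  have "\<exists>b. \<exists>\<phi>\<in>formulas L (1 + length b). \<forall>y. B N y = holds M \<phi> ([y] @ b)" for N
  proof -
    obtain b \<phi> where \<phi>: "\<phi> \<in> formulas L (1 + length b)"
      and eq: "{a. length a = 1 \<and> B N (hd a)} = {a. length a = 1 \<and> holds M \<phi> (a @ b)}"
      using D[of N] unfolding definable_def by blast
    have "B N y = holds M \<phi> ([y] @ b)" for y
      using arg_cong[OF eq, of "\<lambda>S. [y] \<in> S"] by simp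
    then show ?thesis using \<phi> by blast
  qed
  then obtain b \<phi> where \<phi>: "\<And>N. \<phi> N \<in> formulas L (1 + length (b N))"
    and B: "\<And>N y. B N y = holds M (\<phi> N) ([y] @ b N)"
    by metis
  define A where "A = (\<Union>N. set (b N))"
  have "countable A" unfolding A_def by (intro countable_UN countableI_type) (auto simp: countable_finite)
  then have "|A| \<le>o natLeq"
    by (metis card_of_ordLeq card_of_nat countable_def inj_on_def ordLeq_ordIso_trans subset_UNIV)
  then have small: "|A| <o \<kappa>" using \<kappa> by (rule ordLeq_ordLess_trans)
  have "\<exists>x. \<forall>(\<phi>, b)\<in>range (\<lambda>N. (\<phi> N, b N)). holds M \<phi> ([x] @ b)"
  proof (rule sat[unfolded saturated_def, rule_format, of A], intro conjI allI impI small)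
    show "\<forall>(\<phi>, b)\<in>range (\<lambda>N. (\<phi> N, b N)). set b \<subseteq> A \<and> \<phi> \<in> formulas L (1 + length b)"
      using \<phi> by (auto simp: A_def)
    fix q assume "q \<subseteq> range (\<lambda>N. (\<phi> N, b N))" "finite q"
    then obtain F where F: "finite F" "q = (\<lambda>N. (\<phi> N, b N)) ` F"
      by (meson finite_subset_image)
    obtain e where e: "\<forall>m<n. e m = a m" "\<forall>i<Max (insert 0 F). P i e"
      using fin by blast
    have "B N (e n)" if "N \<in> F" for N
    proof -
      have "N \<le> Max (insert 0 F)" using F(1) that by simp
      then show ?thesis unfolding B_def using e by (intro exI[of _ e]) auto
    qed
    then show "\<exists>x. \<forall>(\<phi>, b)\<in>q. holds M \<phi> ([x] @ b)"
      using B F(2) by auto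
  qed
  then obtain x where "\<And>N. B N x"
    using B by auto
  then show ?thesis
    using that unfolding B_def by blast
qed

text \<open>The coordinates are fixed one at a time so that all finite sets of conditions stay
  satisfiable. The diagonal sequence satisfies each \<open>P i\<close>, since \<open>P i\<close>
  looks at finitely many coordinates.\<close>

lemma edef_compactness:
  fixes P :: "nat \<Rightarrow> (nat \<Rightarrow> 'a) \<Rightarrow> bool"
  assumes sat: "saturated \<kappa> L M" and \<kappa>: "natLeq <o \<kappa>"
    and P: "\<And>i. edef L M (P i)" and fin: "\<And>N. \<exists>e. \<forall>i<N. P i e"
  shows "\<exists>e. \<forall>i. P i e"
proof -
  define good where "good n a \<longleftrightarrow> (\<forall>N. \<exists>e. (\<forall>m<n. e m = a m) \<and> (\<forall>i<N. P i e))" for n a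
  have "\<exists>x. good (Suc n) (a(n := x))" if "good n a" for n a
  proof -
    have "\<And>N. \<exists>e. (\<forall>m<n. e m = a m) \<and> (\<forall>i<N. P i e)"
      using that unfolding good_def by blast
    then obtain x where x: "\<And>N. \<exists>e. (\<forall>m<n. e m = a m) \<and> e n = x \<and> (\<forall>i<N. P i e)"
      by (rule finitely_satisfiable_extend[OF sat \<kappa> P, where n = n and a = a]) blast+
    have "good (Suc n) (a(n := x))"
      unfolding good_def
    proof
      fix N
      obtain e where "\<forall>m<n. e m = a m" "e n = x" "\<forall>i<N. P i e" using x by blast
      then show "\<exists>e. (\<forall>m<Suc n. e m = (a(n := x)) m) \<and> (\<forall>i<N. P i e)"
        by (intro exI[of _ e]) (auto simp: less_Suc_eq)
    qed
    then show ?thesis by blast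
  qed
  then obtain X where X: "\<And>n a. good n a \<Longrightarrow> good (Suc n) (a(n := X n a))" by metis
  define S where "S = rec_nat (\<lambda>_. undefined) (\<lambda>n a. a(n := X n a))"
  have S: "S (Suc n) = (S n)(n := X n (S n))" for n by (simp add: S_def)
  have good: "good n (S n)" for n
  proof (induction n)
    case 0
    then show ?case using fin by (simp add: good_def)
  next
    case (Suc n)
    then show ?case using X[OF Suc] by (simp only: S)
  qed
  have stable: "S n m = S (Suc m) m" if "m < n" for m n
    using that
  proof (induction n)
    case (Suc n)
    show ?case
    proof (cases "m = n")
      case False
      then have "S (Suc n) m = S n m" by (simp only: S fun_upd_other not_False_eq_True)
      then show ?thesis using Suc False by simp
    qed simp
  qed simp
  have "P i (\<lambda>m. S (Suc m) m)" for i
  proof -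
    obtain W where W: "finite W" "\<And>e e'. (\<And>v. v \<in> W \<Longrightarrow> e v = e' v) \<Longrightarrow> P i e = P i e'"
      using edef_finite_support[OF P] by metis
    obtain n where n: "W \<subseteq> {..<n}" using finite_nat_bounded[OF W(1)] by blast
    obtain e where e: "\<forall>m<n. e m = S n m" "\<forall>j<Suc i. P j e"
      using good[of n] unfolding good_def by blast
    have "P i e = P i (\<lambda>m. S (Suc m) m)"
    proof (rule W(2))
      fix v assume "v \<in> W"
      then have "v < n" using n by auto
      then show "e v = S (Suc v) v" using e(1) stable[of v n] by metis
    qed
    then show ?thesis using e(2) by simp
  qed
  then show ?thesis by blast
qed

lemma dfn_compactness:
  fixes P :: "nat \<Rightarrow> ('v::countable \<Rightarrow> 'a list) \<Rightarrow> bool"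
  assumes sat: "saturated \<kappa> L M" and \<kappa>: "natLeq <o \<kappa>"
    and P: "\<And>i. dfn L M len (P i)"
    and fin: "\<And>N. \<exists>E. (\<forall>v. length (E v) = len v) \<and> (\<forall>i<N. P i E)"
  obtains E where "\<And>v. length (E v) = len v" "\<And>i. P i E"
proof -
  define Q where "Q i e = P i (tuples len (\<lambda>u. e (to_nat u)))" for i and e :: "nat \<Rightarrow> 'a"
  have "edef L M (Q i)" for i
    using edef_subst[OF P[unfolded dfn_def], where g = "\<lambda>u. Inl (to_nat u)"] by (simp add: Q_def[abs_def])
  moreover have "\<exists>e. \<forall>i<N. Q i e" for N
  proof -
    obtain E where E: "\<And>v. length (E v) = len v" "\<forall>i<N. P i E" using fin by blast
    define e where "e = (\<lambda>m. case from_nat m of (v, x) \<Rightarrow> E v ! x)"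
    have "tuples len (\<lambda>u. e (to_nat u)) = E"
      using tuples_surj[of E len] E(1) by (simp add: e_def)
    then have "\<forall>i<N. Q i e" using E(2) by (simp add: Q_def)
    then show ?thesis by blast
  qed
  ultimately obtain e where "\<forall>i. Q i e"
    using edef_compactness[OF sat \<kappa>] by blast
  then show ?thesis by (intro that[of "tuples len (\<lambda>u. e (to_nat u))"]) (auto simp: Q_def)
qed

section \<open>Patterns\<close>

lemma strict_mono_on_lessThanI:
  fixes g :: "nat \<Rightarrow> nat"
  assumes "\<And>t. Suc t < w \<Longrightarrow> g t < g (Suc t)"
  shows "strict_mono_on {..<w} g"
proof (rule strict_mono_onI)
  fix r s assume "r \<in> {..<w}" "s \<in> {..<w}" "r < s"
  from this(3,2) show "g r < g s"
  proof (induction s)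
    case (Suc s)
    then show ?case using assms[of s] by (cases "r = s") (auto intro: less_trans)
  qed simp
qed

lemma has_ict_pattern_mono:
  assumes "has_ict_pattern L M p D m" "D \<subseteq> D'" "m' \<le> m"
  shows "has_ict_pattern L M p D' m'"
proof -
  obtain \<phi> l b where \<phi>: "\<forall>i<m. \<phi> i \<in> formulas L (p + l i) \<and> (\<forall>j. length (b i j) = l i)"
    and b: "\<And>\<eta>. \<exists>a\<in>D. \<forall>i<m. \<forall>j::nat. holds M (\<phi> i) (a @ b i j) \<longleftrightarrow> j = \<eta> i"
    using assms(1) unfolding has_ict_pattern_def by blast
  have "\<exists>a\<in>D'. \<forall>i<m'. \<forall>j. holds M (\<phi> i) (a @ b i j) \<longleftrightarrow> j = \<eta> i" for \<eta>
    using b[of \<eta>] assms(2,3) by (meson order_less_le_trans subsetD)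
  then show ?thesis
    unfolding has_ict_pattern_def using \<phi> assms(3)
    by (intro exI[of _ \<phi>] exI[of _ l] exI[of _ b]) auto
qed

lemma has_ict_patternE:
  assumes "has_ict_pattern L M p D m" "definable L M p D"
  obtains \<Phi> l c where "\<And>i. i < m \<Longrightarrow> definable L M (p + l i) (\<Phi> i)"
    "\<And>i j. i < m \<Longrightarrow> length (c i j) = l i"
    "\<And>\<eta> :: nat \<Rightarrow> nat. \<exists>a\<in>D. \<forall>i<m. \<forall>j. a @ c i j \<in> \<Phi> i \<longleftrightarrow> j = \<eta> i"
proof -
  obtain \<phi> l c where \<phi>: "\<And>i. i < m \<Longrightarrow> \<phi> i \<in> formulas L (p + l i)"
    and l: "\<And>i j. i < m \<Longrightarrow> length (c i j) = l i"
    and \<eta>: "\<And>\<eta> :: nat \<Rightarrow> nat. \<exists>a\<in>D. \<forall>i<m. \<forall>j. holds M (\<phi> i) (a @ c i j) \<longleftrightarrow> j = \<eta> i"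
    using assms(1) unfolding has_ict_pattern_def by blast
  define \<Phi> where "\<Phi> i = {v. length v = p + l i \<and> holds M (\<phi> i) v}" for i
  have "definable L M (p + l i) (\<Phi> i)" if "i < m" for i
    unfolding definable_def \<Phi>_def using \<phi>[OF that]
    by (intro exI[of _ "[]"] bexI[of _ "\<phi> i"]) auto
  moreover have "\<exists>a\<in>D. \<forall>i<m. \<forall>j. a @ c i j \<in> \<Phi> i \<longleftrightarrow> j = \<eta> i" for \<eta> :: "nat \<Rightarrow> nat"
    using \<eta>[of \<eta>] l definable_length[OF assms(2)] unfolding \<Phi>_def by auto
  ultimately show ?thesis using that l by blast
qed

lemma dp_rank_eqI:
  assumes "has_ict_pattern L M p D s" "\<And>m. has_ict_pattern L M p D m \<Longrightarrow> m \<le> s"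
  shows "dp_rank L M p D = enat s"
  unfolding dp_rank_def by (rule antisym) (auto intro!: SUP_least SUP_upper assms)

lemma has_ict_pattern_le_dp_rank:
  assumes "dp_rank L M p D = enat r" "has_ict_pattern L M p D m"
  shows "m \<le> r"
proof -
  have "enat m \<le> dp_rank L M p D"
    unfolding dp_rank_def using assms(2) by (intro SUP_upper) simp
  then show ?thesis using assms(1) by simp
qed

text \<open>The assumption \<open>r > 0\<close> excludes the empty set, whose rank is 0 although it carries no pattern
  of depth 0.\<close>

lemma has_ict_pattern_dp_rank:
  assumes "dp_rank L M p D = enat r" "r > 0"
  shows "has_ict_pattern L M p D r"
proof (rule ccontr)
  assume "\<not> has_ict_pattern L M p D r"
  then have "m < r" if "has_ict_pattern L M p D m" for m
    using has_ict_pattern_mono[OF that order_refl, of r] by (meson not_less)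
  then have "dp_rank L M p D \<le> enat (r - 1)"
    unfolding dp_rank_def by (intro SUP_least) fastforce
  then show False using assms by simp
qed

section \<open>Infinite patterns from finite grids by compactness\<close>

locale saturated_structure =
  fixes \<kappa> :: "'k rel" and L :: "('f, 'r) language" and M :: "('f, 'r, 'a) struct"
  assumes saturated: "saturated \<kappa> L M" and natLeq_less: "natLeq <o \<kappa>"
begin

text \<open>For fixed sets \<open>\<Phi> i\<close>, finite grids of every size give an infinite
  pattern by compactness. The parameters defining the \<open>\<Phi> i\<close> are absorbed into the
  parameters of the pattern.\<close>

lemma has_ict_pattern_of_grids:
  fixes I :: "'i set"
  assumes I: "finite I" and D: "definable L M p D"
    and \<Phi>: "\<And>i. i \<in> I \<Longrightarrow> definable L M (p + l i) (\<Phi> i)"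
    and grids: "\<And>k :: nat. \<exists>c. (\<forall>i\<in>I. \<forall>j<k. length (c i j) = l i) \<and>
      (\<forall>\<eta>. (\<forall>i\<in>I. \<eta> i < k) \<longrightarrow> (\<exists>a\<in>D. \<forall>i\<in>I. \<forall>j<k. a @ c i j \<in> \<Phi> i \<longleftrightarrow> j = \<eta> i))"
  shows "has_ict_pattern L M p D (card I)"
proof -
  define m where "m = card I"
  obtain \<rho> where \<rho>: "bij_betw \<rho> {..<m} I"
    using I m_def ex_bij_betw_nat_finite lessThan_atLeast0 by metis
  define \<sigma> where "\<sigma> = inv_into {..<m} \<rho>"
  have \<rho>I: "\<rho> i \<in> I" "\<sigma> (\<rho> i) = i" if "i < m" for i
    using \<rho> that by (auto simp: \<sigma>_def bij_betw_def)
  have \<sigma>I: "\<sigma> i < m" "\<rho> (\<sigma> i) = i" if "i \<in> I" for i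
    using \<rho> that by (auto simp: \<sigma>_def bij_betw_def f_inv_into_f dest: inv_into_into)
  \<comment> \<open>\<open>Inl (i, j)\<close> is the variable for a row parameter,
    \<open>Inr xs\<close> the one for the witness of the path \<open>xs\<close>. Finite lists serve
    as paths to keep the index type countable.\<close>
  define len :: "(nat \<times> nat) + nat list \<Rightarrow> nat"
    where "len = case_sum (\<lambda>(i, j). l (\<rho> i)) (\<lambda>_. p)"
  define pth where "pth N = {xs :: nat list. set xs \<subseteq> {..<N} \<and> length xs = m}" for N
  define P where "P N E \<longleftrightarrow> (\<forall>\<eta>\<in>pth N. E (Inr \<eta>) \<in> D \<and> (\<forall>i\<in>{..<m}. \<forall>j\<in>{..<N}.
    E (Inr \<eta>) @ E (Inl (i, j)) \<in> \<Phi> (\<rho> i) \<longleftrightarrow> j = \<eta> ! i))" for N E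
  have "dfn L M len (P N)" for N
    unfolding P_def pth_def
    by (intro dfn_ball dfn_intros dfn_mem[OF D] dfn_mem[OF \<Phi>] tuple_term_intros
        finite_lists_length_eq finite_lessThan) (auto simp: \<rho>I)
  moreover have "\<exists>E. (\<forall>v. length (E v) = len v) \<and> (\<forall>i<N. P i E)" for N
  proof -
    obtain c where c: "\<And>i j. i \<in> I \<Longrightarrow> j < N \<Longrightarrow> length (c i j) = l i"
      and c_pat: "\<And>\<eta>. (\<forall>i\<in>I. \<eta> i < N) \<Longrightarrow> \<exists>a\<in>D. \<forall>i\<in>I. \<forall>j<N. a @ c i j \<in> \<Phi> i \<longleftrightarrow> j = \<eta> i"
      using grids[of N] by blast
    have "\<exists>a\<in>D. \<forall>i\<in>I. \<forall>j<N. a @ c i j \<in> \<Phi> i \<longleftrightarrow> j = xs ! \<sigma> i" if "xs \<in> pth N" for xs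
      using that \<sigma>I(1) by (intro c_pat) (auto simp: pth_def subset_iff)
    then obtain a where a: "\<And>xs. xs \<in> pth N \<Longrightarrow> a xs \<in> D"
      "\<And>xs i j. xs \<in> pth N \<Longrightarrow> i \<in> I \<Longrightarrow> j < N \<Longrightarrow> a xs @ c i j \<in> \<Phi> i \<longleftrightarrow> j = xs ! \<sigma> i"
      by metis
    define E where "E = case_sum
      (\<lambda>(i, j). if i < m \<and> j < N then c (\<rho> i) j else replicate (l (\<rho> i)) undefined)
      (\<lambda>xs. if xs \<in> pth N then a xs else replicate p undefined)"
    have "length (E v) = len v" for v
      using c \<rho>I definable_length[OF D a(1)] by (auto simp: E_def len_def split: sum.splits)
    moreover have "P n E" if "n < N" for n
    proof -
      have "pth n \<subseteq> pth N" using that by (auto simp: pth_def)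
      then show ?thesis
        unfolding P_def using a \<rho>I that by (auto simp: E_def subset_iff)
    qed
    ultimately show ?thesis by blast
  qed
  ultimately obtain E where E: "\<And>v. length (E v) = len v" "\<And>N. P N E"
    by (rule dfn_compactness[OF saturated natLeq_less, of len P]) (rule that)
  define def where "def i b \<phi> \<longleftrightarrow> \<phi> \<in> formulas L (p + l (\<rho> i) + length b) \<and>
      \<Phi> (\<rho> i) = {v. length v = p + l (\<rho> i) \<and> holds M \<phi> (v @ b)}" for i b \<phi>
  have "\<exists>b \<phi>. def i b \<phi>" if "i < m" for i
    using \<Phi>[OF \<rho>I(1)[OF that]] unfolding definable_def def_def by blast
  then obtain b \<phi> where "\<And>i. i < m \<Longrightarrow> def i (b i) (\<phi> i)" by metis
  then have \<phi>: "\<And>i. i < m \<Longrightarrow> \<phi> i \<in> formulas L (p + l (\<rho> i) + length (b i))"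
    and \<Phi>\<phi>: "\<And>i. i < m \<Longrightarrow> \<Phi> (\<rho> i) = {v. length v = p + l (\<rho> i) \<and> holds M (\<phi> i) (v @ b i)}"
    unfolding def_def by blast+
  have "\<exists>a\<in>D. \<forall>i<m. \<forall>j. holds M (\<phi> i) (a @ E (Inl (i, j)) @ b i) \<longleftrightarrow> j = \<eta> i" for \<eta>
  proof -
    define xs where "xs = map \<eta> [0..<m]"
    have aD: "E (Inr xs) \<in> D"
    proof -
      have "xs \<in> pth (Suc (Max (insert 0 (set xs))))" by (auto simp: pth_def xs_def less_Suc_eq_le)
      then show ?thesis using E(2) unfolding P_def by blast
    qed
    moreover have "holds M (\<phi> i) (E (Inr xs) @ E (Inl (i, j)) @ b i) \<longleftrightarrow> j = \<eta> i" if "i < m" for i j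
    proof -
      have "x < Suc (Max (insert j (set xs)))" if "x \<in> set xs" for x
        using that by (intro le_imp_less_Suc Max_ge) simp_all
      then have "xs \<in> pth (Suc (Max (insert j (set xs))))" by (auto simp: pth_def xs_def)
      moreover have "j < Suc (Max (insert j (set xs)))" by (simp add: less_Suc_eq_le)
      ultimately have "E (Inr xs) @ E (Inl (i, j)) \<in> \<Phi> (\<rho> i) \<longleftrightarrow> j = xs ! i"
        using E(2)[of "Suc (Max (insert j (set xs)))"] that unfolding P_def by blast
      then show ?thesis
        using \<Phi>\<phi>[OF that] E(1)[of "Inl (i, j)"] E(1)[of "Inr xs"] that by (simp add: len_def xs_def)
    qed
    ultimately show ?thesis by blast
  qed
  then show ?thesis
    unfolding has_ict_pattern_def m_def[symmetric]
    using \<phi> E(1)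
    by (intro exI[of _ \<phi>] exI[of _ "\<lambda>i. l (\<rho> i) + length (b i)"] exI[of _ "\<lambda>i j. E (Inl (i, j)) @ b i"])
       (auto simp: len_def add.assoc)
qed

text \<open>After thinning out the rows, the truth value of \<open>\<Phi> i\<close> at a witness is constant to the left of
  \<open>\<zeta> i\<close> and constant to the right of \<open>\<zeta>' i\<close>. Hence the conjunction of \<open>\<Phi> i\<close> and its negation
  at consecutive parameters isolates the pair \<open>(\<zeta> i, \<zeta>' i)\<close>.\<close>

lemma has_ict_pattern_of_pairs:
  fixes I :: "'i set"
  assumes I: "finite I" and D: "definable L M p D"
    and \<Phi>: "\<And>i. i \<in> I \<Longrightarrow> definable L M (p + l i) (\<Phi> i)"
    and pairs: "\<And>k :: nat. \<exists>c. (\<forall>i\<in>I. \<forall>j<k. length (c i j) = l i) \<and>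
      (\<forall>\<zeta> \<zeta>'. (\<forall>i\<in>I. \<zeta> i < \<zeta>' i \<and> \<zeta>' i < k) \<longrightarrow>
        (\<exists>a\<in>D. \<forall>i\<in>I. a @ c i (\<zeta> i) \<in> \<Phi> i \<and> a @ c i (\<zeta>' i) \<notin> \<Phi> i))"
  shows "has_ict_pattern L M p D (card I)"
proof (rule has_ict_pattern_of_grids[OF I D])
  define \<Psi> where "\<Psi> i = {v. length v = p + 2 * l i \<and> (take p v @ take (l i) (drop p v) \<in> \<Phi> i \<and>
    take p v @ drop (p + l i) v \<notin> \<Phi> i)}" for i
  show "definable L M (p + 2 * l i) (\<Psi> i)" if "i \<in> I" for i
    unfolding \<Psi>_def
    by (intro definable_dfn dfn_intros dfn_mem[OF \<Phi>[OF that]] tuple_term_intros)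
  fix k :: nat
  \<comment> \<open>The pair for \<open>j\<close> occupies the positions \<open>2 * j + 1\<close>
    and \<open>2 * j + 2\<close>; the positions 0 and \<open>2 * k + 1\<close> remain as probes to
    the left and to the right of all pairs.\<close>
  define K where "K = 2 * k + 2"
  show "\<exists>c. (\<forall>i\<in>I. \<forall>j<k. length (c i j) = 2 * l i) \<and>
      (\<forall>\<eta>. (\<forall>i\<in>I. \<eta> i < k) \<longrightarrow> (\<exists>a\<in>D. \<forall>i\<in>I. \<forall>j<k. a @ c i j \<in> \<Psi> i \<longleftrightarrow> j = \<eta> i))"
  proof (rule product_ramsey[OF I, of "Pow I \<times> Pow I" K 4])
    show "finite (Pow I \<times> Pow I)" using I by simp
    fix N :: nat
    assume ramsey: "\<And>col :: ('i \<Rightarrow> nat \<Rightarrow> nat) \<Rightarrow> 'i set \<times> 'i set. (\<And>g. col g \<in> Pow I \<times> Pow I) \<Longrightarrow>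
        (\<And>g g'. (\<And>i t. i \<in> I \<Longrightarrow> t < 4 \<Longrightarrow> g i t = g' i t) \<Longrightarrow> col g = col g') \<Longrightarrow>
        \<exists>h v. (\<forall>i\<in>I. strict_mono_on {..<K} (h i) \<and> h i ` {..<K} \<subseteq> {..<N}) \<and>
        (\<forall>g. (\<forall>i\<in>I. strict_mono_on {..<4} (g i) \<and> g i ` {..<4} \<subseteq> {..<K}) \<longrightarrow>
           col (\<lambda>i t. h i (g i t)) = v)"
    obtain c where c: "\<And>i j. i \<in> I \<Longrightarrow> j < N \<Longrightarrow> length (c i j) = l i"
      and "\<And>\<zeta> \<zeta>'. (\<forall>i\<in>I. \<zeta> i < \<zeta>' i \<and> \<zeta>' i < N) \<Longrightarrow>
        \<exists>a\<in>D. \<forall>i\<in>I. a @ c i (\<zeta> i) \<in> \<Phi> i \<and> a @ c i (\<zeta>' i) \<notin> \<Phi> i"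
      using pairs[of N] by blast
    then obtain A where A: "\<And>\<zeta> \<zeta>'. (\<forall>i\<in>I. \<zeta> i < \<zeta>' i \<and> \<zeta>' i < N) \<Longrightarrow> A \<zeta> \<zeta>' \<in> D \<and>
        (\<forall>i\<in>I. A \<zeta> \<zeta>' @ c i (\<zeta> i) \<in> \<Phi> i \<and> A \<zeta> \<zeta>' @ c i (\<zeta>' i) \<notin> \<Phi> i)"
      by metis
    \<comment> \<open>Of the four points of \<open>g\<close> in each row, the middle two form the
      pair realized by the witness \<open>B g\<close>; the outer two test the row on either side,
      and \<open>col\<close> records the outcome. \<open>restrict\<close> makes the witness
      independent of values outside \<open>I\<close>.\<close>
    define B where "B g = A (restrict (\<lambda>i. g i 1) I) (restrict (\<lambda>i. g i 2) I)"
      for g :: "'i \<Rightarrow> nat \<Rightarrow> nat"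
    define col where "col g = ({i\<in>I. B g @ c i (g i 0) \<in> \<Phi> i}, {i\<in>I. B g @ c i (g i 3) \<in> \<Phi> i})"
      for g :: "'i \<Rightarrow> nat \<Rightarrow> nat"
    have colC: "col g \<in> Pow I \<times> Pow I" for g by (auto simp: col_def)
    have dep: "col g = col g'" if "\<And>i t. i \<in> I \<Longrightarrow> t < 4 \<Longrightarrow> g i t = g' i t" for g g'
    proof -
      have "B g = B g'"
        unfolding B_def using that by (intro arg_cong2[where f = A] restrict_ext) auto
      then show ?thesis using that[of _ 0] that[of _ 3] by (auto simp: col_def)
    qed
    obtain h v where hv: "\<forall>i\<in>I. strict_mono_on {..<K} (h i) \<and> h i ` {..<K} \<subseteq> {..<N}"
        "\<forall>g. (\<forall>i\<in>I. strict_mono_on {..<4} (g i) \<and> g i ` {..<4} \<subseteq> {..<K}) \<longrightarrow>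
          col (\<lambda>i t. h i (g i t)) = v"
      using ramsey[of col, OF colC dep] by blast
    then have h: "\<And>i. i \<in> I \<Longrightarrow> strict_mono_on {..<K} (h i)"
        "\<And>i. i \<in> I \<Longrightarrow> h i ` {..<K} \<subseteq> {..<N}"
      and v: "\<And>g. (\<forall>i\<in>I. strict_mono_on {..<4} (g i) \<and> g i ` {..<4} \<subseteq> {..<K}) \<Longrightarrow>
        col (\<lambda>i t. h i (g i t)) = v"
      by simp_all
    define d where "d i j = c i (h i (2 * j + 1)) @ c i (h i (2 * j + 2))" for i j
    have hK: "h i x < N" if "i \<in> I" "x < K" for i x
      using h(2)[OF that(1)] that(2) by auto
    have "\<exists>a\<in>D. \<forall>i\<in>I. \<forall>j<k. a @ d i j \<in> \<Psi> i \<longleftrightarrow> j = \<eta> i" if \<eta>: "\<forall>i\<in>I. \<eta> i < k" for \<eta>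
    proof -
      define a where "a = A (restrict (\<lambda>i. h i (2 * \<eta> i + 1)) I) (restrict (\<lambda>i. h i (2 * \<eta> i + 2)) I)"
      have a: "a \<in> D \<and> (\<forall>i\<in>I. a @ c i (h i (2 * \<eta> i + 1)) \<in> \<Phi> i \<and> a @ c i (h i (2 * \<eta> i + 2)) \<notin> \<Phi> i)"
      proof -
        have "h i (2 * \<eta> i + 1) < h i (2 * \<eta> i + 2) \<and> h i (2 * \<eta> i + 2) < N" if "i \<in> I" for i
          using h(1)[OF that] hK[OF that] \<eta> that by (fastforce simp: strict_mono_on_def K_def)
        then show ?thesis unfolding a_def
          using A[of "restrict (\<lambda>i. h i (2 * \<eta> i + 1)) I" "restrict (\<lambda>i. h i (2 * \<eta> i + 2)) I"] by simp
      qed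
      define G where "G x y i t =
        (if t = 0 then x i else if t = 1 then 2 * \<eta> i + 1 else if t = 2 then 2 * \<eta> i + 2 else y i)"
        for x y and i :: 'i and t :: nat
      have G: "col (\<lambda>i t. h i (G x y i t)) = v"
        if "\<And>i. i \<in> I \<Longrightarrow> x i < 2 * \<eta> i + 1 \<and> 2 * \<eta> i + 2 < y i \<and> y i < K" for x y
      proof (rule v, intro ballI conjI)
        fix i assume i: "i \<in> I"
        show "strict_mono_on {..<4} (G x y i)"
        proof (rule strict_mono_on_lessThanI)
          fix t :: nat assume "Suc t < 4"
          then have "t = 0 \<or> t = 1 \<or> t = 2" by auto
          then show "G x y i t < G x y i (Suc t)" using that[OF i] by (auto simp: G_def)
        qed
        show "G x y i ` {..<4} \<subseteq> {..<K}" using that[OF i] by (auto simp: G_def)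
      qed
      have BG: "B (\<lambda>i t. h i (G x y i t)) = a" for x y
        by (simp add: B_def a_def G_def)
      \<comment> \<open>The left probe of row \<open>i\<close> is moved to \<open>x\<close> while
        the other rows keep their default probes; homogeneity then decides the truth value.\<close>
      have left: "a @ c i (h i x) \<in> \<Phi> i \<longleftrightarrow> i \<in> fst v" if i: "i \<in> I" "x < 2 * \<eta> i + 1" for i x
      proof -
        have "col (\<lambda>i' t. h i' (G (\<lambda>i'. if i' = i then x else 0) (\<lambda>_. 2 * k + 1) i' t)) = v"
          using \<eta> i by (intro G) (auto simp: K_def)
        then show ?thesis using i by (auto simp: col_def BG) (auto simp: G_def)
      qed
      have right: "a @ c i (h i y) \<in> \<Phi> i \<longleftrightarrow> i \<in> snd v" if i: "i \<in> I" "2 * \<eta> i + 2 < y" "y < K" for i y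
      proof -
        have "col (\<lambda>i' t. h i' (G (\<lambda>_. 0) (\<lambda>i'. if i' = i then y else 2 * k + 1) i' t)) = v"
          using \<eta> i by (intro G) (auto simp: K_def)
        then show ?thesis using i by (auto simp: col_def BG) (auto simp: G_def)
      qed
      have "a @ d i j \<in> \<Psi> i \<longleftrightarrow> j = \<eta> i" if i: "i \<in> I" "j < k" for i j
      proof -
        have len: "length a = p" "length (c i (h i (2 * j + 1))) = l i" "length (c i (h i (2 * j + 2))) = l i"
          using a definable_length[OF D] c hK i by (auto simp: K_def)
        then have "a @ d i j \<in> \<Psi> i \<longleftrightarrow> a @ c i (h i (2 * j + 1)) \<in> \<Phi> i \<and> a @ c i (h i (2 * j + 2)) \<notin> \<Phi> i"
          by (simp add: \<Psi>_def d_def)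
        \<comment> \<open>For \<open>j \<noteq> \<eta> i\<close> both positions lie on the same side
          of the realized pair and get equal truth values, which excludes membership in
          \<open>\<Psi> i\<close>.\<close>
        moreover consider "j < \<eta> i" | "j = \<eta> i" | "j > \<eta> i" by linarith
        then have "(a @ c i (h i (2 * j + 1)) \<in> \<Phi> i \<and> a @ c i (h i (2 * j + 2)) \<notin> \<Phi> i) \<longleftrightarrow> j = \<eta> i"
        proof cases
          case 1
          then show ?thesis using left[OF i(1), of "2 * j + 1"] left[OF i(1), of "2 * j + 2"] by simp
        next
          case 2
          then show ?thesis using a i by simp
        next
          case 3
          then show ?thesis using right[OF i(1), of "2 * j + 1"] right[OF i(1), of "2 * j + 2"] i
            by (simp add: K_def)
        qed
        ultimately show ?thesis by simp
      qed
      then show ?thesis using a by blast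
    qed
    moreover have "length (d i j) = 2 * l i" if "i \<in> I" "j < k" for i j
      using c hK that by (simp add: d_def K_def)
    ultimately show ?thesis by blast
  qed
qed

text \<open>Distinct elements form a pattern of depth 1 for the formula
  \<open>x = y\<close>.\<close>

lemma has_ict_pattern_infinite:
  assumes D: "definable L M p D" and inf: "infinite D"
  shows "has_ict_pattern L M p D 1"
proof -
  obtain b :: "nat \<Rightarrow> 'a list" where b: "inj b" "range b \<subseteq> D"
    using infinite_countable_subset[OF inf] by blast
  have "has_ict_pattern L M p D (card {()})"
  proof (rule has_ict_pattern_of_grids[OF _ D])
    show "definable L M (p + p) {v. length v = p + p \<and> take p v = drop p v}"
      by (intro definable_dfn dfn_intros tuple_term_intros)
    have "length (b j) = p" for j using b(2) definable_length[OF D] by blast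
    then show "\<exists>c. (\<forall>i\<in>{()}. \<forall>j<k. length (c i j) = p) \<and>
        (\<forall>\<eta>. (\<forall>i\<in>{()}. \<eta> i < k) \<longrightarrow> (\<exists>a\<in>D. \<forall>i\<in>{()}. \<forall>j<k.
          a @ c i j \<in> {v. length v = p + p \<and> take p v = drop p v} \<longleftrightarrow> j = \<eta> i))" for k :: nat
      using b by (intro exI[of _ "\<lambda>_. b"]) (auto intro!: bexI[of _ "b _"] simp: inj_eq)
  qed simp
  then show ?thesis by simp
qed

end

section \<open>Splitting a pattern along a fibration\<close>

definition slice :: "(nat \<Rightarrow> nat) \<Rightarrow> nat \<Rightarrow> 'a list \<Rightarrow> 'a list" where
  "slice sz i v = take (sz i) (drop (\<Sum>i'<i. sz i') v)"

lemma join_Suc: "join (Suc n) x = join n x @ x n"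
  by (simp add: join_def)

lemma join_cong: "(\<And>i. i < n \<Longrightarrow> x i = y i) \<Longrightarrow> join n x = join n y"
  by (induction n) (simp_all add: join_Suc join_def[of 0])

lemma length_join: "(\<And>i. i < n \<Longrightarrow> length (x i) = sz i) \<Longrightarrow> length (join n x) = (\<Sum>i<n. sz i)"
  by (induction n) (simp_all add: join_Suc join_def[of 0])

lemma slice_join_append:
  assumes "\<And>i. i < n \<Longrightarrow> length (x i) = sz i" "i < n"
  shows "slice sz i (join n x @ w) = x i"
  using assms
proof (induction n arbitrary: w)
  case (Suc n)
  show ?case
  proof (cases "i < n")
    case True
    then show ?thesis using Suc.IH[of "x n @ w"] Suc.prems(1) by (simp add: join_Suc)
  next
    case False
    then have "i = n" using Suc.prems(2) by simp
    moreover have "length (join n x) = (\<Sum>i<n. sz i)"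
      using Suc.prems(1) by (intro length_join) simp
    ultimately show ?thesis using Suc.prems(1)[of n] by (simp add: slice_def join_Suc)
  qed
qed simp

lemma slice_join:
  "(\<And>i. i < n \<Longrightarrow> length (x i) = sz i) \<Longrightarrow> i < n \<Longrightarrow> slice sz i (join n x) = x i"
  using slice_join_append[of n x sz i "[]"] by simp

lemma tuple_term_slice: "tuple_term len T \<Longrightarrow> tuple_term len (\<lambda>E. slice sz i (T E))"
  unfolding slice_def by (intro tuple_term_take tuple_term_drop)

text \<open>The point \<open>x\<close> realizes the path \<open>\<zeta>\<close> through the rows in \<open>T\<close>. In the fibre over \<open>x\<close>, the rows in
  \<open>Q\<close> are realized by \<open>m\<close> distinct elements, the \<open>t\<close>-th of which uses its own copy \<open>e i t\<close> of the rows.\<close>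

definition split_witness where
  "split_witness Q T Z \<Phi> \<Theta> m q p k d e \<zeta> x \<longleftrightarrow> length x = p \<and>
     (\<forall>i\<in>T. x @ d i (\<zeta> i) \<in> \<Theta> i \<and> (\<forall>j<k. \<zeta> i < j \<longrightarrow> x @ d i j \<notin> \<Theta> i)) \<and>
     (\<forall>J J'. (\<forall>i\<in>Q. \<forall>t<m. J i t < J' i t \<and> J' i t < k) \<longrightarrow>
       (\<exists>ys. (\<forall>t<m. length (ys t) = q \<and> ys t @ x \<in> Z \<and>
           (\<forall>i\<in>Q. ys t @ x @ e i t (J i t) \<in> \<Phi> i \<and> ys t @ x @ e i t (J' i t) \<notin> \<Phi> i)) \<and>
         (Q \<noteq> {} \<longrightarrow> inj_on ys {..<m::nat})))"
  for Q T :: "nat set" and Z :: "'a list set" and k :: nat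

context saturated_structure
begin

text \<open>\<open>\<chi> S x z\<close> says that some \<open>y\<close> in the fibre over
  \<open>x\<close> meets one positive and \<open>m\<close> negative conditions in each row of
  \<open>S\<close>. For the rows in \<open>Q\<close>, the first negative condition becomes the
  failure at \<open>J' i t\<close>, and the others separate \<open>ys t\<close> from later
  copies.\<close>

lemma pattern_split:
  fixes q p N m :: nat
  assumes Z: "definable L M (q + p) Z" and N: "has_ict_pattern L M (q + p) Z N" and m: "m \<ge> 1"
  obtains Q T :: "nat set" and \<Phi> \<Theta> l l\<Theta> where
    "finite Q" "finite T" "card Q + card T = N"
    "\<And>i. i \<in> Q \<Longrightarrow> definable L M (q + p + l i) (\<Phi> i)"
    "\<And>i. i \<in> T \<Longrightarrow> definable L M (p + l\<Theta>) (\<Theta> i)"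
    "\<And>k :: nat. \<exists>d e. (\<forall>i\<in>T. \<forall>j<k. length (d i j) = l\<Theta>) \<and>
      (\<forall>i\<in>Q. \<forall>t<m. \<forall>j<k. length (e i t j) = l i) \<and>
      (\<forall>\<zeta>. (\<forall>i\<in>T. \<zeta> i < k) \<longrightarrow> (\<exists>x. split_witness Q T Z \<Phi> \<Theta> m q p k d e \<zeta> x))"
proof -
  obtain \<Phi> l c where \<Phi>: "\<And>i. i < N \<Longrightarrow> definable L M (q + p + l i) (\<Phi> i)"
    and l: "\<And>i j. i < N \<Longrightarrow> length (c i j) = l i"
    and "\<And>\<eta> :: nat \<Rightarrow> nat. \<exists>a\<in>Z. \<forall>i<N. \<forall>j. a @ c i j \<in> \<Phi> i \<longleftrightarrow> j = \<eta> i"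
    by (rule has_ict_patternE[OF N Z]) blast
  then obtain W where W: "\<And>\<eta>. W \<eta> \<in> Z" "\<And>\<eta> i j. i < N \<Longrightarrow> W \<eta> @ c i j \<in> \<Phi> i \<longleftrightarrow> j = (\<eta> i :: nat)"
    by metis
  define \<chi> where "\<chi> S x z \<longleftrightarrow> (\<exists>y. length y = q \<and> (y @ x \<in> Z \<and>
      (\<forall>i\<in>S. y @ x @ z i 0 \<in> \<Phi> i \<and> (\<forall>b\<in>{1..m}. y @ x @ z i b \<notin> \<Phi> i))))"
    for S and x :: "'a list" and z :: "nat \<Rightarrow> nat \<Rightarrow> 'a list"
  have \<chi>_cong: "\<chi> S x z = \<chi> S x z'" if "\<And>i b. i \<in> S \<Longrightarrow> b \<le> m \<Longrightarrow> z i b = z' i b" for S x z z'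
    using that unfolding \<chi>_def by (intro ex_cong1 conj_cong ball_cong refl) auto

  \<comment> \<open>\<open>X g\<close> is the second component of the witness whose path takes the
    first point of \<open>g\<close> in each row. In the rows of \<open>A\<close>,
    \<open>zz A g\<close> offers the first half of the points, beginning with the selected one; in
    the other rows it offers the second half.\<close>
  define X where "X g = drop q (W (\<lambda>i. if i < N then g i 0 else 0))" for g :: "nat \<Rightarrow> nat \<Rightarrow> nat"
  define zz where "zz A g = (\<lambda>i b. c i (if i \<in> A then g i b else g i (m + 1 + b)))"
    for A :: "nat set" and g :: "nat \<Rightarrow> nat \<Rightarrow> nat"
  define col where "col g = {(S, A). S \<subseteq> {..<N} \<and> A \<subseteq> S \<and> \<chi> S (X g) (zz A g)}" for g
  define w where "w = 2 * (m + 1)"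
  have col_dep: "col g = col g'" if "\<And>i t. i \<in> {..<N} \<Longrightarrow> t < w \<Longrightarrow> g i t = g' i t" for g g'
  proof -
    have "(\<lambda>i. if i < N then g i 0 else 0) = (\<lambda>i. if i < N then g' i 0 else 0)"
      using that by (auto simp: fun_eq_iff w_def)
    then have "X g = X g'" by (simp add: X_def)
    moreover have "\<chi> S x (zz A g) = \<chi> S x (zz A g')" if "S \<subseteq> {..<N}" for S A x
      using that \<open>\<And>i t. i \<in> {..<N} \<Longrightarrow> t < w \<Longrightarrow> g i t = g' i t\<close>
      by (intro \<chi>_cong) (auto simp: zz_def w_def subset_iff)
    ultimately show ?thesis unfolding col_def by auto
  qed
  have col_Pow: "col g \<in> Pow (Pow {..<N} \<times> Pow {..<N})" for g
    by (auto simp: col_def)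
  have "\<exists>f. \<forall>k::nat. \<exists>h. (\<forall>i\<in>{..<N}. strict_mono_on {..<k} (h i)) \<and>
      (\<forall>g. (\<forall>i\<in>{..<N}. strict_mono_on {..<w} (g i) \<and> g i ` {..<w} \<subseteq> {..<k}) \<longrightarrow>
        col (\<lambda>i t. h i (g i t)) = f)"
    by (rule product_ramsey_uniform[OF _ _ col_Pow col_dep]) simp_all
  then obtain f where f: "\<And>k::nat. \<exists>h. (\<forall>i\<in>{..<N}. strict_mono_on {..<k} (h i)) \<and>
      (\<forall>g. (\<forall>i\<in>{..<N}. strict_mono_on {..<w} (g i) \<and> g i ` {..<w} \<subseteq> {..<k}) \<longrightarrow>
        col (\<lambda>i t. h i (g i t)) = f)"
    by blast

  \<comment> \<open>If all rows of \<open>S\<close> are at selected points, the first component of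
    the original witness confirms \<open>\<chi>\<close>.\<close>
  have f_full: "(S, S) \<in> f" if "S \<subseteq> {..<N}" for S
  proof -
    obtain h where h: "\<forall>i\<in>{..<N}. strict_mono_on {..<w} (h i)"
      and col: "col (\<lambda>i t. h i t) = f"
      using f[of w] by (auto dest!: spec[of _ "\<lambda>_ t. t"] simp: strict_mono_on_def)
    define \<eta> where "\<eta> = (\<lambda>i. if i < N then h i 0 else 0)"
    have "\<chi> S (drop q (W \<eta>)) (zz S h)"
      unfolding \<chi>_def
    proof (intro exI[of _ "take q (W \<eta>)"] conjI ballI)
      show "length (take q (W \<eta>)) = q"
        using definable_length[OF Z W(1)] by simp
      show "take q (W \<eta>) @ drop q (W \<eta>) \<in> Z" using W(1) by simp
      fix i assume i: "i \<in> S"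
      then have "i < N" using that by auto
      then show "take q (W \<eta>) @ drop q (W \<eta>) @ zz S h i 0 \<in> \<Phi> i"
        using W(2)[of i \<eta> "h i 0"] i by (simp add: zz_def \<eta>_def flip: append_assoc)
      fix b assume "b \<in> {1..m}"
      then have "h i 0 < h i b"
        using h \<open>i < N\<close> by (auto simp: strict_mono_on_def w_def)
      then show "take q (W \<eta>) @ drop q (W \<eta>) @ zz S h i b \<notin> \<Phi> i"
        using W(2)[of i \<eta> "h i b"] i \<open>i < N\<close> by (simp add: zz_def \<eta>_def flip: append_assoc)
    qed
    then have "(S, S) \<in> col h"
      using that by (simp add: col_def X_def \<eta>_def)
    then show ?thesis using col by simp
  qed

  define clean where "clean Q \<longleftrightarrow> Q \<subseteq> {..<N} \<and>
    (\<forall>S A. S \<subseteq> {..<N} \<and> A \<subseteq> S \<inter> Q \<longrightarrow> ((S, A) \<in> f \<longleftrightarrow> (S, {}) \<in> f))" for Q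
  have "finite {Q. clean Q}"
    by (rule finite_subset[of _ "Pow {..<N}"]) (auto simp: clean_def)
  moreover have "clean {}" by (simp add: clean_def)
  ultimately obtain Q where Q: "clean Q" and Q_max: "\<And>Q'. clean Q' \<Longrightarrow> Q \<subseteq> Q' \<Longrightarrow> Q = Q'"
    using finite_has_maximal[of "{Q. clean Q}"] by auto
  define T where "T = {..<N} - Q"
  have QN: "Q \<subseteq> {..<N}" using Q by (simp add: clean_def)
  \<comment> \<open>By maximality of \<open>Q\<close>, membership of a row \<open>i \<in> T\<close>
    in \<open>A\<close> matters for some \<open>A\<close> whose other elements all belong to
    \<open>Q\<close>.\<close>
  have "\<exists>S A. S \<subseteq> {..<N} \<and> A \<subseteq> S \<and> A \<subseteq> insert i Q \<and> i \<in> A \<and>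
      ((S, A - {i}) \<in> f \<longleftrightarrow> (S, A) \<notin> f)" if i: "i \<in> T" for i
  proof -
    have "\<not> clean (insert i Q)" using Q_max[of "insert i Q"] i by (auto simp: T_def)
    then obtain S A where SA: "S \<subseteq> {..<N}" "A \<subseteq> S \<inter> insert i Q" "((S, A) \<in> f) \<noteq> ((S, {}) \<in> f)"
      using i QN by (auto simp: clean_def T_def)
    have "A - {i} \<subseteq> S \<inter> Q" using SA(2) by auto
    then have "(S, A - {i}) \<in> f \<longleftrightarrow> (S, {}) \<in> f" using Q SA(1) unfolding clean_def by blast
    moreover from this have "i \<in> A" using SA(3) by (metis Diff_empty Diff_insert0)
    ultimately show ?thesis using SA by (intro exI[of _ S] exI[of _ A]) auto
  qed
  then obtain S A where SA: "\<And>i. i \<in> T \<Longrightarrow> S i \<subseteq> {..<N}" "\<And>i. i \<in> T \<Longrightarrow> A i \<subseteq> S i"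
      "\<And>i. i \<in> T \<Longrightarrow> A i \<subseteq> insert i Q" "\<And>i. i \<in> T \<Longrightarrow> i \<in> A i"
      "\<And>i. i \<in> T \<Longrightarrow> (S i, A i - {i}) \<in> f \<longleftrightarrow> (S i, A i) \<notin> f"
    by metis

  define sz where "sz s = l (s div (m + 1))" for s
  define l\<Theta> where "l\<Theta> = (\<Sum>s<N * (m + 1). sz s)"
  define unpack where "unpack v = (\<lambda>i b. slice sz (i * (m + 1) + b) v)" for v :: "'a list"
  define pack where "pack z = join (N * (m + 1)) (\<lambda>s. z (s div (m + 1)) (s mod (m + 1)))"
    for z :: "nat \<Rightarrow> nat \<Rightarrow> 'a list"
  \<comment> \<open>\<open>\<Theta> i\<close> says that \<open>\<chi> (S i)\<close> has the truth
    value predicted for selected parameters in the rows of \<open>A i\<close>. Comparing with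
    \<open>(S i, A i) \<in> f\<close> treats both truth values at once.\<close>
  define \<Theta> where "\<Theta> i = {v. length v = p + l\<Theta> \<and>
    (\<chi> (S i) (take p v) (unpack (drop p v)) \<longleftrightarrow> (S i, A i) \<in> f)}" for i
  have idx: "s div (m + 1) < N" if "s < N * (m + 1)" for s
    using that by (simp add: less_mult_imp_div_less)
  have pack_length: "length (pack z) = l\<Theta>" if "\<And>i b. i < N \<Longrightarrow> length (z i b) = l i" for z
    unfolding pack_def l\<Theta>_def using that idx by (intro length_join) (auto simp: sz_def)
  have unpack_pack: "unpack (pack z) i b = z i b"
    if "\<And>i b. i < N \<Longrightarrow> length (z i b) = l i" "i < N" "b \<le> m" for z i b
  proof -
    have "i * (m + 1) + b < (i + 1) * (m + 1)" using that by simp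
    also have "\<dots> \<le> N * (m + 1)" using that by (intro mult_le_mono1) simp
    finally have "unpack (pack z) i b = z ((i * (m + 1) + b) div (m + 1)) ((i * (m + 1) + b) mod (m + 1))"
      unfolding unpack_def pack_def using that(1) idx by (intro slice_join) (auto simp: sz_def)
    moreover have "(i * (m + 1) + b) div (m + 1) = i" "(i * (m + 1) + b) mod (m + 1) = b"
      using that(3) by (simp_all add: div_mult_self3 del: mult_Suc_right add_Suc_right add_Suc)
    ultimately show ?thesis by simp
  qed
  have \<Theta>: "definable L M (p + l\<Theta>) (\<Theta> i)" if i: "i \<in> T" for i
  proof -
    have "finite (S i)" by (rule finite_subset[OF SA(1)[OF i]]) simp
    then show ?thesis
      unfolding \<Theta>_def \<chi>_def unpack_def
      by (intro definable_dfn dfn_intros dfn_ex dfn_ball dfn_mem[OF Z] dfn_mem[OF \<Phi>]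
          tuple_term_intros tuple_term_slice) (use SA(1)[OF i] in auto)
  qed

  show thesis
  proof (rule that[of Q T l \<Phi> l\<Theta> \<Theta>])
    show "finite Q" "finite T" using QN finite_subset by (auto simp: T_def)
    have "card (Q \<union> T) = card Q + card T"
      using QN finite_subset[OF QN] by (intro card_Un_disjoint) (auto simp: T_def)
    moreover have "Q \<union> T = {..<N}" using QN by (auto simp: T_def)
    ultimately show "card Q + card T = N" by simp
    show "definable L M (q + p + l i) (\<Phi> i)" if "i \<in> Q" for i using \<Phi> QN that by auto
    show "definable L M (p + l\<Theta>) (\<Theta> i)" if "i \<in> T" for i using \<Theta> that .
    fix k :: nat
    \<comment> \<open>A row in \<open>T\<close> consists of \<open>k + 1\<close> blocks of \<open>m + 1\<close> parameters, one of which is selected; the last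
      block provides unselected parameters. A row in \<open>Q\<close> consists of a selected block, an unselected
      block, \<open>m\<close> segments of \<open>k\<close> active parameters, and padding.\<close>
    define K where "K = k * (m + 1) + 3 * (m + 1) + m * k"
    obtain h where h: "\<And>i. i < N \<Longrightarrow> strict_mono_on {..<K} (h i)"
      and colf: "\<And>g. (\<forall>i\<in>{..<N}. strict_mono_on {..<w} (g i) \<and> g i ` {..<w} \<subseteq> {..<K}) \<Longrightarrow>
        col (\<lambda>i t. h i (g i t)) = f"
      using f[of K] by blast
    define base where "base i b = (if i \<in> T then k * (m + 1) + b else (m + 1) + b)" for i b
    define act where "act t j = 2 * (m + 1) + t * k + j" for t j :: nat
    define d where "d i j = pack (\<lambda>i' b. c i' (h i' (if i' = i then j * (m + 1) + b
      else if i' \<in> A i then b else base i' b)))" for i j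
    define e where "e i t j = c i (h i (act t j))" for i t j
    have main: "\<exists>x. split_witness Q T Z \<Phi> \<Theta> m q p k d e \<zeta> x" if \<zeta>: "\<forall>i\<in>T. \<zeta> i < k" for \<zeta>
    proof -
      \<comment> \<open>The positions of the selected block: rows in \<open>T\<close> follow
        \<open>\<zeta>\<close>, rows in \<open>Q\<close> always select their first block.\<close>
      define sp where "sp i b = (if i \<in> T then \<zeta> i * (m + 1) + b else b)" for i b
      define x where "x = drop q (W (\<lambda>i. if i < N then h i (sp i 0) else 0))"
      have x: "length x = p"
        using definable_length[OF Z W(1)] by (simp add: x_def)
      \<comment> \<open>The truth value of \<open>\<chi>\<close> is read off from \<open>f\<close>
        as soon as the unselected positions \<open>gen\<close> increase and lie to the right of the
        selected block.\<close>
      have eval: "\<chi> S' x (\<lambda>i b. c i (h i (if i \<in> A' then sp i b else gen i b))) \<longleftrightarrow> (S', A') \<in> f"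
        if "S' \<subseteq> {..<N}" "A' \<subseteq> S'"
          and gen: "\<And>i. i < N \<Longrightarrow> sp i m < gen i 0" "\<And>i b. i < N \<Longrightarrow> b < m \<Longrightarrow> gen i b < gen i (Suc b)"
            "\<And>i. i < N \<Longrightarrow> gen i m < K"
        for S' A' gen
      proof -
        define g where "g i t = (if t \<le> m then sp i t else gen i (t - (m + 1)))" for i t
        have "strict_mono_on {..<w} (g i) \<and> g i ` {..<w} \<subseteq> {..<K}" if i: "i < N" for i
        proof
          show "strict_mono_on {..<w} (g i)"
          proof (rule strict_mono_on_lessThanI)
            fix t assume "Suc t < w"
            then consider "Suc t \<le> m" | "t = m" | "m < t" "t - (m + 1) < m" by (force simp: w_def)
            then show "g i t < g i (Suc t)"
            proof cases
              case 3
              then have "Suc t - (m + 1) = Suc (t - (m + 1))" by simp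
              then show ?thesis using 3 gen(2)[OF i, of "t - (m + 1)"] by (simp add: g_def)
            qed (use gen(1)[OF i] in \<open>auto simp: g_def sp_def\<close>)
          qed
          then have "g i t \<le> g i (w - 1)" if "t < w" for t
            using that by (cases "t = w - 1") (auto simp: strict_mono_on_def intro!: less_imp_le)
          moreover have "g i (w - 1) = gen i m" by (simp add: g_def w_def)
          ultimately show "g i ` {..<w} \<subseteq> {..<K}" using gen(3)[OF i] by fastforce
        qed
        then have "col (\<lambda>i t. h i (g i t)) = f" by (intro colf) simp
        then have "(S', A') \<in> f \<longleftrightarrow> \<chi> S' (X (\<lambda>i t. h i (g i t))) (zz A' (\<lambda>i t. h i (g i t)))"
          using that(1,2) by (auto simp: col_def)
        also have "X (\<lambda>i t. h i (g i t)) = x" by (simp add: X_def x_def g_def cong: if_cong)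
        also have "\<chi> S' x (zz A' (\<lambda>i t. h i (g i t))) =
            \<chi> S' x (\<lambda>i b. c i (h i (if i \<in> A' then sp i b else gen i b)))"
          by (intro \<chi>_cong) (auto simp: zz_def g_def)
        finally show ?thesis by simp
      qed
      have dK: "j * (m + 1) + m < K" if "j \<le> k" for j
      proof -
        have "j * (m + 1) \<le> k * (m + 1)" using that by (rule mult_le_mono1)
        then show ?thesis by (simp add: K_def algebra_simps)
      qed
      have sp_less: "sp i m < j * (m + 1)" if "i \<in> T" "\<zeta> i < j" for i j
      proof -
        have "(\<zeta> i + 1) * (m + 1) \<le> j * (m + 1)" using that by (intro mult_le_mono1) simp
        then show ?thesis using that by (simp add: sp_def)
      qed
      have base: "sp i m < base i 0" "base i b < base i (Suc b)" "base i m < K" for i b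
        using sp_less[of i k] \<zeta> dK[of k] by (auto simp: base_def sp_def K_def)
      have \<Theta>_iff: "x @ d i j \<in> \<Theta> i \<longleftrightarrow> (\<chi> (S i) x (\<lambda>i' b. c i' (h i' (if i' = i then j * (m + 1) + b
          else if i' \<in> A i then b else base i' b))) \<longleftrightarrow> (S i, A i) \<in> f)" if "i \<in> T" for i j
      proof -
        define z where "z = (\<lambda>i' b. c i' (h i' (if i' = i then j * (m + 1) + b
          else if i' \<in> A i then b else base i' b)))"
        have zl: "length (z i' b) = l i'" if "i' < N" for i' b using l[OF that] by (simp add: z_def)
        have "\<chi> (S i) x (unpack (pack z)) = \<chi> (S i) x z"
          using SA(1)[OF \<open>i \<in> T\<close>] zl by (intro \<chi>_cong unpack_pack) auto
        moreover have "d i j = pack z" by (simp add: d_def z_def)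
        ultimately show ?thesis
          using x pack_length[of z] zl by (simp add: \<Theta>_def z_def)
      qed
      have T1: "x @ d i (\<zeta> i) \<in> \<Theta> i" if i: "i \<in> T" for i
      proof -
        have "\<chi> (S i) x (\<lambda>i' b. c i' (h i' (if i' = i then \<zeta> i * (m + 1) + b
            else if i' \<in> A i then b else base i' b))) =
          \<chi> (S i) x (\<lambda>i' b. c i' (h i' (if i' \<in> A i then sp i' b else base i' b)))"
          using SA(3)[OF i] SA(4)[OF i] i by (intro \<chi>_cong) (auto simp: sp_def T_def)
        also have "\<dots> \<longleftrightarrow> (S i, A i) \<in> f"
          by (intro eval SA base) (use i in auto)
        finally show ?thesis using \<Theta>_iff[OF i] by simp
      qed
      \<comment> \<open>Block \<open>j\<close> is unselected and lies to the right of the selected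
        one, so the prediction for \<open>A i - {i}\<close> applies. Blocks to the left are not
        controlled, which is why patterns are later obtained from pairs.\<close>
      have T2: "x @ d i j \<notin> \<Theta> i" if i: "i \<in> T" and j: "\<zeta> i < j" "j < k" for i j
      proof -
        define gen where "gen i' b = (if i' = i then j * (m + 1) + b else base i' b)" for i' b
        have "\<chi> (S i) x (\<lambda>i' b. c i' (h i' (if i' = i then j * (m + 1) + b
            else if i' \<in> A i then b else base i' b))) =
          \<chi> (S i) x (\<lambda>i' b. c i' (h i' (if i' \<in> A i - {i} then sp i' b else gen i' b)))"
          using SA(3)[OF i] i by (intro \<chi>_cong) (auto simp: sp_def T_def gen_def)
        also have "\<dots> \<longleftrightarrow> (S i, A i - {i}) \<in> f"
          by (rule eval) (use SA(1,2)[OF i] base sp_less[OF i j(1)] dK[of j] j in \<open>auto simp: gen_def\<close>)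
        finally show ?thesis using \<Theta>_iff[OF i] SA(5)[OF i] by simp
      qed
      have "\<exists>ys. (\<forall>t<m. length (ys t) = q \<and> ys t @ x \<in> Z \<and>
              (\<forall>i\<in>Q. ys t @ x @ e i t (J i t) \<in> \<Phi> i \<and> ys t @ x @ e i t (J' i t) \<notin> \<Phi> i)) \<and>
            (Q \<noteq> {} \<longrightarrow> inj_on ys {..<m})"
        if JJ': "\<forall>i\<in>Q. \<forall>t<m. J i t < J' i t \<and> J' i t < k" for J J'
      proof -
        have act_less: "act t j < act t' j'" if "t < t'" "j < k" for t t' j j'
        proof -
          have "(t + 1) * k \<le> t' * k" using that by (intro mult_le_mono1) simp
          then show ?thesis using that by (simp add: act_def)
        qed
        have act_pad: "act t j < 2 * (m + 1) + m * k + b" if "t < m" "j < k" for t j b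
        proof -
          have "(t + 1) * k \<le> m * k" using that by (intro mult_le_mono1) simp
          then show ?thesis using that by (simp add: act_def)
        qed
        \<comment> \<open>Copy \<open>t\<close> shall satisfy \<open>\<Phi> i\<close> at
          \<open>J i t\<close> and fail it at \<open>J' i t\<close> and at \<open>J i t'\<close> for
          all later copies \<open>t'\<close>. Padding fills the negative conditions left
          over.\<close>
        define gen where "gen t i b = (if i \<in> T then base i b else
            if b = 0 then act t (J i t) else if b = 1 then act t (J' i t)
            else if t + b - 1 < m then act (t + b - 1) (J i (t + b - 1))
            else 2 * (m + 1) + m * k + b)" for t i b
        have "\<chi> Q x (\<lambda>i b. c i (h i (if i \<in> {} then sp i b else gen t i b)))" if t: "t < m" for t
        proof (subst eval)
          \<comment> \<open>This follows from \<open>(Q, Q) \<in> f\<close>, as rows in a clean set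
            do not matter. Unselected parameters therefore realize the rows of \<open>Q\<close> in
            the fibre over \<open>x\<close>.\<close>
          show "(Q, {}) \<in> f"
            using f_full[OF QN] Q QN unfolding clean_def by blast
          fix i assume i: "i < N"
          have J: "J i t' < J' i t'" "J' i t' < k" "J i t' < k" if "i \<notin> T" "t' < m" for t'
            using JJ' that i by (force simp: T_def)+
          show "sp i m < gen t i 0"
            using base(1)[of i] by (auto simp: gen_def sp_def act_def)
          show "gen t i b < gen t i (Suc b)" if "b < m" for b
          proof (cases "i \<in> T")
            case True
            then show ?thesis using base(2)[of i b] by (simp add: gen_def)
          next
            case False
            consider "b = 0" | "b = 1" | "b > 1" by linarith
            then show ?thesis
            proof cases
              case 1
              then show ?thesis using False J[OF False t] by (simp add: gen_def act_def)
            next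
              case 2
              then show ?thesis
                using False J[OF False t] t act_less[of t "t + 1" "J' i t" "J i (t + 1)"] act_pad[of t "J' i t" 2]
                by (auto simp: gen_def)
            next
              case 3
              then show ?thesis
                using False J(3)[OF False, of "t + b - 1"] act_pad[of "t + b - 1" "J i (t + b - 1)" "Suc b"]
                  act_less[of "t + b - 1" "t + b" "J i (t + b - 1)" "J i (t + b)"]
                by (auto simp: gen_def)
            qed
          qed
          show "gen t i m < K"
          proof (cases "i \<in> T \<or> t + m - 1 \<ge> m")
            case True
            then show ?thesis using base(3)[of i] m t
              act_pad[of t "J' i t" 0] J[OF _ t] by (auto simp: gen_def K_def)
          next
            case False
            then have "t = 0" "i \<notin> T" using m by auto
            then have "gen t i m = act (m - 1) (if m = 1 then J' i 0 else J i (m - 1))"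
              using m by (auto simp: gen_def)
            also have "\<dots> < 2 * (m + 1) + m * k + 0"
              using m J[of "m - 1"] J[of 0] \<open>i \<notin> T\<close> by (intro act_pad) auto
            also have "\<dots> < K" by (simp add: K_def)
            finally show ?thesis .
          qed
        qed (use QN in auto)
        then have "\<exists>y. length y = q \<and> y @ x \<in> Z \<and> (\<forall>i\<in>Q. y @ x @ c i (h i (gen t i 0)) \<in> \<Phi> i \<and>
            (\<forall>b\<in>{1..m}. y @ x @ c i (h i (gen t i b)) \<notin> \<Phi> i))" if "t < m" for t
          using that unfolding \<chi>_def by simp
        then obtain ys where ys: "\<And>t. t < m \<Longrightarrow> length (ys t) = q \<and> ys t @ x \<in> Z"
            "\<And>t i. t < m \<Longrightarrow> i \<in> Q \<Longrightarrow> ys t @ x @ c i (h i (gen t i 0)) \<in> \<Phi> i"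
            "\<And>t i b. t < m \<Longrightarrow> i \<in> Q \<Longrightarrow> b \<in> {1..m} \<Longrightarrow> ys t @ x @ c i (h i (gen t i b)) \<notin> \<Phi> i"
          by metis
        have yJ: "ys t @ x @ e i t (J i t) \<in> \<Phi> i" if "t < m" "i \<in> Q" for t i
          using ys(2)[OF that] that by (simp add: gen_def e_def T_def)
        have yJ': "ys t @ x @ e i t (J' i t) \<notin> \<Phi> i" if "t < m" "i \<in> Q" for t i
          using ys(3)[OF that, of 1] that m by (simp add: gen_def e_def T_def)
        have "inj_on ys {..<m}" if Qne: "Q \<noteq> {}"
        proof (rule linorder_inj_onI)
          obtain i where i: "i \<in> Q" using Qne by blast
          fix t t' assume t: "t < t'" "t \<in> {..<m}" "t' \<in> {..<m}"
          have "ys t @ x @ e i t' (J i t') \<notin> \<Phi> i"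
            using ys(3)[of t i "t' - t + 1"] i t by (simp add: gen_def e_def T_def)
          then show "ys t \<noteq> ys t'" using yJ[of t' i] i t by auto
        qed auto
        then show ?thesis using ys(1) yJ yJ' by blast
      qed
      then have "split_witness Q T Z \<Phi> \<Theta> m q p k d e \<zeta> x"
        unfolding split_witness_def using x T1 T2 by blast
      then show ?thesis by blast
    qed
    have dl: "length (d i j) = l\<Theta>" for i j
      unfolding d_def using l by (intro pack_length) simp
    have el: "length (e i t j) = l i" if "i \<in> Q" for i t j
      using l QN that by (auto simp: e_def)
    show "\<exists>d e. (\<forall>i\<in>T. \<forall>j<k. length (d i j) = l\<Theta>) \<and>
      (\<forall>i\<in>Q. \<forall>t<m. \<forall>j<k. length (e i t j) = l i) \<and>
      (\<forall>\<zeta>. (\<forall>i\<in>T. \<zeta> i < k) \<longrightarrow> (\<exists>x. split_witness Q T Z \<Phi> \<Theta> m q p k d e \<zeta> x))"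
      by (intro exI[of _ d] exI[of _ e] conjI ballI impI allI dl el main) blast+
  qed
qed

end

definition piece :: "nat \<Rightarrow> nat \<Rightarrow> nat \<Rightarrow> 'a list \<Rightarrow> 'a list" where
  "piece p q t v = take q (drop (p + t * q) v)"

text \<open>The elements of \<open>dup m p q Z\<close> are the tuples \<open>x @ y\<^sub>0 @ \<dots> @ y\<^bsub>m-1\<^esub>\<close> with distinct \<open>y\<^sub>t\<close> such that
  \<open>y\<^sub>t @ x \<in> Z\<close> for all \<open>t\<close>, where \<open>length x = p\<close> and \<open>length y\<^sub>t = q\<close>.\<close>

definition dup :: "nat \<Rightarrow> nat \<Rightarrow> nat \<Rightarrow> 'a list set \<Rightarrow> 'a list set" where
  "dup m p q Z = {v. length v = p + m * q \<and> ((\<forall>t\<in>{..<m}. piece p q t v @ take p v \<in> Z) \<and>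
     (\<forall>t\<in>{..<m}. \<forall>t'\<in>{..<t}. piece p q t v \<noteq> piece p q t' v))}"

lemma tuple_term_piece: "tuple_term len T \<Longrightarrow> tuple_term len (\<lambda>E. piece p q t (T E))"
  unfolding piece_def by (intro tuple_term_take tuple_term_drop)

lemma definable_dup: "definable L M (q + p) Z \<Longrightarrow> definable L M (p + m * q) (dup m p q Z)"
  unfolding dup_def
  by (intro definable_dfn dfn_intros dfn_ball dfn_mem[where k = "q + p"] tuple_term_intros tuple_term_piece)
     auto

lemma length_join_const: "(\<And>t. t < m \<Longrightarrow> length (ys t) = q) \<Longrightarrow> length (join m ys) = m * q"
  using length_join[of m ys "\<lambda>_. q"] by simp

lemma piece_join:
  assumes "length x = p" "\<And>t. t < m \<Longrightarrow> length (ys t) = q" "t < m"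
  shows "piece p q t (x @ join m ys @ w) = ys t"
proof -
  have "slice (\<lambda>_. q) t (join m ys @ w) = ys t"
    by (rule slice_join_append) (use assms in auto)
  then show ?thesis using assms(1) by (simp add: slice_def piece_def)
qed

context saturated_structure
begin

text \<open>The rows in \<open>Q\<close> form a pattern in one fibre, hence in \<open>V\<close>, and
  those in \<open>T\<close> a pattern in \<open>U\<close>; this is subadditivity. Since the
  \<open>m\<close> fibre elements realize their own copies of the rows in \<open>Q\<close>
  independently of each other, each row in \<open>Q\<close> counts \<open>m\<close> times in
  \<open>dup\<close>.\<close>

lemma dp_rank_split:
  assumes Z: "definable L M (q + p) Z" and N: "has_ict_pattern L M (q + p) Z N" and m: "m \<ge> 1"
    and U: "definable L M p U" and V: "definable L M q V"
    and ZUV: "\<And>z. z \<in> Z \<Longrightarrow> take q z \<in> V \<and> drop q z \<in> U"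
  obtains s t where "s + t = N" "has_ict_pattern L M q V s" "has_ict_pattern L M p U t"
    "s \<noteq> 0 \<Longrightarrow> has_ict_pattern L M (p + m * q) (dup m p q Z) (t + m * s)"
proof -
  obtain Q T :: "nat set" and \<Phi> \<Theta> l l\<Theta> where fin: "finite Q" "finite T" "card Q + card T = N"
    and \<Phi>: "\<And>i. i \<in> Q \<Longrightarrow> definable L M (q + p + l i) (\<Phi> i)"
    and \<Theta>: "\<And>i. i \<in> T \<Longrightarrow> definable L M (p + l\<Theta>) (\<Theta> i)"
    and grid: "\<And>k :: nat. \<exists>d e. (\<forall>i\<in>T. \<forall>j<k. length (d i j) = l\<Theta>) \<and>
      (\<forall>i\<in>Q. \<forall>t<m. \<forall>j<k. length (e i t j) = l i) \<and>
      (\<forall>\<zeta>. (\<forall>i\<in>T. \<zeta> i < k) \<longrightarrow> (\<exists>x. split_witness Q T Z \<Phi> \<Theta> m q p k d e \<zeta> x))"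
  proof (rule pattern_split[OF Z N m], goal_cases)
    case (1 Q T \<Phi> \<Theta> l l\<Theta>)
    show ?case by (rule 1(1)[OF 1(2-)])
  qed
  have VU: "y \<in> V" "x \<in> U" if "y @ x \<in> Z" "length y = q" for x y
    using ZUV[OF that(1)] that(2) by auto
  have good_len: "length x = p" if "split_witness Q T Z \<Phi> \<Theta> m q p k d e \<zeta> x" for k d e x \<zeta>
    using that by (simp add: split_witness_def)
  have good_T: "x @ d i (\<zeta> i) \<in> \<Theta> i" "j < k \<Longrightarrow> \<zeta> i < j \<Longrightarrow> x @ d i j \<notin> \<Theta> i"
    if "split_witness Q T Z \<Phi> \<Theta> m q p k d e \<zeta> x" "i \<in> T" for k d e x \<zeta> i j
    using that by (auto simp: split_witness_def)
  have good_Q: "\<exists>ys. (\<forall>t<m. length (ys t) = q \<and> ys t @ x \<in> Z \<and>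
              (\<forall>i\<in>Q. ys t @ x @ e i t (J i t) \<in> \<Phi> i \<and> ys t @ x @ e i t (J' i t) \<notin> \<Phi> i)) \<and>
            (Q \<noteq> {} \<longrightarrow> inj_on ys {..<m})"
    if "split_witness Q T Z \<Phi> \<Theta> m q p k d e \<zeta> x" "\<And>i t. i \<in> Q \<Longrightarrow> t < m \<Longrightarrow> J i t < J' i t \<and> J' i t < k" for k d e x \<zeta> J J'
    using that unfolding split_witness_def by blast
  show thesis
  proof (rule that[of "card Q" "card T"])
    show "card Q + card T = N" by (rule fin)
    show "has_ict_pattern L M q V (card Q)"
    proof (rule has_ict_pattern_of_pairs[OF fin(1) V])
      show "definable L M (q + (p + l i)) (\<Phi> i)" if "i \<in> Q" for i
        using \<Phi>[OF that] by (simp add: add.assoc)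
      fix k :: nat
      \<comment> \<open>Size \<open>k + 2\<close> leaves room, even for small \<open>k\<close>, for
        the constant path 0 here and for the dummy pair \<open>0 < 1\<close> in the next
        case.\<close>
      obtain d e where el: "\<forall>i\<in>Q. \<forall>t<m. \<forall>j<k + 2. length (e i t j) = l i"
        and g: "\<forall>\<zeta>. (\<forall>i\<in>T. \<zeta> i < k + 2) \<longrightarrow> (\<exists>x. split_witness Q T Z \<Phi> \<Theta> m q p (k + 2) d e \<zeta> x)"
        using grid[of "k + 2"] by blast
      obtain x where x: "split_witness Q T Z \<Phi> \<Theta> m q p (k + 2) d e (\<lambda>_. 0) x"
        using g[rule_format, of "\<lambda>_. 0"] by auto
      have "\<exists>a\<in>V. \<forall>i\<in>Q. a @ x @ e i 0 (\<zeta> i) \<in> \<Phi> i \<and> a @ x @ e i 0 (\<zeta>' i) \<notin> \<Phi> i"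
        if \<zeta>: "\<forall>i\<in>Q. \<zeta> i < \<zeta>' i \<and> \<zeta>' i < k" for \<zeta> \<zeta>'
      proof -
        have "(\<zeta> i) < (\<zeta>' i) \<and> (\<zeta>' i) < k + 2" if "i \<in> Q" for i using \<zeta> that by fastforce
        then obtain ys where "\<forall>t<m. length (ys t) = q \<and> ys t @ x \<in> Z \<and>
              (\<forall>i\<in>Q. ys t @ x @ e i t (\<zeta> i) \<in> \<Phi> i \<and> ys t @ x @ e i t (\<zeta>' i) \<notin> \<Phi> i)"
          using good_Q[OF x, of "\<lambda>i _. \<zeta> i" "\<lambda>i _. \<zeta>' i"] by blast
        then show ?thesis using m VU(1) by (intro bexI[of _ "ys 0"]) auto
      qed
      moreover have "length (x @ e i 0 j) = p + l i" if "i \<in> Q" "j < k" for i j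
        using el m that good_len[OF x] by simp
      ultimately show "\<exists>c. (\<forall>i\<in>Q. \<forall>j<k. length (c i j) = p + l i) \<and>
        (\<forall>\<zeta> \<zeta>'. (\<forall>i\<in>Q. \<zeta> i < \<zeta>' i \<and> \<zeta>' i < k) \<longrightarrow>
          (\<exists>a\<in>V. \<forall>i\<in>Q. a @ c i (\<zeta> i) \<in> \<Phi> i \<and> a @ c i (\<zeta>' i) \<notin> \<Phi> i))"
        by (intro exI[of _ "\<lambda>i j. x @ e i 0 j"]) simp
    qed
    show "has_ict_pattern L M p U (card T)"
    proof (rule has_ict_pattern_of_pairs[OF fin(2) U \<Theta>], assumption)
      fix k :: nat
      obtain d e where dl: "\<forall>i\<in>T. \<forall>j<k + 2. length (d i j) = l\<Theta>"
        and g: "\<forall>\<zeta>. (\<forall>i\<in>T. \<zeta> i < k + 2) \<longrightarrow> (\<exists>x. split_witness Q T Z \<Phi> \<Theta> m q p (k + 2) d e \<zeta> x)"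
        using grid[of "k + 2"] by blast
      have "\<exists>a\<in>U. \<forall>i\<in>T. a @ d i (\<zeta> i) \<in> \<Theta> i \<and> a @ d i (\<zeta>' i) \<notin> \<Theta> i"
        if \<zeta>: "\<forall>i\<in>T. \<zeta> i < \<zeta>' i \<and> \<zeta>' i < k" for \<zeta> \<zeta>'
      proof -
        have \<zeta>2: "\<zeta> i < k + 2" "\<zeta>' i < k + 2" "\<zeta> i < \<zeta>' i" if "i \<in> T" for i using \<zeta> that by fastforce+
        then obtain x where x: "split_witness Q T Z \<Phi> \<Theta> m q p (k + 2) d e \<zeta> x" using g by blast
        obtain ys where "\<forall>t<m. length (ys t) = q \<and> ys t @ x \<in> Z"
          using good_Q[OF x, of "\<lambda>_ _. 0" "\<lambda>_ _. 1"] by auto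
        then have "x \<in> U" using m VU(2)[of "ys 0" x] by auto
        then show ?thesis
          using good_T[OF x] \<zeta>2 by (intro bexI[of _ x]) auto
      qed
      then show "\<exists>c. (\<forall>i\<in>T. \<forall>j<k. length (c i j) = l\<Theta>) \<and>
        (\<forall>\<zeta> \<zeta>'. (\<forall>i\<in>T. \<zeta> i < \<zeta>' i \<and> \<zeta>' i < k) \<longrightarrow>
          (\<exists>a\<in>U. \<forall>i\<in>T. a @ c i (\<zeta> i) \<in> \<Theta> i \<and> a @ c i (\<zeta>' i) \<notin> \<Theta> i))"
        using dl by (intro exI[of _ d]) simp
    qed
    assume "card Q \<noteq> 0"
    \<comment> \<open>A row in \<open>Q\<close> is what makes the elements \<open>ys t\<close>
      distinct, as \<open>dup\<close> demands.\<close>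
    then have Qne: "Q \<noteq> {}" by auto
    define I where "I = T <+> Q \<times> {..<m}"
    define \<Psi> where "\<Psi> = case_sum
      (\<lambda>i. {v. length v = p + m * q + l\<Theta> \<and> take p v @ drop (p + m * q) v \<in> \<Theta> i})
      (\<lambda>(i, t). {v. length v = p + m * q + l i \<and>
        piece p q t v @ take p v @ drop (p + m * q) v \<in> \<Phi> i})"
    define l' where "l' = case_sum (\<lambda>i::nat. l\<Theta>) (\<lambda>(i, t::nat). l i)"
    have "has_ict_pattern L M (p + m * q) (dup m p q Z) (card I)"
    proof (rule has_ict_pattern_of_pairs[OF _ definable_dup[OF Z]])
      show "finite I" using fin by (simp add: I_def)
      show "definable L M (p + m * q + l' i) (\<Psi> i)" if "i \<in> I" for i
        using that \<Phi> \<Theta> unfolding \<Psi>_def l'_def I_def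
        by (auto intro!: definable_dfn dfn_intros dfn_mem tuple_term_intros tuple_term_piece
            split: sum.splits prod.splits)
      fix k :: nat
      obtain d e where dl: "\<forall>i\<in>T. \<forall>j<k + 2. length (d i j) = l\<Theta>"
        and el: "\<forall>i\<in>Q. \<forall>t<m. \<forall>j<k + 2. length (e i t j) = l i"
        and g: "\<forall>\<zeta>. (\<forall>i\<in>T. \<zeta> i < k + 2) \<longrightarrow> (\<exists>x. split_witness Q T Z \<Phi> \<Theta> m q p (k + 2) d e \<zeta> x)"
        using grid[of "k + 2"] by blast
      define c where "c = case_sum d (\<lambda>(i, t). e i t)"
      have "\<exists>a\<in>dup m p q Z. \<forall>i\<in>I. a @ c i (\<zeta> i) \<in> \<Psi> i \<and> a @ c i (\<zeta>' i) \<notin> \<Psi> i"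
        if \<zeta>: "\<forall>i\<in>I. \<zeta> i < \<zeta>' i \<and> \<zeta>' i < k" for \<zeta> \<zeta>'
      proof -
        have \<zeta>T: "\<zeta> (Inl i) < k + 2" "\<zeta>' (Inl i) < k + 2" "\<zeta> (Inl i) < \<zeta>' (Inl i)" if "i \<in> T" for i
          using bspec[OF \<zeta>, of "Inl i"] InlI[OF that, of "Q \<times> {..<m}"] by (simp_all add: I_def)
        have \<zeta>Q: "\<zeta> (Inr (i, t)) < \<zeta>' (Inr (i, t)) \<and> \<zeta>' (Inr (i, t)) < k + 2"
            "\<zeta> (Inr (i, t)) < k + 2" if "i \<in> Q" "t < m" for i t
          using bspec[OF \<zeta>, of "Inr (i, t)"] InrI[of "(i, t)" "Q \<times> {..<m}" T] that
          by (simp_all add: I_def)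
        obtain x where x: "split_witness Q T Z \<Phi> \<Theta> m q p (k + 2) d e (\<lambda>i. \<zeta> (Inl i)) x"
          using g[rule_format, of "\<lambda>i. \<zeta> (Inl i)"] \<zeta>T by auto
        obtain ys where ys: "\<And>t. t < m \<Longrightarrow> length (ys t) = q" "\<And>t. t < m \<Longrightarrow> ys t @ x \<in> Z"
            "inj_on ys {..<m}"
            "\<And>t i. t < m \<Longrightarrow> i \<in> Q \<Longrightarrow> ys t @ x @ e i t (\<zeta> (Inr (i, t))) \<in> \<Phi> i"
            "\<And>t i. t < m \<Longrightarrow> i \<in> Q \<Longrightarrow> ys t @ x @ e i t (\<zeta>' (Inr (i, t))) \<notin> \<Phi> i"
          using good_Q[OF x, of "\<lambda>i t. \<zeta> (Inr (i, t))" "\<lambda>i t. \<zeta>' (Inr (i, t))"] \<zeta>Q(1) Qne by blast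
        define a where "a = x @ join m ys"
        have xl: "length x = p" by (rule good_len[OF x])
        have jl: "length (join m ys) = m * q" using ys(1) by (rule length_join_const)
        have pc: "piece p q t (a @ w) = ys t" if "t < m" for t w
          unfolding a_def append_assoc by (rule piece_join) (use xl ys(1) that in auto)
        then have pc0: "piece p q t a = ys t" if "t < m" for t
          using that pc[of t "[]"] by simp
        have "a \<in> dup m p q Z"
          using xl jl pc0 ys(2) inj_onD[OF ys(3)] by (fastforce simp: dup_def a_def)
        moreover have "a @ c i (\<zeta> i) \<in> \<Psi> i \<and> a @ c i (\<zeta>' i) \<notin> \<Psi> i" if iI: "i \<in> I" for i
        proof -
          consider i' where "i = Inl i'" "i' \<in> T" | i' t where "i = Inr (i', t)" "i' \<in> Q" "t < m"
            using iI by (auto simp: I_def)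
          then show ?thesis
          proof cases
            case 1
            then have "x @ d i' (\<zeta> i) \<in> \<Theta> i'" "x @ d i' (\<zeta>' i) \<notin> \<Theta> i'"
              using good_T(1)[OF x 1(2)] good_T(2)[OF x 1(2)] \<zeta>T[of i'] by auto
            then show ?thesis
              using 1 xl jl dl \<zeta>T[OF 1(2)] by (simp add: \<Psi>_def c_def a_def)
          next
            case 2
            then have "length (e i' t (\<zeta> i)) = l i'" "length (e i' t (\<zeta>' i)) = l i'"
              using el \<zeta>Q by auto
            then show ?thesis
              using 2 xl jl pc[OF 2(3)] ys(4,5)[OF 2(3,2)] by (simp add: \<Psi>_def c_def) (simp add: a_def)
          qed
        qed
        ultimately show ?thesis by blast
      qed
      moreover have "length (c i j) = l' i" if "i \<in> I" "j < k" for i j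
        using that dl el by (auto simp: I_def c_def l'_def)
      ultimately show "\<exists>c. (\<forall>i\<in>I. \<forall>j<k. length (c i j) = l' i) \<and>
        (\<forall>\<zeta> \<zeta>'. (\<forall>i\<in>I. \<zeta> i < \<zeta>' i \<and> \<zeta>' i < k) \<longrightarrow>
          (\<exists>a\<in>dup m p q Z. \<forall>i\<in>I. a @ c i (\<zeta> i) \<in> \<Psi> i \<and> a @ c i (\<zeta>' i) \<notin> \<Psi> i))"
        by blast
    qed
    moreover have "card I = card T + m * card Q"
      using fin by (simp add: I_def card_Plus card_cartesian_product mult.commute)
    ultimately show "has_ict_pattern L M (p + m * q) (dup m p q Z) (card T + m * card Q)" by simp
  qed
qed

end

section \<open>From full rank to broadness\<close>

primrec products :: "'a list set list \<Rightarrow> 'a list set" where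
  "products [] = {[]}"
| "products (D # Ds) = {y @ x | y x. y \<in> D \<and> x \<in> products Ds}"

lemma products_append: "products (Ds @ Es) = {y @ x | y x. y \<in> products Ds \<and> x \<in> products Es}"
proof (induction Ds)
  case (Cons D Ds)
  then show ?case by (auto simp del: append_assoc) (metis append_assoc, metis append_assoc)
qed simp

lemma concat_in_products: "list_all2 (\<in>) ys Ds \<Longrightarrow> concat ys \<in> products Ds"
  by (induction ys Ds rule: list_all2_induct) auto

lemma join_Suc_shift: "join (Suc n) x = x 0 @ join n (\<lambda>i. x (Suc i))"
  unfolding join_def by (simp add: upt_conv_Cons map_Suc_upt[symmetric] o_def del: upt_Suc)

text \<open>A factor is a triple of the dimension of the ambient power, a set, and a bound for its
  dp-rank.\<close>

type_synonym 'a factor = "nat \<times> 'a list set \<times> nat"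

abbreviation factor_set :: "'a factor list \<Rightarrow> 'a list set" where
  "factor_set Ts \<equiv> products (map (\<lambda>T. fst (snd T)) Ts)"

abbreviation factor_dim :: "'a factor list \<Rightarrow> nat" where
  "factor_dim Ts \<equiv> sum_list (map fst Ts)"

abbreviation factor_rank :: "'a factor list \<Rightarrow> nat" where
  "factor_rank Ts \<equiv> sum_list (map (\<lambda>T. snd (snd T)) Ts)"

context saturated_structure
begin

definition bounded :: "'a factor \<Rightarrow> bool" where
  "bounded T \<longleftrightarrow> (case T of (q, D, r) \<Rightarrow>
    definable L M q D \<and> (\<forall>m. has_ict_pattern L M q D m \<longrightarrow> m \<le> r))"

lemma products_Cons_split:
  assumes "definable L M q D" "z \<in> products (D # Ds)"
  shows "take q z \<in> D \<and> drop q z \<in> products Ds"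
  using assms(2) definable_length[OF assms(1)] by auto

lemma definable_factor_set:
  "\<forall>T\<in>set Ts. bounded T \<Longrightarrow> definable L M (factor_dim Ts) (factor_set Ts)"
proof (induction Ts)
  case Nil
  have "definable L M 0 {a. length a = 0 \<and> True}"
    by (rule definable_dfn) (rule dfn_const)
  moreover have "{a :: 'a list. length a = 0 \<and> True} = {[]}" by auto
  ultimately show ?case by simp
next
  case (Cons T Ts)
  obtain q D r where T: "T = (q, D, r)" by (cases T)
  have D: "definable L M q D" using Cons.prems by (simp add: T bounded_def)
  have P: "definable L M (factor_dim Ts) (factor_set Ts)" using Cons by simp
  have "definable L M (q + factor_dim Ts)
      {v. length v = q + factor_dim Ts \<and> (take q v \<in> D \<and> drop q v \<in> factor_set Ts)}"
    by (intro definable_dfn dfn_intros dfn_mem[OF D] dfn_mem[OF P] tuple_term_intros)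
  moreover have "{v. length v = q + factor_dim Ts \<and> (take q v \<in> D \<and> drop q v \<in> factor_set Ts)} =
      factor_set (T # Ts)"
    using definable_length[OF D] definable_length[OF P]
    by (auto simp: T) (metis append_take_drop_id)
  ultimately show ?case by (simp add: T)
qed

text \<open>Subadditivity, one factor at a time. The empty product is a single point, which cannot
  follow two different paths.\<close>

lemma bounded_factor_set:
  "\<forall>T\<in>set Ts. bounded T \<Longrightarrow> has_ict_pattern L M (factor_dim Ts) (factor_set Ts) m \<Longrightarrow>
    m \<le> factor_rank Ts"
proof (induction Ts arbitrary: m)
  case Nil
  then obtain \<phi> b where \<phi>: "\<And>\<eta>. \<forall>i<m. \<forall>j::nat. holds M (\<phi> i) (b i j) \<longleftrightarrow> j = \<eta> i"
    unfolding has_ict_pattern_def by auto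
  have "m = 0"
  proof (rule ccontr)
    assume "m \<noteq> 0"
    then show False using \<phi>[of "\<lambda>_. 0"] \<phi>[of "\<lambda>_. 1"] by auto
  qed
  then show ?case by simp
next
  case (Cons T Ts)
  obtain q D r where T: "T = (q, D, r)" by (cases T)
  have D: "definable L M q D" "\<And>m. has_ict_pattern L M q D m \<Longrightarrow> m \<le> r"
    using Cons.prems by (auto simp: T bounded_def)
  have Z: "definable L M (q + factor_dim Ts) (factor_set (T # Ts))"
    using definable_factor_set[OF Cons.prems(1)] by (simp add: T)
  have P: "definable L M (factor_dim Ts) (factor_set Ts)"
    using definable_factor_set[of Ts] Cons.prems(1) by simp
  obtain s t where st: "s + t = m" "has_ict_pattern L M q D s"
      "has_ict_pattern L M (factor_dim Ts) (factor_set Ts) t"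
  proof (rule dp_rank_split[OF Z _ order_refl P D(1)])
    show "has_ict_pattern L M (q + factor_dim Ts) (factor_set (T # Ts)) m"
      using Cons.prems(2) by (simp add: T)
    show "take q z \<in> D \<and> drop q z \<in> factor_set Ts" if "z \<in> factor_set (T # Ts)" for z
      using products_Cons_split[OF D(1)] that by (simp add: T)
  qed (rule that)
  have "t \<le> factor_rank Ts" using Cons.IH[OF _ st(3)] Cons.prems(1) by simp
  then show ?case using D(2)[OF st(2)] st(1) by (simp add: T)
qed

lemma bounded_subset:
  assumes "\<forall>T\<in>set Ts. bounded T" "Z \<subseteq> factor_set Ts" "has_ict_pattern L M (factor_dim Ts) Z m"
  shows "m \<le> factor_rank Ts"
proof -
  have "has_ict_pattern L M (factor_dim Ts) (factor_set Ts) m"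
    by (rule has_ict_pattern_mono[OF assms(3,2) order_refl])
  then show ?thesis using bounded_factor_set[OF assms(1)] by blast
qed

text \<open>Replacing the first factor by \<open>m\<close> copies at the end preserves the property of having full
  rank, so after all factors have been replaced the resulting set is nonempty.\<close>

lemma full_rank_grid:
  fixes m :: nat
  assumes "m \<ge> 1"
    "\<forall>T\<in>set (Ts @ Ss). bounded T" "\<forall>(q, D, r)\<in>set Ts. r \<ge> 1"
    "definable L M (factor_dim (Ts @ Ss)) Z" "Z \<subseteq> factor_set (Ts @ Ss)"
    "has_ict_pattern L M (factor_dim (Ts @ Ss)) Z (factor_rank (Ts @ Ss))"
  shows "\<exists>g w. (\<forall>i<length Ts. inj_on (g i) {..<m} \<and> (\<forall>t<m. length (g i t) = fst (Ts ! i))) \<and>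
    (\<forall>\<tau>. (\<forall>i<length Ts. \<tau> i < m) \<longrightarrow> join (length Ts) (\<lambda>i. g i (\<tau> i)) @ w \<in> Z)"
  using assms(2-)
proof (induction Ts arbitrary: Ss Z)
  case Nil
  then obtain w where "w \<in> Z" unfolding has_ict_pattern_def by blast
  then show ?case by (auto simp: join_def)
next
  case (Cons T Ts)
  obtain q D r where T: "T = (q, D, r)" by (cases T)
  define p where "p = factor_dim (Ts @ Ss)"
  have D: "definable L M q D" "\<And>m. has_ict_pattern L M q D m \<Longrightarrow> m \<le> r" "r \<ge> 1"
    using Cons.prems(1,2) by (auto simp: T bounded_def)
  have bnd: "\<forall>T\<in>set (Ts @ Ss). bounded T" using Cons.prems(1) by simp
  have P: "definable L M p (factor_set (Ts @ Ss))"
    using definable_factor_set[OF bnd] by (simp add: p_def)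
  have Z: "definable L M (q + p) Z" using Cons.prems(3) by (simp add: T p_def)
  have Zs: "take q z \<in> D \<and> drop q z \<in> factor_set (Ts @ Ss)" if "z \<in> Z" for z
    using Cons.prems(4) products_Cons_split[OF D(1), of z] that by (auto simp: T)
  have rk: "has_ict_pattern L M (q + p) Z (r + factor_rank (Ts @ Ss))"
    using Cons.prems(5) by (simp add: T p_def)
  obtain s t where st: "s + t = r + factor_rank (Ts @ Ss)" "has_ict_pattern L M q D s"
      "has_ict_pattern L M p (factor_set (Ts @ Ss)) t"
      "s \<noteq> 0 \<Longrightarrow> has_ict_pattern L M (p + m * q) (dup m p q Z) (t + m * s)"
  proof (rule dp_rank_split[OF Z rk assms(1) P D(1) Zs], assumption, goal_cases)
    case (1 s t)
    show ?case by (rule 1(1)[OF 1(2-)])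
  qed
  have "t \<le> factor_rank (Ts @ Ss)"
    using bounded_factor_set[OF bnd, of t] st(3) by (simp add: p_def)
  \<comment> \<open>Both summands are bounded by the respective ranks and their sum is maximal, so
    both bounds are attained.\<close>
  then have "s = r" "t = factor_rank (Ts @ Ss)"
    using st(1) D(2)[OF st(2)] by auto
  then have dup: "has_ict_pattern L M (p + m * q) (dup m p q Z) (factor_rank (Ts @ Ss) + m * r)"
    using st(4) D(3) by simp
  \<comment> \<open>The copies come last in the tuples of \<open>dup\<close>. Appending them to
    \<open>Ss\<close> leaves only the original factors in \<open>Ts\<close> to be replaced.\<close>
  define Ss' where "Ss' = Ss @ replicate m T"
  have dim: "factor_dim (Ts @ Ss') = p + m * q"
    by (simp add: Ss'_def p_def T sum_list_replicate)
  have rank: "factor_rank (Ts @ Ss') = factor_rank (Ts @ Ss) + m * r"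
    by (simp add: Ss'_def T sum_list_replicate)
  have "dup m p q Z \<subseteq> factor_set (Ts @ Ss')"
  proof
    fix v assume v: "v \<in> dup m p q Z"
    then have pv: "piece p q t v @ take p v \<in> Z" if "t < m" for t
      using that by (auto simp: dup_def)
    have vl: "length v = p + m * q" using v by (simp add: dup_def)
    have pl: "length (piece p q t v) = q" if "t < m" for t
    proof -
      have "(t + 1) * q \<le> m * q" using that by (intro mult_le_mono1) simp
      then show ?thesis using vl by (simp add: piece_def)
    qed
    have "piece p q t v \<in> D" "take p v \<in> factor_set (Ts @ Ss)" if "t < m" for t
      using Zs[OF pv[OF that]] pl[OF that] by auto
    moreover have "concat (map (\<lambda>t. piece p q t v) [0..<m]) = drop p v"
    proof -
      have "concat (map (\<lambda>t. piece p q t v) [0..<n]) = take (n * q) (drop p v)" for n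
      proof (induction n)
        case (Suc n)
        have "take (Suc n * q) (drop p v) = take (n * q) (drop p v) @ piece p q n v"
          using take_add[of "n * q" q "drop p v"] by (simp add: piece_def add.commute)
        then show ?case using Suc.IH by simp
      qed simp
      from this[of m] show ?thesis using vl by simp
    qed
    moreover have "list_all2 (\<in>) (map (\<lambda>t. piece p q t v) [0..<m]) (replicate m D)"
      using calculation(1) by (simp add: list_all2_conv_all_nth)
    ultimately have "take p v \<in> factor_set (Ts @ Ss)" "drop p v \<in> products (replicate m D)"
      using assms(1) concat_in_products[of "map (\<lambda>t. piece p q t v) [0..<m]" "replicate m D"]
      by auto
    then have "take p v @ drop p v \<in> products (map (\<lambda>T. fst (snd T)) (Ts @ Ss) @ replicate m D)"
      unfolding products_append[of "map _ (Ts @ Ss)"] by blast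
    then show "v \<in> factor_set (Ts @ Ss')" by (simp add: Ss'_def T)
  qed
  moreover have "definable L M (factor_dim (Ts @ Ss')) (dup m p q Z)"
    unfolding dim by (rule definable_dup[OF Z])
  moreover have "\<forall>T\<in>set (Ts @ Ss'). bounded T"
    using Cons.prems(1) by (auto simp: Ss'_def)
  moreover have "\<forall>(q, D, r)\<in>set Ts. r \<ge> 1" using Cons.prems(2) by simp
  moreover have "has_ict_pattern L M (factor_dim (Ts @ Ss')) (dup m p q Z) (factor_rank (Ts @ Ss'))"
    unfolding dim rank by (rule dup)
  ultimately obtain g w where g: "\<And>i. i < length Ts \<Longrightarrow> inj_on (g i) {..<m}"
      "\<And>i t. i < length Ts \<Longrightarrow> t < m \<Longrightarrow> length (g i t) = fst (Ts ! i)"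
    and gw: "\<And>\<tau>. (\<forall>i<length Ts. \<tau> i < m) \<Longrightarrow> join (length Ts) (\<lambda>i. g i (\<tau> i)) @ w \<in> dup m p q Z"
    using Cons.IH[of Ss' "dup m p q Z"] by blast
  define a where "a = (\<Sum>i<length Ts. fst (Ts ! i))"
  have jl: "length (join (length Ts) (\<lambda>i. g i (\<tau> i))) = a" if "\<forall>i<length Ts. \<tau> i < m" for \<tau>
    unfolding a_def using g(2) that by (intro length_join) simp
  have "a = factor_dim Ts"
    by (simp add: a_def sum_list_sum_nth atLeast0LessThan case_prod_beta)
  then have ap: "a \<le> p" by (simp add: p_def)
  \<comment> \<open>The copies sit in the tail \<open>w\<close>, at distance \<open>p - a\<close>
    from its beginning, so they do not depend on the path \<open>\<tau>\<close> through the other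
    rows. They form the new first row of the grid.\<close>
  define y where "y t = piece (p - a) q t w" for t
  have y: "piece p q t (join (length Ts) (\<lambda>i. g i (\<tau> i)) @ w) = y t"
    if "\<forall>i<length Ts. \<tau> i < m" for \<tau> t
    using jl[OF that] ap by (simp add: piece_def y_def)
  have tk: "take p (join (length Ts) (\<lambda>i. g i (\<tau> i)) @ w) =
      join (length Ts) (\<lambda>i. g i (\<tau> i)) @ take (p - a) w" if "\<forall>i<length Ts. \<tau> i < m" for \<tau>
    using jl[OF that] ap by simp
  have in_dup: "join (length Ts) (\<lambda>i. g i 0) @ w \<in> dup m p q Z"
    using gw[of "\<lambda>_. 0"] assms(1) by auto
  have y_inj: "inj_on y {..<m}"
  proof (rule linorder_inj_onI)
    fix t t' assume t: "t < t'" "t \<in> {..<m}" "t' \<in> {..<m}"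
    have "y t' \<noteq> y t"
    proof -
      have "piece p q t' (join (length Ts) (\<lambda>i. g i 0) @ w) \<noteq>
          piece p q t (join (length Ts) (\<lambda>i. g i 0) @ w)"
        using in_dup t unfolding dup_def mem_Collect_eq by blast
      then show ?thesis using y[of "\<lambda>_. 0" t] y[of "\<lambda>_. 0" t'] assms(1) by simp
    qed
    then show "y t \<noteq> y t'" by simp
  qed auto
  have y_len: "length (y t) = q" if "t < m" for t
  proof -
    have "(t + 1) * q \<le> m * q" using that by (intro mult_le_mono1) simp
    moreover have "a + length w = p + m * q"
      using in_dup jl[of "\<lambda>_. 0"] assms(1) by (simp add: dup_def)
    ultimately have "q \<le> length w - (p - a + t * q)"
      using ap by simp
    then show ?thesis by (simp add: y_def piece_def min_absorb2)
  qed
  define g' where "g' = case_nat y g"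
  have "inj_on (g' i) {..<m} \<and> (\<forall>t<m. length (g' i t) = fst ((T # Ts) ! i))"
    if "i < length (T # Ts)" for i
    using that g y_inj y_len by (cases i) (auto simp: g'_def T)
  moreover have "join (length (T # Ts)) (\<lambda>i. g' i (\<tau> i)) @ take (p - a) w \<in> Z"
    if \<tau>: "\<forall>i<length (T # Ts). \<tau> i < m" for \<tau>
  proof -
    have \<tau>': "\<forall>i<length Ts. \<tau> (Suc i) < m" and "\<tau> 0 < m" using \<tau> by auto
    have "y (\<tau> 0) @ join (length Ts) (\<lambda>i. g i (\<tau> (Suc i))) @ take (p - a) w \<in> Z"
    proof -
      let ?v = "join (length Ts) (\<lambda>i. g i (\<tau> (Suc i))) @ w"
      have "piece p q (\<tau> 0) ?v @ take p ?v \<in> Z"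
        using gw[OF \<tau>'] \<open>\<tau> 0 < m\<close> unfolding dup_def mem_Collect_eq by blast
      then show ?thesis using y[OF \<tau>', of "\<tau> 0"] tk[OF \<tau>'] by simp
    qed
    then show ?thesis by (simp add: join_Suc_shift g'_def)
  qed
  ultimately show ?case by blast
qed

lemma broad_of_grids:
  assumes Y: "definable L M (\<Sum>i<n. k i) Y" and X: "\<And>i. i < n \<Longrightarrow> definable L M (k i) (X i)"
    and grids: "\<And>m :: nat. \<exists>g. (\<forall>i<n. inj_on (g i) {..<m} \<and> (\<forall>t<m. g i t \<in> X i)) \<and>
      (\<forall>\<tau>. (\<forall>i<n. \<tau> i < m) \<longrightarrow> join n (\<lambda>i. g i (\<tau> i)) \<in> Y)"
  shows "broad n X Y"
proof -
  define len :: "nat \<times> nat \<Rightarrow> nat" where "len = (\<lambda>(i, j). k i)"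
  define pth where "pth N = {xs :: nat list. set xs \<subseteq> {..<N} \<and> length xs = n}" for N
  define P where "P N E \<longleftrightarrow> (\<forall>i\<in>{..<n}. \<forall>t\<in>{..<N}. E (i, t) \<in> X i \<and> (\<forall>t'\<in>{..<t}. E (i, t) \<noteq> E (i, t'))) \<and>
      (\<forall>xs\<in>pth N. concat (map (\<lambda>i. E (i, xs ! i)) [0..<n]) \<in> Y)" for N :: nat and E
  have "dfn L M len (P N)" for N
    unfolding P_def pth_def
    by (intro dfn_ball dfn_intros dfn_mem[OF Y] dfn_mem[OF X] tuple_term_intros
        finite_lists_length_eq finite_lessThan) auto
  moreover have "\<exists>E. (\<forall>v. length (E v) = len v) \<and> (\<forall>i<N. P i E)" for N
  proof -
    obtain g where g: "\<And>i. i < n \<Longrightarrow> inj_on (g i) {..<N}" "\<And>i t. i < n \<Longrightarrow> t < N \<Longrightarrow> g i t \<in> X i"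
      and gY: "\<And>\<tau>. (\<forall>i<n. \<tau> i < N) \<Longrightarrow> join n (\<lambda>i. g i (\<tau> i)) \<in> Y"
      using grids[of N] by blast
    define E where "E = (\<lambda>(i, t). if i < n \<and> t < N then g i t else replicate (k i) undefined)"
    have "length (E v) = len v" for v
      using definable_length[OF X g(2)] by (auto simp: E_def len_def split: prod.splits)
    moreover have "P N' E" if "N' < N" for N'
    proof -
      have "E (i, t) \<in> X i \<and> (\<forall>t'\<in>{..<t}. E (i, t) \<noteq> E (i, t'))" if "i < n" "t < N" for i t
        using g that by (force simp: E_def inj_on_def)
      moreover have "concat (map (\<lambda>i. E (i, xs ! i)) [0..<n]) \<in> Y" if xs: "xs \<in> pth N'" for xs
      proof -
        have xsN: "xs ! i < N" if "i < n" for i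
          using xs that \<open>N' < N\<close> less_trans[of "xs ! i" N' N] by (simp add: pth_def subset_iff)
        then have "join n (\<lambda>i. E (i, xs ! i)) = join n (\<lambda>i. g i (xs ! i))"
          by (intro join_cong) (simp add: E_def)
        then show ?thesis using gY[of "\<lambda>i. xs ! i"] xsN by (simp add: join_def)
      qed
      ultimately show ?thesis using that by (simp add: P_def)
    qed
    ultimately show ?thesis by blast
  qed
  ultimately obtain E where E: "\<And>v. length (E v) = len v" "\<And>N. P N E"
    by (rule dfn_compactness[OF saturated natLeq_less, of len P]) (rule that)
  have EX: "E (i, t) \<in> X i" "t' < t \<Longrightarrow> E (i, t) \<noteq> E (i, t')" if "i < n" for i t t'
    using E(2)[of "Suc t"] that unfolding P_def by auto
  have "inj (\<lambda>t. E (i, t))" if "i < n" for i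
  proof (rule linorder_inj_onI)
    show "E (i, x) \<noteq> E (i, y)" if "x < y" for x y
      using EX(2)[OF \<open>i < n\<close> that] by simp
  qed auto
  moreover have "join n (\<lambda>i. E (i, \<eta> i)) \<in> Y" for \<eta>
  proof -
    define xs where "xs = map \<eta> [0..<n]"
    have "x < Suc (Max (insert 0 (set xs)))" if "x \<in> set xs" for x
      using that by (intro le_imp_less_Suc Max_ge) simp_all
    then have "xs \<in> pth (Suc (Max (insert 0 (set xs))))" by (auto simp: pth_def xs_def)
    then have "concat (map (\<lambda>i. E (i, xs ! i)) [0..<n]) \<in> Y"
      using E(2) unfolding P_def by blast
    moreover have "map (\<lambda>i. E (i, xs ! i)) [0..<n] = map (\<lambda>i. E (i, \<eta> i)) [0..<n]"
      by (simp add: xs_def)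
    ultimately show ?thesis by (simp add: join_def)
  qed
  ultimately show ?thesis
    unfolding broad_def using EX(1) by (intro exI[of _ "\<lambda>i t. E (i, t)"]) auto
qed

lemma product_subset_products: "product n X \<subseteq> products (map X [0..<n])"
  unfolding product_def join_def
  by (auto intro!: concat_in_products simp: list_all2_conv_all_nth)

lemma dp_rank_product_le:
  assumes X: "\<And>i. i < n \<Longrightarrow> definable L M (k i) (X i)"
    and r: "\<And>i. i < n \<Longrightarrow> dp_rank L M (k i) (X i) = enat (r i)"
    and Y: "Y \<subseteq> product n X" and m: "has_ict_pattern L M (\<Sum>i<n. k i) Y m"
  shows "m \<le> (\<Sum>i<n. r i)"
proof -
  define Ts where "Ts = map (\<lambda>i. (k i, X i, r i)) [0..<n]"
  have "\<forall>T\<in>set Ts. bounded T"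
    using X has_ict_pattern_le_dp_rank[OF r] by (auto simp: Ts_def bounded_def)
  moreover have "Y \<subseteq> factor_set Ts"
    using Y product_subset_products[of n X] by (simp add: Ts_def o_def)
  moreover have "factor_dim Ts = (\<Sum>i<n. k i)" "factor_rank Ts = (\<Sum>i<n. r i)"
    by (simp_all add: Ts_def o_def interv_sum_list_conv_sum_set_nat atLeast0LessThan)
  ultimately show ?thesis using bounded_subset[of Ts Y m] m by simp
qed

lemma broad_of_full_rank:
  assumes X: "\<And>i. i < n \<Longrightarrow> definable L M (k i) (X i)"
    and r: "\<And>i. i < n \<Longrightarrow> dp_rank L M (k i) (X i) = enat (r i)" "\<And>i. i < n \<Longrightarrow> r i > 0"
    and Yd: "definable L M (\<Sum>i<n. k i) Y" and Y: "Y \<subseteq> product n X"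
    and rank: "has_ict_pattern L M (\<Sum>i<n. k i) Y (\<Sum>i<n. r i)"
  shows "broad n X Y"
proof (rule broad_of_grids[OF Yd X])
  fix m :: nat
  define Ts where "Ts = map (\<lambda>i. (k i, X i, r i)) [0..<n]"
  have dims: "factor_dim Ts = (\<Sum>i<n. k i)" "factor_rank Ts = (\<Sum>i<n. r i)"
    by (simp_all add: Ts_def o_def interv_sum_list_conv_sum_set_nat atLeast0LessThan)
  \<comment> \<open>Size \<open>m + 1\<close> guarantees at least one copy, also for
    \<open>m = 0\<close>.\<close>
  have "\<exists>g w. (\<forall>i<length Ts. inj_on (g i) {..<m + 1} \<and> (\<forall>t<m + 1. length (g i t) = fst (Ts ! i))) \<and>
    (\<forall>\<tau>. (\<forall>i<length Ts. \<tau> i < m + 1) \<longrightarrow> join (length Ts) (\<lambda>i. g i (\<tau> i)) @ w \<in> Y)"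
  proof (rule full_rank_grid[where Ss = "[]"])
    show "\<forall>T\<in>set (Ts @ []). bounded T"
      using X has_ict_pattern_le_dp_rank[OF r(1)] by (auto simp: Ts_def bounded_def)
    show "\<forall>(q, D, r)\<in>set Ts. 1 \<le> r" using r(2) by (auto simp: Ts_def Suc_le_eq)
    show "Y \<subseteq> factor_set (Ts @ [])"
      using Y product_subset_products[of n X] by (simp add: Ts_def o_def)
  qed (use Yd rank dims in simp_all)
  then obtain g w where g: "\<And>i. i < n \<Longrightarrow> inj_on (g i) {..<m + 1}"
      "\<And>i t. i < n \<Longrightarrow> t < m + 1 \<Longrightarrow> length (g i t) = k i"
    and gw: "\<And>\<tau>. (\<forall>i<n. \<tau> i < m + 1) \<Longrightarrow> join n (\<lambda>i. g i (\<tau> i)) @ w \<in> Y"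
    by (auto simp: Ts_def)
  have "w = []"
    using definable_length[OF Yd gw[of "\<lambda>_. 0"]] length_join[of n "\<lambda>i. g i 0" k] g(2) by simp
  with gw have gY: "\<And>\<tau>. (\<forall>i<n. \<tau> i < m + 1) \<Longrightarrow> join n (\<lambda>i. g i (\<tau> i)) \<in> Y" by simp
  have "g i t \<in> X i" if it: "i < n" "t < m" for i t
  proof -
    \<comment> \<open>One constant path is enough: the lengths determine the components of a join,
      so \<open>g i t\<close> is the component in \<open>X i\<close> of a point of the
      product.\<close>
    have "join n (\<lambda>i'. g i' t) \<in> Y" using gY[of "\<lambda>_. t"] it by simp
    then obtain x where x: "join n (\<lambda>i'. g i' t) = join n x" "\<forall>i<n. x i \<in> X i"
      using Y unfolding product_def by blast
    have "g i t = slice k i (join n (\<lambda>i'. g i' t))"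
      by (rule slice_join[symmetric]) (use g it in auto)
    also have "\<dots> = x i"
      unfolding x(1) by (rule slice_join) (use x definable_length[OF X] it in auto)
    finally show ?thesis using x(2) it by simp
  qed
  moreover have "inj_on (g i) {..<m}" if "i < n" for i
    using g(1)[OF that] by (rule inj_on_subset) auto
  moreover have "join n (\<lambda>i. g i (\<tau> i)) \<in> Y" if "\<forall>i<n. \<tau> i < m" for \<tau>
    using that by (intro gY) auto
  ultimately show "\<exists>g. (\<forall>i<n. inj_on (g i) {..<m} \<and> (\<forall>t<m. g i t \<in> X i)) \<and>
      (\<forall>\<tau>. (\<forall>i<n. \<tau> i < m) \<longrightarrow> join n (\<lambda>i. g i (\<tau> i)) \<in> Y)"
    by blast
qed

end

section \<open>From broadness to full rank\<close>

abbreviation paths :: "nat \<Rightarrow> nat \<Rightarrow> (nat \<Rightarrow> nat) set" where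
  "paths d K \<equiv> {..<d} \<rightarrow>\<^sub>E {..<K}"

lemma finite_paths: "finite (paths d K)"
  by (intro finite_PiE) auto

lemma paths_mono: "K \<le> K' \<Longrightarrow> paths d K \<subseteq> paths d K'"
  by (intro PiE_mono) auto

lemma paths_less: "\<eta> \<in> paths d K \<Longrightarrow> s < d \<Longrightarrow> \<eta> s < K"
  by (auto simp: PiE_def)

section \<open>NIP with one varying coordinate of a product\<close>

lemma join_upd:
  assumes "t < n"
  shows "join n (w(t := y)) = join t w @ y @ concat (map w [Suc t..<n])"
proof -
  have "[0..<n] = [0..<t] @ t # [Suc t..<n]"
    using assms upt_add_eq_append[of 0 t "n - t"] upt_conv_Cons[of t n] by simp
  then show ?thesis by (simp add: join_def)
qed

text \<open>The parameters \<open>p\<close> of \<open>E\<close> are appended to the tuples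
  \<open>y\<close>, so that NIP for the formula also bounds the sets shattered by
  \<open>E\<close>.\<close>

lemma NIP_definable:
  assumes "NIP L M" "definable L M (a + b) E"
  shows "\<exists>d::nat. \<forall>z. (\<forall>i<d. length (z i) = a) \<longrightarrow>
    (\<exists>S\<subseteq>{..<d}. \<forall>y. length y = b \<longrightarrow> \<not> (\<forall>i<d. z i @ y \<in> E \<longleftrightarrow> i \<in> S))"
proof -
  obtain p \<phi> where \<phi>: "\<phi> \<in> formulas L (a + b + length p)"
    and E: "E = {v. length v = a + b \<and> holds M \<phi> (v @ p)}"
    using assms(2) unfolding definable_def by blast
  have "\<not> has_IP M a (b + length p) \<phi>"
    using assms(1) \<phi> unfolding NIP_def by (simp add: add.assoc)
  then obtain d :: nat where d: "\<not> (\<exists>(z :: nat \<Rightarrow> 'c list) ys. (\<forall>i<d. length (z i) = a) \<and>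
      (\<forall>S\<subseteq>{..<d}. length (ys S) = b + length p) \<and>
      (\<forall>i<d. \<forall>S\<subseteq>{..<d}. holds M \<phi> (z i @ ys S) \<longleftrightarrow> i \<in> S))"
    unfolding has_IP_def not_all by (elim exE) (rule that)
  show ?thesis
  proof (intro exI[of _ d] allI impI, rule ccontr)
    fix z :: "nat \<Rightarrow> 'c list"
    assume z: "\<forall>i<d. length (z i) = a"
      and "\<not> (\<exists>S\<subseteq>{..<d}. \<forall>y. length y = b \<longrightarrow> \<not> (\<forall>i<d. z i @ y \<in> E \<longleftrightarrow> i \<in> S))"
    then have "\<forall>S. \<exists>y. S \<subseteq> {..<d} \<longrightarrow> length y = b \<and> (\<forall>i<d. z i @ y \<in> E \<longleftrightarrow> i \<in> S)" by blast
    then obtain ys where ys: "\<And>S. S \<subseteq> {..<d} \<Longrightarrow> length (ys S) = b \<and> (\<forall>i<d. z i @ ys S \<in> E \<longleftrightarrow> i \<in> S)"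
      by metis
    have "(\<forall>i<d. length (z i) = a) \<and> (\<forall>S\<subseteq>{..<d}. length (ys S @ p) = b + length p) \<and>
      (\<forall>i<d. \<forall>S\<subseteq>{..<d}. holds M \<phi> (z i @ ys S @ p) \<longleftrightarrow> i \<in> S)"
    proof (intro conjI allI impI)
      fix i S assume "i < d" "S \<subseteq> {..<d}"
      then have "length (ys S) = b" "z i @ ys S \<in> E \<longleftrightarrow> i \<in> S" "length (z i) = a"
        using ys z by auto
      then show "holds M \<phi> (z i @ ys S @ p) \<longleftrightarrow> i \<in> S"
        by (simp add: E)
    qed (use ys z in auto)
    then show False using d by (elim notE) (intro exI[of _ z] exI[of _ "\<lambda>S. ys S @ p"])
  qed
qed

text \<open>The varying coordinate lies in the middle of the tuple. \<open>E\<close> rearranges the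
  entries so that \<open>y\<close> comes last; in \<open>z e\<close> the coordinate \<open>t\<close>
  is left empty, as recorded by \<open>k'\<close>.\<close>

lemma NIP_join:
  fixes k :: "nat \<Rightarrow> nat"
  assumes "NIP L M" "definable L M (\<Sum>i<n. k i) Y" "t < n"
  shows "\<exists>d::nat. \<forall>w. (\<forall>e<d. \<forall>i<n. i \<noteq> t \<longrightarrow> length (w e i) = k i) \<longrightarrow>
    (\<exists>S\<subseteq>{..<d}. \<forall>y. length y = k t \<longrightarrow> \<not> (\<forall>e<d. join n ((w e)(t := y)) \<in> Y \<longleftrightarrow> e \<in> S))"
proof -
  define k' where "k' = k(t := 0)"
  define p where "p = (\<Sum>i<n. k' i)"
  define A where "A = (\<Sum>i<t. k i)"
  define E where "E = {v. length v = p + k t \<and> take A v @ drop p v @ drop A (take p v) \<in> Y}"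
  have Ed: "definable L M (p + k t) E"
    unfolding E_def by (intro definable_dfn dfn_mem[OF assms(2)] tuple_term_intros)
  obtain d :: nat where d: "\<forall>z. (\<forall>i<d. length (z i) = p) \<longrightarrow>
    (\<exists>S\<subseteq>{..<d}. \<forall>y. length y = k t \<longrightarrow> \<not> (\<forall>i<d. z i @ y \<in> E \<longleftrightarrow> i \<in> S))"
    using NIP_definable[OF assms(1) Ed] by (elim exE) (rule that)
  show ?thesis
  proof (intro exI[of _ d] allI impI)
    fix w :: "nat \<Rightarrow> nat \<Rightarrow> 'c list"
    assume w: "\<forall>e<d. \<forall>i<n. i \<noteq> t \<longrightarrow> length (w e i) = k i"
    define z where "z e = join n ((w e)(t := []))" for e
    have zl: "length (z e) = p" if "e < d" for e
      unfolding z_def p_def by (rule length_join) (use w that in \<open>auto simp: k'_def\<close>)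
    obtain S where S: "S \<subseteq> {..<d}"
        "\<And>y. length y = k t \<Longrightarrow> \<not> (\<forall>e<d. z e @ y \<in> E \<longleftrightarrow> e \<in> S)"
      using d[rule_format, of z] zl by auto
    have A: "length (join t (w e)) = A" if "e < d" for e
      unfolding A_def by (rule length_join) (use w that assms(3) in auto)
    have "z e @ y \<in> E \<longleftrightarrow> join n ((w e)(t := y)) \<in> Y" if "e < d" "length y = k t" for e y
      using that zl[OF that(1)] A[OF that(1)] join_upd[OF assms(3), of "w e" y]
        join_upd[OF assms(3), of "w e" "[]"]
      by (simp add: E_def z_def)
    then show "\<exists>S\<subseteq>{..<d}. \<forall>y. length y = k t \<longrightarrow> \<not> (\<forall>e<d. join n ((w e)(t := y)) \<in> Y \<longleftrightarrow> e \<in> S)"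
      using S by (intro exI[of _ S]) simp
  qed
qed

text \<open>In a slot grid, the element of \<open>X i\<close> with index \<open>\<eta>\<close> is the witness in an ict-pattern of
  depth \<open>d i\<close> for the path \<open>\<eta>\<close>.\<close>

definition slot_pattern ::
  "nat \<Rightarrow> nat \<Rightarrow> 'a list set \<Rightarrow> (nat \<Rightarrow> 'a list set) \<Rightarrow> (nat \<Rightarrow> nat) \<Rightarrow>
   (nat \<Rightarrow> nat \<Rightarrow> 'a list) \<Rightarrow> ((nat \<Rightarrow> nat) \<Rightarrow> 'a list) \<Rightarrow> bool" where
  "slot_pattern K d D \<Phi> l c x \<longleftrightarrow> (\<forall>s\<in>{..<d}. \<forall>j\<in>{..<K}. length (c s j) = l s) \<and>
     (\<forall>\<eta>\<in>paths d K. x \<eta> \<in> D \<and> (\<forall>s\<in>{..<d}. \<forall>j\<in>{..<K}. x \<eta> @ c s j \<in> \<Phi> s \<longleftrightarrow> j = \<eta> s))"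

definition slot_grid where
  "slot_grid K n d X Y \<Phi> l c x \<longleftrightarrow> (\<forall>i<n. slot_pattern K (d i) (X i) (\<Phi> i) (l i) (c i) (x i)) \<and>
     (\<forall>\<eta>. (\<forall>i<n. \<eta> i \<in> paths (d i) K) \<longrightarrow> join n (\<lambda>i. x i (\<eta> i)) \<in> Y)"

lemma slot_pattern_mono: "K \<le> K' \<Longrightarrow> slot_pattern K' d D \<Phi> l c x \<Longrightarrow> slot_pattern K d D \<Phi> l c x"
  unfolding slot_pattern_def using paths_mono[of K K' d] by (meson lessThan_iff order_less_le_trans subsetD)

lemma slot_grid_mono: "K \<le> K' \<Longrightarrow> slot_grid K' n d X Y \<Phi> l c x \<Longrightarrow> slot_grid K n d X Y \<Phi> l c x"
  unfolding slot_grid_def using paths_mono[of K K'] slot_pattern_mono by (meson subsetD)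

text \<open>Indices of the tuples that are existentially quantified in
  \<open>spread_uniform\<close>: row parameters, witnesses, and the sequence in \<open>X t\<close>.
  Only the free tuples there go through compactness, so a function is allowed as an
  argument.\<close>

datatype grid_index = Par nat nat nat nat | Elt nat nat "nat \<Rightarrow> nat" | Seq nat

section \<open>Slot grids between broadness and patterns\<close>

context saturated_structure
begin

text \<open>The formulas are fixed before the size \<open>K\<close>, whereas parameters and
  witnesses may vary with it; this is the form that compactness accepts.\<close>

definition has_slot_grids where
  "has_slot_grids n k d X Y \<longleftrightarrow> (\<exists>\<Phi> l. (\<forall>i<n. \<forall>s<d i. definable L M (k i + l i s) (\<Phi> i s)) \<and>
     (\<forall>K. \<exists>c x. slot_grid K n d X Y \<Phi> l c x))"

lemma has_slot_grids_broad:
  assumes X: "\<And>i. i < n \<Longrightarrow> definable L M (k i) (X i)" and "broad n X Y"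
  shows "has_slot_grids n k (\<lambda>_. 1) X Y"
proof -
  obtain a :: "nat \<Rightarrow> nat \<Rightarrow> 'a list" where a: "\<And>i j. i < n \<Longrightarrow> a i j \<in> X i" "\<And>i. i < n \<Longrightarrow> inj (a i)"
    and aY: "\<And>\<eta>. join n (\<lambda>i. a i (\<eta> i)) \<in> Y"
    using assms(2) unfolding broad_def by blast
  define \<Phi> where "\<Phi> i s = {v :: 'a list. length v = k i + k i \<and> take (k i) v = drop (k i) v}"
    for i and s :: nat
  have "definable L M (k i + k i) (\<Phi> i s)" for i s
    unfolding \<Phi>_def by (intro definable_dfn dfn_intros tuple_term_intros)
  moreover have "slot_grid K n (\<lambda>_. 1) X Y \<Phi> (\<lambda>i s. k i) (\<lambda>i s j. a i j) (\<lambda>i \<eta>. a i (\<eta> 0))" for K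
  proof -
    have "length (a i j) = k i" if "i < n" for i j
      using definable_length[OF X a(1)] that by simp
    then show ?thesis
      using a aY by (auto simp: slot_grid_def slot_pattern_def \<Phi>_def inj_eq)
  qed
  ultimately show ?thesis
    unfolding has_slot_grids_def
    by (intro exI[of _ \<Phi>] exI[of _ "\<lambda>i s. k i"]) blast
qed

text \<open>A path through all rows \<open>(i, s)\<close> splits into one path for each slot, and
  row \<open>(i, s)\<close> tests only the component in \<open>X i\<close>.\<close>

lemma has_ict_pattern_slot_grids:
  assumes X: "\<And>i. i < n \<Longrightarrow> definable L M (k i) (X i)" and Y: "definable L M (\<Sum>i<n. k i) Y"
    and "has_slot_grids n k r X Y"
  shows "has_ict_pattern L M (\<Sum>i<n. k i) Y (\<Sum>i<n. r i)"
proof -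
  define p where "p = (\<Sum>i<n. k i)"
  obtain \<Phi> l where \<Phi>: "\<And>i s. i < n \<Longrightarrow> s < r i \<Longrightarrow> definable L M (k i + l i s) (\<Phi> i s)"
    and grid: "\<And>K. \<exists>c x. slot_grid K n r X Y \<Phi> l c x"
    using assms(3) unfolding has_slot_grids_def by blast
  define I where "I = (SIGMA i:{..<n}. {..<r i})"
  define \<Psi> where "\<Psi> = (\<lambda>(i, s). {v. length v = p + l i s \<and> slice k i v @ drop p v \<in> \<Phi> i s})"
  have "has_ict_pattern L M p Y (card I)"
  proof (rule has_ict_pattern_of_grids)
    show "finite I" by (simp add: I_def)
    show "definable L M p Y" using Y by (simp add: p_def)
    show "definable L M (p + (case i of (i, s) \<Rightarrow> l i s)) (\<Psi> i)" if "i \<in> I" for i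
      using that \<Phi> unfolding \<Psi>_def I_def
      by (auto intro!: definable_dfn dfn_intros dfn_mem tuple_term_intros tuple_term_slice)
    fix K :: nat
    obtain c x where g: "slot_grid K n r X Y \<Phi> l c x" using grid by blast
    have pat: "slot_pattern K (r i) (X i) (\<Phi> i) (l i) (c i) (x i)" if "i < n" for i
      using g that by (simp add: slot_grid_def)
    define c' where "c' = (\<lambda>(i, s). c i s)"
    have "length (c' i j) = (case i of (i, s) \<Rightarrow> l i s)" if "i \<in> I" "j < K" for i j
      using pat that by (auto simp: I_def c'_def slot_pattern_def)
    moreover have "\<exists>a\<in>Y. \<forall>i\<in>I. \<forall>j<K. a @ c' i j \<in> \<Psi> i \<longleftrightarrow> j = \<eta> i" if \<eta>: "\<forall>i\<in>I. \<eta> i < K" for \<eta>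
    proof -
      define \<eta>' where "\<eta>' i = (\<lambda>s\<in>{..<r i}. \<eta> (i, s))" for i
      have \<eta>': "\<eta>' i \<in> paths (r i) K" if "i < n" for i
        using \<eta> that by (auto simp: \<eta>'_def I_def)
      define a where "a = join n (\<lambda>i. x i (\<eta>' i))"
      have aY: "a \<in> Y" using g \<eta>' by (simp add: slot_grid_def a_def)
      have al: "length a = p" using definable_length[OF Y aY] by (simp add: p_def)
      have xl: "length (x i (\<eta>' i)) = k i" if "i < n" for i
        using pat[OF that] \<eta>'[OF that] definable_length[OF X[OF that]] by (auto simp: slot_pattern_def)
      have "a @ c' (i, s) j \<in> \<Psi> (i, s) \<longleftrightarrow> j = \<eta> (i, s)" if "(i, s) \<in> I" "j < K" for i s j
      proof -
        have ii: "i < n" "s < r i" using that by (auto simp: I_def)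
        have "slice k i (a @ c i s j) = x i (\<eta>' i)"
          unfolding a_def by (rule slice_join_append) (use xl ii in auto)
        moreover have "length (c i s j) = l i s" "x i (\<eta>' i) @ c i s j \<in> \<Phi> i s \<longleftrightarrow> j = \<eta>' i s"
          using pat[OF ii(1)] \<eta>'[OF ii(1)] ii(2) that(2) by (auto simp: slot_pattern_def)
        ultimately show ?thesis
          using al ii(2) by (simp add: \<Psi>_def c'_def \<eta>'_def)
      qed
      then show ?thesis using aY by (intro bexI[of _ a]) auto
    qed
    ultimately show "\<exists>c. (\<forall>i\<in>I. \<forall>j<K. length (c i j) = (case i of (i, s) \<Rightarrow> l i s)) \<and>
      (\<forall>\<eta>. (\<forall>i\<in>I. \<eta> i < K) \<longrightarrow> (\<exists>a\<in>Y. \<forall>i\<in>I. \<forall>j<K. a @ c i j \<in> \<Psi> i \<longleftrightarrow> j = \<eta> i))"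
      by blast
  qed
  then show ?thesis by (simp add: I_def p_def)
qed

end

text \<open>The points \<open>z e\<close> and the grids \<open>x \<tau>\<close> come from one large grid, in which they alternate
  in every coordinate. By NIP an element \<open>y\<close> compatible with all \<open>z e\<close> is compatible with one
  whole grid \<open>x \<tau>\<close>.\<close>

definition spread where
  "spread K D n t q d X Y \<Phi> l z c x b \<longleftrightarrow>
     (\<forall>\<tau>\<in>{..<D::nat}. \<forall>i\<in>{..<n} - {t}. slot_pattern K (d i) (X i) (\<Phi> i) (l i) (c \<tau> i) (x \<tau> i)) \<and>
     (\<forall>j\<in>{..<K}. b j \<in> X t \<and> (\<forall>j'\<in>{..<j}. b j \<noteq> b j') \<and> (\<forall>e\<in>{..<D}. join n ((z e)(t := b j)) \<in> Y)) \<and>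
     (\<forall>y. length y = q \<longrightarrow> (\<forall>e\<in>{..<D}. join n ((z e)(t := y)) \<in> Y) \<longrightarrow>
        (\<exists>\<tau>\<in>{..<D}. \<forall>\<eta>\<in>PiE {..<n} (\<lambda>i. paths (d i) K). join n ((\<lambda>i. x \<tau> i (\<eta> i))(t := y)) \<in> Y))"

lemma spread_mono:
  assumes "K \<le> K'" "spread K' D n t q d X Y \<Phi> l z c x b"
  shows "spread K D n t q d X Y \<Phi> l z c x b"
proof -
  have "PiE {..<n} (\<lambda>i. paths (d i) K) \<subseteq> PiE {..<n} (\<lambda>i. paths (d i) K')"
    by (intro PiE_mono paths_mono assms(1))
  then have "\<exists>\<tau>\<in>{..<D}. \<forall>\<eta>\<in>PiE {..<n} (\<lambda>i. paths (d i) K). join n ((\<lambda>i. x \<tau> i (\<eta> i))(t := y)) \<in> Y"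
    if y: "length y = q" "\<forall>e\<in>{..<D}. join n ((z e)(t := y)) \<in> Y" for y
  proof -
    obtain \<tau> where "\<tau> < D"
      "\<forall>\<eta>\<in>PiE {..<n} (\<lambda>i. paths (d i) K'). join n ((\<lambda>i. x \<tau> i (\<eta> i))(t := y)) \<in> Y"
      using assms(2) y unfolding spread_def by blast
    then show ?thesis
      using \<open>_ \<subseteq> _\<close> by (intro bexI[of _ \<tau>]) (auto dest: subsetD)
  qed
  moreover have "slot_pattern K (d i) (X i) (\<Phi> i) (l i) (c \<tau> i) (x \<tau> i)"
    if "\<tau> < D" "i \<in> {..<n} - {t}" for \<tau> i
    using assms(2) that slot_pattern_mono[OF assms(1)] unfolding spread_def by blast
  moreover have "b j \<in> X t \<and> (\<forall>j'\<in>{..<j}. b j \<noteq> b j') \<and> (\<forall>e\<in>{..<D}. join n ((z e)(t := b j)) \<in> Y)"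
    if "j < K" for j
    using assms that unfolding spread_def by simp
  ultimately show ?thesis unfolding spread_def by blast
qed

text \<open>Suppose \<open>y\<close> is compatible with all \<open>z e\<close> but fails for some
  path in each grid. As points and grids alternate, for every \<open>S\<close> an increasing choice
  takes the point \<open>z e\<close> for \<open>e \<in> S\<close> and the failing path of grid
  \<open>e\<close> otherwise. By homogeneity a single configuration then realizes every
  \<open>S\<close>, contrary to the choice of \<open>D\<close>.\<close>

lemma spread_exists:
  fixes L :: "('f, 'r) language" and M :: "('f, 'r, 'a) struct" and k :: "nat \<Rightarrow> nat"
  assumes grids: "\<And>K. \<exists>c x. slot_grid K n d X Y \<Phi> l c x"
    and X: "\<And>i. i < n \<Longrightarrow> definable L M (k i) (X i)"
    and t: "t < n" "d t \<ge> 1"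
    and D: "\<forall>w. (\<forall>e<D. \<forall>i<n. i \<noteq> t \<longrightarrow> length (w e i :: 'a list) = k i) \<longrightarrow>
      (\<exists>S\<subseteq>{..<D::nat}. \<forall>y. length y = k t \<longrightarrow> \<not> (\<forall>e<D. join n ((w e)(t := y)) \<in> Y \<longleftrightarrow> e \<in> S))"
    and K: "K \<ge> 1"
  shows "\<exists>z c x b. (\<forall>e i. i < n \<longrightarrow> length (z e i) = k i) \<and>
    (\<forall>\<tau> i \<eta>. i < n \<longrightarrow> length (x \<tau> i \<eta>) = k i) \<and> (\<forall>j. length (b j) = k t) \<and>
    spread K D n t (k t) d X Y \<Phi> l z c x b"
proof -
  \<comment> \<open>The rows of all slots except \<open>t\<close>, whose coordinate is always
    overwritten by \<open>y\<close>.\<close>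
  define I where "I = (SIGMA i:{..<n} - {t}. {..<d i})"
  define K' where "K' = 2 * D * K + K"
  show ?thesis
  proof (rule product_ramsey[where I = I and C = "Pow (Pow {..<D})" and k = K' and w = D])
    show "finite I" "finite (Pow (Pow {..<D}))" by (simp_all add: I_def)
    fix N :: nat
    assume "K' \<le> N"
    assume ramsey: "\<And>col :: (nat \<times> nat \<Rightarrow> nat \<Rightarrow> nat) \<Rightarrow> nat set set.
      (\<And>g. col g \<in> Pow (Pow {..<D})) \<Longrightarrow>
      (\<And>g g'. (\<And>i t. i \<in> I \<Longrightarrow> t < D \<Longrightarrow> g i t = g' i t) \<Longrightarrow> col g = col g') \<Longrightarrow>
      \<exists>h v. (\<forall>i\<in>I. strict_mono_on {..<K'} (h i) \<and> h i ` {..<K'} \<subseteq> {..<N}) \<and>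
        (\<forall>g. (\<forall>i\<in>I. strict_mono_on {..<D} (g i) \<and> g i ` {..<D} \<subseteq> {..<K'}) \<longrightarrow>
           col (\<lambda>i t. h i (g i t)) = v)"
    obtain c x0 where grid: "slot_grid N n d X Y \<Phi> l c x0" using grids by blast
    \<comment> \<open>Off the grid a dummy of the correct length is used, since the lengths are
      claimed for all indices.\<close>
    define x where "x i \<eta> = (if \<eta> \<in> paths (d i) N then x0 i \<eta> else replicate (k i) undefined)" for i \<eta>
    have pat: "slot_pattern N (d i) (X i) (\<Phi> i) (l i) (c i) (x i)" if "i < n" for i
      using grid that by (auto simp: slot_grid_def slot_pattern_def x_def)
    have gridY: "join n (\<lambda>i. x i (\<eta> i)) \<in> Y" if "\<And>i. i < n \<Longrightarrow> \<eta> i \<in> paths (d i) N" for \<eta>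
    proof -
      have "join n (\<lambda>i. x i (\<eta> i)) = join n (\<lambda>i. x0 i (\<eta> i))"
        using that by (intro join_cong) (simp add: x_def)
      then show ?thesis using grid that by (simp add: slot_grid_def)
    qed
    have xl: "length (x i \<eta>) = k i" if "i < n" for i \<eta>
      using pat[OF that] definable_length[OF X[OF that]]
      by (cases "\<eta> \<in> paths (d i) N") (auto simp: slot_pattern_def x_def)
    define pt where "pt g e i = x i (\<lambda>s\<in>{..<d i}. g (i, s) e)" for g :: "nat \<times> nat \<Rightarrow> nat \<Rightarrow> nat" and e i
    \<comment> \<open>The family of truth patterns that varying \<open>y\<close> produces on the
      \<open>D\<close> points \<open>pt g e\<close>.\<close>
    define col where "col g = {S. S \<subseteq> {..<D} \<and>
      (\<exists>y. length y = k t \<and> (\<forall>e<D. join n ((pt g e)(t := y)) \<in> Y \<longleftrightarrow> e \<in> S))}" for g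
    have colC: "col g \<in> Pow (Pow {..<D})" for g by (auto simp: col_def)
    have dep: "col g = col g'" if "\<And>i t. i \<in> I \<Longrightarrow> t < D \<Longrightarrow> g i t = g' i t" for g g'
    proof -
      have "pt g e i = pt g' e i" if "e < D" "i < n" "i \<noteq> t" for e i
        unfolding pt_def using that \<open>\<And>i t. i \<in> I \<Longrightarrow> t < D \<Longrightarrow> g i t = g' i t\<close>
        by (intro arg_cong[where f = "x i"] restrict_ext) (auto simp: I_def)
      then have "join n ((pt g e)(t := y)) = join n ((pt g' e)(t := y))" if "e < D" for e y
        using that by (intro join_cong) auto
      then show ?thesis by (simp add: col_def)
    qed
    obtain h v where hv: "\<forall>i\<in>I. strict_mono_on {..<K'} (h i) \<and> h i ` {..<K'} \<subseteq> {..<N}"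
        "\<forall>g. (\<forall>i\<in>I. strict_mono_on {..<D} (g i) \<and> g i ` {..<D} \<subseteq> {..<K'}) \<longrightarrow>
           col (\<lambda>i t. h i (g i t)) = v"
      using ramsey[of col, OF colC dep] by blast
    \<comment> \<open>Grid \<open>e\<close> uses the \<open>K\<close> positions from
      \<open>2 * e * K\<close> on, and the point \<open>z e\<close> the position
      \<open>(2 * e + 1) * K\<close> directly after them.\<close>
    define F where "F e = (2 * e + 1) * K" for e :: nat
    define G where "G e j = 2 * e * K + j" for e j :: nat
    have FG: "F e < K'" "j < K \<Longrightarrow> G e j < F e" "F e < G (Suc e) j" "j < K \<Longrightarrow> G e j < K'" if "e < D" for e j
    proof -
      have "(e + 1) * K \<le> D * K" using that by (intro mult_le_mono1) simp
      then show "F e < K'" "j < K \<Longrightarrow> G e j < F e" "F e < G (Suc e) j" "j < K \<Longrightarrow> G e j < K'"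
        using K that by (auto simp: F_def G_def K'_def algebra_simps)
    qed
    have hN: "h (i, s) u < N" if "i < n" "i \<noteq> t" "s < d i" "u < K'" for i s u
    proof -
      have "(i, s) \<in> I" using that by (simp add: I_def)
      then show ?thesis using hv(1) that(4) by blast
    qed
    define z where "z e i = (if i = t then replicate (k t) undefined else x i (\<lambda>s\<in>{..<d i}. h (i, s) (F e)))" for e i
    define c' where "c' \<tau> i s j = c i s (h (i, s) (G \<tau> j))" for \<tau> i s j
    define x' where "x' \<tau> i \<eta> = x i (\<lambda>s\<in>{..<d i}. h (i, s) (G \<tau> (\<eta> s)))" for \<tau> i \<eta>
    \<comment> \<open>Constant paths in slot \<open>t\<close>; row 0, which exists by
      \<open>d t \<ge> 1\<close>, tells these elements apart.\<close>
    define b where "b j = x t (\<lambda>s\<in>{..<d t}. j)" for j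
    have part1: "slot_pattern K (d i) (X i) (\<Phi> i) (l i) (c' \<tau> i) (x' \<tau> i)"
      if \<tau>: "\<tau> < D" and i: "i < n" "i \<noteq> t" for \<tau> i
      unfolding slot_pattern_def
    proof (intro conjI ballI)
      fix s j assume "s \<in> {..<d i}" "j \<in> {..<K}"
      then show "length (c' \<tau> i s j) = l i s"
        using pat[OF i(1)] hN[OF i] FG(4)[OF \<tau>] by (simp add: slot_pattern_def c'_def)
    next
      fix \<eta> assume \<eta>: "\<eta> \<in> paths (d i) K"
      define \<eta>' where "\<eta>' = (\<lambda>s\<in>{..<d i}. h (i, s) (G \<tau> (\<eta> s)))"
      have \<eta>': "\<eta>' \<in> paths (d i) N"
        using hN[OF i] FG(4)[OF \<tau>] paths_less[OF \<eta>] by (auto simp: \<eta>'_def)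
      then show "x' \<tau> i \<eta> \<in> X i"
        using pat[OF i(1)] by (simp add: slot_pattern_def x'_def \<eta>'_def)
      fix s j assume sj: "s \<in> {..<d i}" "j \<in> {..<K}"
      have "(i, s) \<in> I" using sj i by (simp add: I_def)
      then have "inj_on (h (i, s)) {..<K'}" using hv(1) strict_mono_on_imp_inj_on by blast
      moreover have "G \<tau> j < K'" "G \<tau> (\<eta> s) < K'"
        using FG(4)[OF \<tau>] paths_less[OF \<eta>] sj by auto
      ultimately have "h (i, s) (G \<tau> j) = h (i, s) (G \<tau> (\<eta> s)) \<longleftrightarrow> j = \<eta> s"
        by (auto simp: inj_on_eq_iff G_def)
      moreover have "h (i, s) (G \<tau> j) < N" using hN[OF i] sj FG(4)[OF \<tau>] by simp
      ultimately show "x' \<tau> i \<eta> @ c' \<tau> i s j \<in> \<Phi> i s \<longleftrightarrow> j = \<eta> s"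
        using pat[OF i(1)] \<eta>' sj by (simp add: slot_pattern_def x'_def c'_def \<eta>'_def)
    qed
    have bpath: "(\<lambda>s\<in>{..<d t}. j) \<in> paths (d t) N" if "j < K" for j
      using that \<open>K' \<le> N\<close> by (auto simp: K'_def)
    have part2: "b j \<in> X t" "j' < j \<Longrightarrow> b j \<noteq> b j'" "e < D \<Longrightarrow> join n ((z e)(t := b j)) \<in> Y"
      if j: "j < K" for j j' e
    proof -
      have 1: "x t (\<lambda>s\<in>{..<d t}. j) \<in> X t" if "j < K" for j
        using pat[OF t(1)] bpath[OF that] by (auto simp: slot_pattern_def)
      then show "b j \<in> X t" using j by (simp add: b_def)
      have 2: "b i @ c t 0 j \<in> \<Phi> t 0 \<longleftrightarrow> j = i" if "i < K" for i
        using pat[OF t(1)] bpath[OF that] t(2) j \<open>K' \<le> N\<close>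
        by (auto simp: slot_pattern_def b_def K'_def)
      show "b j \<noteq> b j'" if "j' < j" using 2[of j] 2[of j'] that j by auto
      show "join n ((z e)(t := b j)) \<in> Y" if e: "e < D"
      proof -
        define \<eta> where "\<eta> i = (if i = t then (\<lambda>s\<in>{..<d t}. j) else (\<lambda>s\<in>{..<d i}. h (i, s) (F e)))" for i
        have "(z e)(t := b j) = (\<lambda>i. x i (\<eta> i))" by (auto simp: z_def b_def \<eta>_def)
        moreover have "\<eta> i \<in> paths (d i) N" if "i < n" for i
          using bpath[OF j] hN[OF that] FG(1)[OF e] by (auto simp: \<eta>_def)
        ultimately show ?thesis using gridY by simp
      qed
    qed
    have part3: "\<exists>\<tau><D. \<forall>\<eta>\<in>PiE {..<n} (\<lambda>i. paths (d i) K). join n ((\<lambda>i. x' \<tau> i (\<eta> i))(t := y)) \<in> Y"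
      if y: "length y = k t" "\<And>e. e < D \<Longrightarrow> join n ((z e)(t := y)) \<in> Y" for y
    proof (rule ccontr)
      assume "\<not> ?thesis"
      then have "\<exists>\<eta>. \<eta> \<in> PiE {..<n} (\<lambda>i. paths (d i) K) \<and>
          join n ((\<lambda>i. x' \<tau> i (\<eta> i))(t := y)) \<notin> Y" if "\<tau> < D" for \<tau>
        using that by blast
      then obtain \<eta> where \<eta>: "\<And>\<tau>. \<tau> < D \<Longrightarrow> \<eta> \<tau> \<in> PiE {..<n} (\<lambda>i. paths (d i) K)"
          "\<And>\<tau>. \<tau> < D \<Longrightarrow> join n ((\<lambda>i. x' \<tau> i (\<eta> \<tau> i))(t := y)) \<notin> Y"
        by metis
      define g where "g S r e = (if e \<in> S then F e else G e (\<eta> e (fst r) (snd r)))"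
        for S and r :: "nat \<times> nat" and e
      have \<eta>K: "\<eta> e i s < K" if "e < D" "i < n" "s < d i" for e i s
        using \<eta>(1)[OF that(1)] that(2,3) by (auto simp: PiE_def Pi_def)
      have gK: "strict_mono_on {..<D} (g S r) \<and> g S r ` {..<D} \<subseteq> {..<K'}" if r: "r \<in> I" for S r
      proof
        obtain i s where is': "r = (i, s)" "i < n" "s < d i" using r by (auto simp: I_def)
        show "strict_mono_on {..<D} (g S r)"
        proof (rule strict_mono_on_lessThanI)
          fix e assume e: "Suc e < D"
          have "g S r e \<le> F e"
            using FG(2)[of e "\<eta> e i s"] \<eta>K[of e i s] is' e by (auto simp: g_def)
          also have "F e < g S r (Suc e)"
            using FG(3)[of e 0] FG(3)[of e "\<eta> (Suc e) i s"] e is' by (auto simp: g_def F_def G_def)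
          finally show "g S r e < g S r (Suc e)" .
        qed
        show "g S r ` {..<D} \<subseteq> {..<K'}"
          using FG(1,4) \<eta>K is' by (auto simp: g_def)
      qed
      then have colv: "col (\<lambda>r e. h r (g S r e)) = v" for S using hv(2) by blast
      have "S \<in> v" if S: "S \<subseteq> {..<D}" for S
      proof -
        have "join n ((pt (\<lambda>r e. h r (g S r e)) e)(t := y)) \<in> Y \<longleftrightarrow> e \<in> S" if e: "e < D" for e
        proof (cases "e \<in> S")
          case True
          then have "join n ((pt (\<lambda>r e. h r (g S r e)) e)(t := y)) = join n ((z e)(t := y))"
            by (intro join_cong) (simp add: pt_def z_def g_def)
          then show ?thesis using y(2)[OF e] True by simp
        next
          case False
          then have "join n ((pt (\<lambda>r e. h r (g S r e)) e)(t := y)) = join n ((\<lambda>i. x' e i (\<eta> e i))(t := y))"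
            by (intro join_cong) (simp add: pt_def x'_def g_def)
          then show ?thesis using \<eta>(2)[OF e] False by simp
        qed
        then have "S \<in> col (\<lambda>r e. h r (g S r e))" using y(1) S by (auto simp: col_def)
        then show ?thesis by (simp add: colv)
      qed
      moreover have "length (pt (\<lambda>r e. h r (g {} r e)) e i) = k i" if "i < n" for e i
        by (simp add: pt_def xl[OF that])
      ultimately obtain S where S: "S \<subseteq> {..<D}" "S \<in> v" "\<And>y. length y = k t \<Longrightarrow>
          \<not> (\<forall>e<D. join n ((pt (\<lambda>r e. h r (g {} r e)) e)(t := y)) \<in> Y \<longleftrightarrow> e \<in> S)"
        using D[rule_format, of "pt (\<lambda>r e. h r (g {} r e))"] by auto
      have "S \<in> col (\<lambda>r e. h r (g {} r e))" using S(2) by (simp add: colv)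
      then show False using S(3) unfolding col_def by auto
    qed
    have "spread K D n t (k t) d X Y \<Phi> l z c' x' b"
      unfolding spread_def
    proof (intro conjI allI impI)
      fix y assume "length y = k t" "\<forall>e\<in>{..<D}. join n ((z e)(t := y)) \<in> Y"
      then have "\<exists>\<tau><D. \<forall>\<eta>\<in>PiE {..<n} (\<lambda>i. paths (d i) K). join n ((\<lambda>i. x' \<tau> i (\<eta> i))(t := y)) \<in> Y"
        by (intro part3) auto
      then show "\<exists>\<tau>\<in>{..<D}. \<forall>\<eta>\<in>PiE {..<n} (\<lambda>i. paths (d i) K). join n ((\<lambda>i. x' \<tau> i (\<eta> i))(t := y)) \<in> Y"
        by blast
    qed (use part1 part2 in auto)
    moreover have "length (z e i) = k i" "length (x' \<tau> i \<eta>) = k i" if "i < n" for e i \<tau> \<eta>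
      using xl[OF that] that by (auto simp: z_def x'_def)
    moreover have "length (b j) = k t" for j using xl[OF t(1)] by (simp add: b_def)
    ultimately show ?thesis by blast
  qed
qed

context saturated_structure
begin

text \<open>Compactness makes \<open>z\<close> independent of \<open>K\<close>: the points are the
  free variables, while for each \<open>K\<close> the grids and the sequence are quantified. Hence
  the elements compatible with \<open>z\<close> will form an infinite set.\<close>

lemma spread_uniform:
  assumes grids: "\<And>K. \<exists>c x. slot_grid K n d X Y \<Phi> l c x"
    and \<Phi>: "\<And>i s. i < n \<Longrightarrow> s < d i \<Longrightarrow> definable L M (k i + l i s) (\<Phi> i s)"
    and X: "\<And>i. i < n \<Longrightarrow> definable L M (k i) (X i)"
    and Y: "definable L M (\<Sum>i<n. k i) Y"
    and t: "t < n" "d t \<ge> 1" and nip: "NIP L M"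
  shows "\<exists>D z. \<forall>K. \<exists>c x b. spread K D n t (k t) d X Y \<Phi> l z c x b"
proof -
  obtain D :: nat where D: "\<forall>w. (\<forall>e<D. \<forall>i<n. i \<noteq> t \<longrightarrow> length (w e i) = k i) \<longrightarrow>
      (\<exists>S\<subseteq>{..<D::nat}. \<forall>y. length y = k t \<longrightarrow> \<not> (\<forall>e<D. join n ((w e)(t := y)) \<in> Y \<longleftrightarrow> e \<in> S))"
    using NIP_join[OF nip Y t(1)] by (elim exE) (rule that)
  define len :: "nat \<times> nat \<Rightarrow> nat" where "len = (\<lambda>(e, i). k i)"
  define len' where "len' = (\<lambda>w. case w of Par \<tau> i s j \<Rightarrow> l i s | Elt \<tau> i \<eta> \<Rightarrow> k i | Seq j \<Rightarrow> k t)"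
  define P where "P K E \<longleftrightarrow> (\<exists>E'. (\<forall>w. length (E' w) = len' w) \<and>
      spread K D n t (k t) d X Y \<Phi> l (\<lambda>e i. E (e, i)) (\<lambda>\<tau> i s j. E' (Par \<tau> i s j))
        (\<lambda>\<tau> i \<eta>. E' (Elt \<tau> i \<eta>)) (\<lambda>j. E' (Seq j)))" for K E
  have "dfn L M len (P K)" for K
  proof -
    have "dfn L M (case_sum len len') (\<lambda>F. spread K D n t (k t) d X Y \<Phi> l (\<lambda>e i. F (Inl (e, i)))
        (\<lambda>\<tau> i s j. F (Inr (Par \<tau> i s j))) (\<lambda>\<tau> i \<eta>. F (Inr (Elt \<tau> i \<eta>))) (\<lambda>j. F (Inr (Seq j))))"
      unfolding spread_def slot_pattern_def join_def fun_upd_def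
      by (intro dfn_intros dfn_ball dfn_bex dfn_all dfn_mem[OF X] dfn_mem[OF Y] dfn_mem[OF \<Phi>]
          dfn_length tuple_term_intros finite_paths finite_PiE finite_lessThan finite_Diff) (use t in auto)
    from dfn_ex_env[OF this] show ?thesis by (simp add: P_def[abs_def])
  qed
  moreover have "\<exists>E. (\<forall>v. length (E v) = len v) \<and> (\<forall>i<N. P i E)" for N
  proof -
    \<comment> \<open>Size \<open>Suc N\<close> is positive, as \<open>spread_exists\<close>
      demands, and covers all smaller sizes by \<open>spread_mono\<close>.\<close>
    have "\<exists>z c x b. (\<forall>e i. i < n \<longrightarrow> length (z e i) = k i) \<and>
        (\<forall>\<tau> i \<eta>. i < n \<longrightarrow> length (x \<tau> i \<eta>) = k i) \<and> (\<forall>j. length (b j) = k t) \<and>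
        spread (Suc N) D n t (k t) d X Y \<Phi> l z c x b"
      by (rule spread_exists[OF grids X t D]) simp_all
    then obtain z c x b where zl: "\<forall>e i. i < n \<longrightarrow> length (z e i) = k i"
      and xl: "\<forall>\<tau> i \<eta>. i < n \<longrightarrow> length (x \<tau> i \<eta>) = k i" and bl: "\<forall>j. length (b j) = k t"
      and spread: "spread (Suc N) D n t (k t) d X Y \<Phi> l z c x b"
      by (elim exE conjE) (rule that)
    define E where "E = (\<lambda>(e, i). if i < n then z e i else replicate (k i) undefined)"
    define E' where "E' w = (case w of
        Par \<tau> i s j \<Rightarrow> if length (c \<tau> i s j) = l i s then c \<tau> i s j else replicate (l i s) undefined
      | Elt \<tau> i \<eta> \<Rightarrow> if i < n then x \<tau> i \<eta> else replicate (k i) undefined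
      | Seq j \<Rightarrow> b j)" for w
    have 1: "join n ((\<lambda>i. E (e, i))(t := y)) = join n ((z e)(t := y))" for e y
      by (intro join_cong) (simp add: E_def)
    have 2: "join n ((\<lambda>i. E' (Elt \<tau> i (\<eta> i)))(t := y)) = join n ((\<lambda>i. x \<tau> i (\<eta> i))(t := y))" for \<tau> \<eta> y
      by (intro join_cong) (simp add: E'_def)
    have 3: "slot_pattern (Suc N) (d i) (X i) (\<Phi> i) (l i) (\<lambda>s j. E' (Par \<tau> i s j)) (\<lambda>\<eta>. E' (Elt \<tau> i \<eta>))"
      if "slot_pattern (Suc N) (d i) (X i) (\<Phi> i) (l i) (c \<tau> i) (x \<tau> i)" "i < n" for i \<tau>
      using that by (simp add: slot_pattern_def E'_def)
    have "spread (Suc N) D n t (k t) d X Y \<Phi> l (\<lambda>e i. E (e, i)) (\<lambda>\<tau> i s j. E' (Par \<tau> i s j))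
        (\<lambda>\<tau> i \<eta>. E' (Elt \<tau> i \<eta>)) (\<lambda>j. E' (Seq j))"
    proof -
      have "E' (Seq j) = b j" for j by (simp add: E'_def)
      moreover have "slot_pattern (Suc N) (d i) (X i) (\<Phi> i) (l i)
          (\<lambda>s j. E' (Par \<tau> i s j)) (\<lambda>\<eta>. E' (Elt \<tau> i \<eta>))" if "\<tau> < D" "i \<in> {..<n} - {t}" for i \<tau>
        using spread that unfolding spread_def by (intro 3) auto
      ultimately show ?thesis
        using spread unfolding spread_def 1 2 by simp
    qed
    moreover have "length (E' w) = len' w" for w
      using xl bl by (simp add: E'_def len'_def split: grid_index.split)
    ultimately have "P K E" if "K < N" for K
      unfolding P_def using spread_mono[of K "Suc N"] that by (intro exI[of _ E']) auto
    moreover have "length (E v) = len v" for v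
      using zl by (auto simp: E_def len_def split: prod.splits)
    ultimately show ?thesis by blast
  qed
  ultimately obtain E where "\<And>K. P K E"
    by (rule dfn_compactness[OF saturated natLeq_less, of len P]) (rule that)
  then show ?thesis
    unfolding P_def by blast
qed

text \<open>Slot \<open>t\<close> receives a pattern inside the set \<open>W\<close> of elements of
  \<open>X t\<close> compatible with all \<open>z e\<close>. Each of its witnesses is compatible
  with a whole grid in the other slots, and after thinning by Ramsey it is the same grid for all
  paths.\<close>

lemma has_slot_grids_step:
  assumes grids: "has_slot_grids n k d X Y" and d: "\<And>i. i < n \<Longrightarrow> d i \<ge> 1"
    and X: "\<And>i. i < n \<Longrightarrow> definable L M (k i) (X i)"
    and Y: "definable L M (\<Sum>i<n. k i) Y"
    and t: "t < n" and r: "r \<ge> 1" and nip: "NIP L M"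
    and inf: "\<And>W. definable L M (k t) W \<Longrightarrow> W \<subseteq> X t \<Longrightarrow> infinite W \<Longrightarrow>
      has_ict_pattern L M (k t) W r"
  shows "has_slot_grids n k (d(t := r)) X Y"
proof -
  obtain \<Phi> l where \<Phi>: "\<And>i s. i < n \<Longrightarrow> s < d i \<Longrightarrow> definable L M (k i + l i s) (\<Phi> i s)"
    and grid: "\<And>K. \<exists>c x. slot_grid K n d X Y \<Phi> l c x"
    using grids unfolding has_slot_grids_def by blast
  have "\<exists>D z. \<forall>K. \<exists>c x b. spread K D n t (k t) d X Y \<Phi> l z c x b"
    by (rule spread_uniform[OF grid \<Phi> X Y t d[OF t] nip])
  then obtain D z where spread: "\<And>K. \<exists>c x b. spread K D n t (k t) d X Y \<Phi> l z c x b"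
    by blast
  define W where "W = {y. length y = k t \<and> (y \<in> X t \<and> (\<forall>e\<in>{..<D}. join n ((z e)(t := y)) \<in> Y))}"
  have W: "definable L M (k t) W"
    unfolding W_def join_def fun_upd_def
    by (intro definable_dfn dfn_intros dfn_ball dfn_mem[OF X[OF t]] dfn_mem[OF Y] tuple_term_intros
        finite_lessThan)
  \<comment> \<open>\<open>W\<close> contains sequences \<open>b\<close> of distinct elements of
    every finite length.\<close>
  have "infinite W"
  proof
    assume fin: "finite W"
    obtain c x b where sp: "spread (Suc (card W)) D n t (k t) d X Y \<Phi> l z c x b" using spread by blast
    have bW: "b j \<in> W \<and> (\<forall>j'<j. b j \<noteq> b j')" if "j < Suc (card W)" for j
      using sp that definable_length[OF X[OF t]] unfolding spread_def W_def by auto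
    have "inj_on b {..<Suc (card W)}"
    proof (rule linorder_inj_onI)
      show "b x \<noteq> b y" if "x < y" "y \<in> {..<Suc (card W)}" for x y
        using bW[of y] that by auto
    qed auto
    moreover have "b ` {..<Suc (card W)} \<subseteq> W" using bW by auto
    ultimately have "card {..<Suc (card W)} \<le> card W" using fin by (metis card_inj_on_le)
    then show False by simp
  qed
  then have "has_ict_pattern L M (k t) W r"
    using inf[OF W] by (auto simp: W_def)
  then obtain \<Psi> m e where \<Psi>: "\<And>s. s < r \<Longrightarrow> definable L M (k t + m s) (\<Psi> s)"
    and m: "\<And>s j. s < r \<Longrightarrow> length (e s j) = m s"
    and "\<And>\<eta> :: nat \<Rightarrow> nat. \<exists>y\<in>W. \<forall>s<r. \<forall>j. y @ e s j \<in> \<Psi> s \<longleftrightarrow> j = \<eta> s"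
    using W by (rule has_ict_patternE) blast
  then obtain y where yW: "\<And>\<eta>. y \<eta> \<in> W"
    and y\<Psi>: "\<And>\<eta> s j. s < r \<Longrightarrow> y \<eta> @ e s j \<in> \<Psi> s \<longleftrightarrow> j = (\<eta> s :: nat)"
    by metis
  have yl: "length (y \<eta>) = k t" "y \<eta> \<in> X t" for \<eta> using yW[of \<eta>] by (auto simp: W_def)
  \<comment> \<open>Size \<open>Suc K\<close> ensures that the constant path 0 exists; it is needed
    to see \<open>v < D\<close> and as a filler in coordinate \<open>t\<close>.\<close>
  have step: "\<exists>c x. slot_grid (Suc K) n (d(t := r)) X Y (\<Phi>(t := \<Psi>)) (l(t := m)) c x" for K
  proof -
    obtain c x b where sp: "spread (Suc K) D n t (k t) d X Y \<Phi> l z c x b" using spread by blast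
    have "\<exists>\<tau><D. \<forall>\<eta>'\<in>PiE {..<n} (\<lambda>i. paths (d i) (Suc K)). join n ((\<lambda>i. x \<tau> i (\<eta>' i))(t := y \<eta>)) \<in> Y" for \<eta>
      using sp yW[of \<eta>] yl[of \<eta>] unfolding spread_def W_def by auto
    then obtain \<tau> where \<tau>: "\<And>\<eta>. \<tau> \<eta> < D" "\<And>\<eta> \<eta>'. \<eta>' \<in> PiE {..<n} (\<lambda>i. paths (d i) (Suc K)) \<Longrightarrow>
        join n ((\<lambda>i. x (\<tau> \<eta>) i (\<eta>' i))(t := y \<eta>)) \<in> Y"
      by metis
    \<comment> \<open>A path uses one point per row, so colouring paths is the case
      \<open>w = 1\<close> of the product Ramsey theorem.\<close>
    define col where "col g = \<tau> (\<lambda>s\<in>{..<r}. g s 0)" for g :: "nat \<Rightarrow> nat \<Rightarrow> nat"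
    have "\<exists>v. \<forall>K::nat. \<exists>h. (\<forall>s\<in>{..<r}. strict_mono_on {..<K} (h s)) \<and>
        (\<forall>g. (\<forall>s\<in>{..<r}. strict_mono_on {..<1} (g s) \<and> g s ` {..<1} \<subseteq> {..<K}) \<longrightarrow>
          col (\<lambda>s t. h s (g s t)) = v)"
    proof (rule product_ramsey_uniform[where C = "{..<D}"])
      show "col g = col g'" if "\<And>i t. i \<in> {..<r} \<Longrightarrow> t < 1 \<Longrightarrow> g i t = g' i t" for g g'
        unfolding col_def using that by (intro arg_cong[where f = \<tau>] restrict_ext) auto
    qed (use \<tau>(1) in \<open>auto simp: col_def\<close>)
    then obtain v h where hv: "\<forall>s\<in>{..<r}. strict_mono_on {..<Suc K} (h s)"
        "\<forall>g. (\<forall>s\<in>{..<r}. strict_mono_on {..<1} (g s) \<and> g s ` {..<1} \<subseteq> {..<Suc K}) \<longrightarrow>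
          col (\<lambda>s t. h s (g s t)) = v"
      by blast
    then have h: "\<And>s. s < r \<Longrightarrow> strict_mono_on {..<Suc K} (h s)"
      and v: "\<And>g. (\<forall>s\<in>{..<r}. strict_mono_on {..<1} (g s) \<and> g s ` {..<1} \<subseteq> {..<Suc K}) \<Longrightarrow>
          col (\<lambda>s t. h s (g s t)) = v"
      by simp_all
    define \<eta>h where "\<eta>h \<eta> = (\<lambda>s\<in>{..<r}. h s (\<eta> s))" for \<eta>
    have \<tau>v: "\<tau> (\<eta>h \<eta>) = v" if "\<eta> \<in> paths r (Suc K)" for \<eta>
    proof -
      have "col (\<lambda>s t. h s (\<eta> s)) = v"
        by (rule v) (use paths_less[OF that] in \<open>auto simp: strict_mono_on_def\<close>)
      then show ?thesis by (simp add: col_def \<eta>h_def)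
    qed
    have "(\<lambda>s\<in>{..<r}. 0) \<in> paths r (Suc K)" by auto
    from \<tau>v[OF this] have vD: "v < D" using \<tau>(1) by metis
    define c' where "c' i s j = (if i = t then e s (h s j) else c v i s j)" for i s j
    define x' where "x' i \<eta> = (if i = t then y (\<eta>h \<eta>) else x v i \<eta>)" for i \<eta>
    have "slot_pattern (Suc K) ((d(t := r)) i) (X i) ((\<Phi>(t := \<Psi>)) i) ((l(t := m)) i) (c' i) (x' i)"
      if i: "i < n" for i
    proof (cases "i = t")
      case True
      have "h s j = h s (\<eta> s) \<longleftrightarrow> j = \<eta> s"
        if "\<eta> \<in> paths r (Suc K)" "s < r" "j < Suc K" for \<eta> s j
        using strict_mono_on_imp_inj_on[OF h[OF that(2)]] paths_less[OF that(1,2)] that(3)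
        by (auto simp: inj_on_eq_iff)
      then show ?thesis
        using True m yl y\<Psi> by (auto simp: slot_pattern_def c'_def x'_def \<eta>h_def)
    next
      case False
      then show ?thesis
        using sp i vD unfolding spread_def by (simp add: c'_def[abs_def] x'_def[abs_def])
    qed
    moreover have "join n (\<lambda>i. x' i (\<eta> i)) \<in> Y"
      if \<eta>: "\<forall>i<n. \<eta> i \<in> paths ((d(t := r)) i) (Suc K)" for \<eta>
    proof -
      \<comment> \<open>Coordinate \<open>t\<close> is overwritten by the new witness, so the path 0
        of the old depth is put there.\<close>
      define \<eta>' where "\<eta>' = (\<lambda>i\<in>{..<n}. if i = t then (\<lambda>s\<in>{..<d t}. 0) else \<eta> i)"
      have "\<eta>' i \<in> paths (d i) (Suc K)" if "i < n" for i
      proof (cases "i = t")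
        case True
        have "(\<lambda>s\<in>{..<d t}. 0) \<in> paths (d t) (Suc K)" by auto
        moreover have "\<eta>' t = (\<lambda>s\<in>{..<d t}. 0)" using t by (simp add: \<eta>'_def)
        ultimately show ?thesis using True by (simp only:)
      next
        case False
        then show ?thesis
          using \<eta>[rule_format, OF that] that False
          by (simp only: \<eta>'_def restrict_apply' lessThan_iff if_False fun_upd_other[OF False])
      qed
      then have "\<eta>' \<in> PiE {..<n} (\<lambda>i. paths (d i) (Suc K))"
      proof (rule PiE_I)
        show "\<eta>' i = undefined" if "i \<notin> {..<n}" for i using that by (simp add: \<eta>'_def)
      qed (simp only: lessThan_iff)
      from \<tau>(2)[OF this, of "\<eta>h (\<eta> t)"]
      have "join n ((\<lambda>i. x v i (\<eta>' i))(t := y (\<eta>h (\<eta> t)))) \<in> Y"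
        using \<tau>v[of "\<eta> t"] \<eta>[rule_format, OF t] by (simp only: fun_upd_same)
      moreover have "join n (\<lambda>i. x' i (\<eta> i)) = join n ((\<lambda>i. x v i (\<eta>' i))(t := y (\<eta>h (\<eta> t))))"
        by (intro join_cong) (simp add: x'_def \<eta>'_def)
      ultimately show ?thesis by simp
    qed
    ultimately show ?thesis
      unfolding slot_grid_def by (intro exI[of _ c'] exI[of _ x']) blast
  qed
  have "\<exists>c x. slot_grid K n (d(t := r)) X Y (\<Phi>(t := \<Psi>)) (l(t := m)) c x" for K
  proof -
    obtain c x where "slot_grid (Suc K) n (d(t := r)) X Y (\<Phi>(t := \<Psi>)) (l(t := m)) c x"
      using step by blast
    then have "slot_grid K n (d(t := r)) X Y (\<Phi>(t := \<Psi>)) (l(t := m)) c x"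
      by (rule slot_grid_mono[rotated]) simp
    then show ?thesis by blast
  qed
  moreover have "definable L M (k i + (l(t := m)) i s) ((\<Phi>(t := \<Psi>)) i s)"
    if "i < n" "s < (d(t := r)) i" for i s
    using that \<Phi> \<Psi> by (cases "i = t") auto
  ultimately show ?thesis
    unfolding has_slot_grids_def by (intro exI[of _ "\<Phi>(t := \<Psi>)"] exI[of _ "l(t := m)"]) blast
qed

text \<open>Broadness gives slots of depth 1. They are upgraded to depth \<open>r i\<close> one
  after the other, and the final grids combine into the pattern.\<close>

lemma full_rank_of_broad:
  assumes X: "\<And>i. i < n \<Longrightarrow> definable L M (k i) (X i)"
    and Y: "definable L M (\<Sum>i<n. k i) Y" and nip: "NIP L M"
    and r: "\<And>i. i < n \<Longrightarrow> r i \<ge> 1"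
    and inf: "\<And>i W. i < n \<Longrightarrow> definable L M (k i) W \<Longrightarrow> W \<subseteq> X i \<Longrightarrow> infinite W \<Longrightarrow>
      has_ict_pattern L M (k i) W (r i)"
    and "broad n X Y"
  shows "has_ict_pattern L M (\<Sum>i<n. k i) Y (\<Sum>i<n. r i)"
proof (rule has_ict_pattern_slot_grids[OF X Y], assumption)
  have "has_slot_grids n k (\<lambda>i. if i < t then r i else 1) X Y" if "t \<le> n" for t
    using that
  proof (induction t)
    case 0
    show ?case using has_slot_grids_broad[OF X \<open>broad n X Y\<close>] by simp
  next
    case (Suc t)
    have "has_slot_grids n k ((\<lambda>i. if i < t then r i else 1)(t := r t)) X Y"
      by (rule has_slot_grids_step) (use Suc X Y nip r inf in auto)
    moreover have "(\<lambda>i. if i < t then r i else 1)(t := r t) = (\<lambda>i. if i < Suc t then r i else 1)"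
      by (auto simp: less_Suc_eq)
    ultimately show ?case by simp
  qed
  \<comment> \<open>For \<open>t = n\<close> the depths agree with \<open>r\<close> at all
    \<open>i < n\<close>, and no other slots are inspected.\<close>
  from this[of n] show "has_slot_grids n k r X Y"
    unfolding has_slot_grids_def slot_grid_def by simp
qed

end

text \<open>An infinite definable set has rank at least 1, so quasi-minimality leaves only the value
  \<open>r\<close>.\<close>

lemma quasi_minimal_infinite:
  assumes "quasi_minimal L M p D" "dp_rank L M p D = enat r" "saturated_structure \<kappa> L M"
    and W: "definable L M p W" "W \<subseteq> D" "infinite W"
  shows "has_ict_pattern L M p W r"
proof -
  have r: "r > 0" "dp_rank L M p W = 0 \<or> dp_rank L M p W = enat r"
    using assms(1,2) W unfolding quasi_minimal_def by auto
  have "has_ict_pattern L M p W 1"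
    by (rule saturated_structure.has_ict_pattern_infinite[OF assms(3) W(1,3)])
  then have "dp_rank L M p W \<noteq> 0"
    using has_ict_pattern_le_dp_rank[of L M p W 0 1] by (auto simp: zero_enat_def)
  then show ?thesis
    using r has_ict_pattern_dp_rank by blast
qed

section \<open>Equivalence of broadness and full rank\<close>

theorem theorem3p21:
  fixes L :: "('f, 'r) language" and M :: "('f, 'r, 'a) struct" and \<kappa> :: "'k rel"
    and n :: nat and k r :: "nat \<Rightarrow> nat"
    and X :: "nat \<Rightarrow> 'a list set" and Y :: "'a list set"
  assumes "monster_model \<kappa> L M"
    and "NIP L M"
    and "n \<ge> 1"
    and "\<And>i. i < n \<Longrightarrow> quasi_minimal L M (k i) (X i)"
    and "\<And>i. i < n \<Longrightarrow> dp_rank L M (k i) (X i) = enat (r i)"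
    and "definable L M (\<Sum>i<n. k i) Y"
    and "Y \<subseteq> product n X"
  shows "broad n X Y \<longleftrightarrow> dp_rank L M (\<Sum>i<n. k i) Y = enat (\<Sum>i<n. r i)"
proof -
  interpret saturated_structure \<kappa> L M
    using assms(1) unfolding monster_model_def by unfold_locales auto
  have X: "definable L M (k i) (X i)" and r: "r i > 0" if "i < n" for i
    using assms(4,5)[OF that] unfolding quasi_minimal_def by auto
  have upper: "m \<le> (\<Sum>i<n. r i)" if "has_ict_pattern L M (\<Sum>i<n. k i) Y m" for m
    using X assms(5,7) that by (rule dp_rank_product_le)
  show ?thesis
  proof
    assume "broad n X Y"
    have "has_ict_pattern L M (\<Sum>i<n. k i) Y (\<Sum>i<n. r i)"
    proof (rule full_rank_of_broad[OF X assms(6,2) _ _ \<open>broad n X Y\<close>])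
      show "has_ict_pattern L M (k i) W (r i)"
        if "i < n" "definable L M (k i) W" "W \<subseteq> X i" "infinite W" for i W
        using assms(4,5)[OF that(1)] saturated_structure_axioms that(2-4)
        by (rule quasi_minimal_infinite)
    qed (use r in \<open>auto simp: Suc_le_eq\<close>)
    then show "dp_rank L M (\<Sum>i<n. k i) Y = enat (\<Sum>i<n. r i)"
      using upper by (rule dp_rank_eqI)
  next
    assume rank: "dp_rank L M (\<Sum>i<n. k i) Y = enat (\<Sum>i<n. r i)"
    \<comment> \<open>Since \<open>n \<ge> 1\<close>, the sum is positive, so the rank is witnessed
      by a pattern of that depth.\<close>
    have "r 0 \<le> (\<Sum>i<n. r i)"
      using assms(3) by (intro member_le_sum) auto
    then have "(\<Sum>i<n. r i) > 0" using r[of 0] assms(3) by simp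
    with rank have full: "has_ict_pattern L M (\<Sum>i<n. k i) Y (\<Sum>i<n. r i)"
      by (rule has_ict_pattern_dp_rank)
    show "broad n X Y"
      using X assms(5) r assms(6,7) full by (rule broad_of_full_rank)
  qed
qed

end
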